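(* Consider the adaptive algorithm AFEM-PGMRES described in the context, run formally with $\tau<0$ so that the tolerance test never stops it. Suppose that the error estimator satisfies stability (A1), reduction (A2), and reliability (A3), and that the employed preconditioners satisfy the norm equivalence (PRE). Let $0<\theta\le1$, $C_{\rm mark}\ge1$, $u_0^0\in\mathcal X_0$, $\lambda_{\rm alg}>0$, and $C_{\rm alg}>0$ (and $k_{\max}\in\mathbb N$) be arbitrary. Then the parameters $C_{\rm alg}$ and $\lambda_{\rm alg}$ are updated in step (ii.a) of the algorithm only finitely many times.
   Context: **Model problem.** $\Omega\subset\mathbb R^d$ ($d\ge1$) is a polyhedral Lipschitz domain, $\mathcal X:=H^1_0(\Omega)$, $f\in L^2(\Omega)$, $\boldsymbol f\in[L^2(\Omega)]^d$, $\boldsymbol b\in[L^\infty(\Omega)]^d$ with $\operatorname{div}\boldsymbol b\in L^\infty(\Omega)$, $c\in L^\infty(\Omega)$, $-\operatorname{div}\boldsymbol b+2c\ge0$ a.e., and $\boldsymbol K\in[L^\infty(\Omega)]^{d\times d}$ symmetric with smallest eigenvalue uniformly bounded from below by a positive constant. Set $a(v,w):=\langle\boldsymbol K\nabla v,\nabla w\rangle_{L^2(\Omega)}$, $b(v,w):=a(v,w)+\langle\boldsymbol b\cdot\nabla v,w\rangle_{L^2(\Omega)}+\langle cv,w\rangle_{L^2(\Omega)}$, $F(v):=\langle f,v\rangle_{L^2(\Omega)}+\langle\boldsymbol f,\nabla v\rangle_{L^2(\Omega)}$, $|||v|||:=a(v,v)^{1/2}$. There are constants $0<C_{\rm ell}\le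 C_{\rm bnd}$ with $|b(v,w)|\le C_{\rm bnd}|||v|||\,|||w|||$ and $b(v,v)\ge C_{\rm ell}|||v|||^2$ on $\mathcal X$. The exact solution $u^\star\in\mathcal X$ satisfies $b(u^\star,v)=F(v)$ for all $v\in\mathcal X$. **Discretization.** $\mathcal T_0$ is a conforming simplicial triangulation of $\Omega$ (admissible for newest vertex bisection, NVB), and $\boldsymbol f|_T\in[H^1(T)]^d$, $\boldsymbol K|_T\in[W^{1,\infty}(T)]^{d\times d}$ for all $T\in\mathcal T_0$. $\mathbb T(\mathcal T_H)$ is the set of triangulations obtained from $\mathcal T_H$ by finitely many NVB steps; $\mathtt{refine}(\mathcal T_H,\mathcal M_H)$ is the coarsest NVB refinement of $\mathcal T_H$ in which all elements of $\mathcal M_H\subseteq\mathcal T_H$ are refined. For fixed $p\in\mathbb N$, $\mathcal X_H\subset H^1_0(\Omega)$ is the space of globally continuous $\mathcal T_H$-piecewise polynomials of degree $\le p$ vanishing on $\partial\Omega$. $u_H^\star\in\mathcal X_H$ is the Galerkin solution: $b(u_H^\star,v_H)=F(v_H)$ for all $v_H\in\mathcal X_H$. Index $\ell$ replaces $H$ for the mesh $\mathcal T_\ell$. **Estimator.** For $T\in\mathcal T_H$, $v_H\in\mathcal X_H$: $\eta_H(T,v_H)^2:=|T|^{2/d}\|\operatorname{div}(\boldsymbol K\nabla v_H-\boldsymbol f)-\boldsymbol b\cdot\nabla v_H-cv_H+f\|_{L^2(T)}^2+|T|^{1/d}\|[\![(\boldsymbol K\nabla v_H-\boldsymbol f)\cdot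 n]\!]\|^2_{L^2(\partial T\cap\Omega)}$, where $[\![\cdot]\!]$ is the jump over facets; $\eta_H(\mathcal U_H,v_H):=(\sum_{T\in\mathcal U_H}\eta_H(T,v_H)^2)^{1/2}$ for $\mathcal U_H\subseteq\mathcal T_H$, and $\eta_H(v_H):=\eta_H(\mathcal T_H,v_H)$. The axioms are, with constants $C_{\rm stab},C_{\rm rel}>0$, $0<q_{\rm red}<1$, for all $\mathcal T_H\in\mathbb T(\mathcal T_0)$, $\mathcal T_h\in\mathbb T(\mathcal T_H)$, $v_H\in\mathcal X_H$, $v_h\in\mathcal X_h$: (A1) $|\eta_h(\mathcal T_h\cap\mathcal T_H,v_h)-\eta_H(\mathcal T_h\cap\mathcal T_H,v_H)|\le C_{\rm stab}|||v_h-v_H|||$; (A2) $\eta_h(\mathcal T_h\setminus\mathcal T_H,v_H)\le q_{\rm red}\,\eta_H(\mathcal T_H\setminus\mathcal T_h,v_H)$; (A3) $|||u^\star-u_H^\star|||\le C_{\rm rel}\,\eta_H(u_H^\star)$. **Preconditioner.** Let $\varphi_{\ell,1},\dots,\varphi_{\ell,N_\ell}$ be a basis of $\mathcal X_\ell$, $(\mathbf B_\ell)_{jk}:=b(\varphi_{\ell,k},\varphi_{\ell,j})$, $(\mathbf d_\ell)_j:=F(\varphi_{\ell,j})$. $\mathbf P_\ell\in\mathbb R^{N_\ell\times N_\ell}$ is symmetric positive definite, $(\mathbf x,\mathbf y)_{\mathbf P_\ell^{-1}}:=(\mathbf P_\ell^{-1}\mathbf x,\mathbf y)_2$ with induced norm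 $\|\cdot\|_{\mathbf P_\ell^{-1}}$. (PRE): there is $C_{\rm pre}\ge1$, independent of $\ell$, the mesh size and $p$, with $C_{\rm pre}^{-1}|||v_\ell|||\le\|\mathbf x_\ell\|_{\mathbf P_\ell^{-1}}\le C_{\rm pre}|||v_\ell|||$ for all $v_\ell=\sum_j(\mathbf x_\ell)_j\varphi_{\ell,j}\in\mathcal X_\ell$. **PGMRES (preconditioned GMRES with restart length $k_{\max}\in\mathbb N$).** Given $\mathbf x_\ell^0$, iterates are defined for $k\ge1$ as follows: with $K:=((k-1)\bmod k_{\max})+1$ and $m:=k-K$ (the index of the last restart), $\mathbf x_\ell^k$ is the unique minimizer of $\|\mathbf P_\ell(\mathbf d_\ell-\mathbf B_\ell\mathbf x)\|_{\mathbf P_\ell^{-1}}$ over $\mathbf x\in\mathbf x_\ell^m+\operatorname{span}\{(\mathbf P_\ell\mathbf B_\ell)^i\mathbf s_\ell^m:0\le i<K\}$, where $\mathbf s_\ell^k:=\mathbf P_\ell(\mathbf d_\ell-\mathbf B_\ell\mathbf x_\ell^k)$ is the preconditioned residual. Write $u_\ell^k:=\sum_j(\mathbf x_\ell^k)_j\varphi_{\ell,j}$. **Algorithm AFEM-PGMRES.** Input: $\mathcal T_0$, $0<\theta\le1$, $C_{\rm mark}\ge1$, $u_0^0\in\mathcal X_0$, $C_{\rm alg},\lambda_{\rm alg}>0$, $k_{\max}\in\mathbb N$, tolerance $\tau$; set $\mathsf S:=0$. Write $\mathsf H_\ell^k:=\eta_\ell(u_\ell^k)+\|\mathbf s_\ell^k\|_{\mathbf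 P_\ell^{-1}}$. For $\ell=0,1,2,\dots$: (i) Starting from $u_\ell^0$, perform PGMRES steps $k=1,2,\dots$ until, for the first time, $\|\mathbf s_\ell^k\|_{\mathbf P_\ell^{-1}}\le\lambda_{\rm alg}\,\eta_\ell(u_\ell^k)$; set $\underline k[\ell]:=k$ (if this never happens, $\underline k[\ell]:=\infty$ and the algorithm iterates forever on level $\ell$). Write $\underline k=\underline k[\ell]$ in $u_\ell^{\underline k}$, $\mathsf H_\ell^{\underline k}$. (ii) If $\mathsf H_\ell^{\underline k}\le\tau$, stop. Otherwise: (a) if $\ell\ge1$ and $\mathsf S>C_{\rm alg}(\mathsf H_\ell^{\underline k})^{-1}$, replace $C_{\rm alg}$ by $2C_{\rm alg}$ and $\lambda_{\rm alg}$ by $\lambda_{\rm alg}/2$; (b) replace $\mathsf S$ by $\mathsf S+(\mathsf H_\ell^{\underline k})^{-1}$. (Convention $1/0=\infty$.) (iii) Choose $\mathcal M_\ell\subseteq\mathcal T_\ell$ with $\theta\eta_\ell(u_\ell^{\underline k})^2\le\eta_\ell(\mathcal M_\ell,u_\ell^{\underline k})^2$ and $\#\mathcal M_\ell\le C_{\rm mark}\min\{\#\mathcal U:\mathcal U\subseteq\mathcal T_\ell,\ \theta\eta_\ell(u_\ell^{\underline k})^2\le\eta_\ell(\mathcal U,u_\ell^{\underline k})^2\}$. (iv) $\mathcal T_{\ell+1}:=\mathtt{refine}(\mathcal T_\ell,\mathcal M_\ell)$, $u_{\ell+1}^0:=u_\ell^{\underline k}$. *)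

theory Defs
  imports
    "HOL-Analysis.Analysis"
    "Jordan_Normal_Form.VS_Connect"
    "Jordan_Normal_Form.Gauss_Jordan_Elimination"
begin

(* Below, "$" and the inner product dot refer to the vectors of real^'d; the vectors of
   Jordan_Normal_Form (coefficient vectors, whose length N_l varies with the level) are
   accessed through vec_index and scalar_prod. *)
no_notation vec_index (infixl "$" 100)
no_notation scalar_prod (infix "\<bullet>" 70)

section \<open>Domains\<close>

definition lipschitz_domain :: "(real^'d) set \<Rightarrow> bool" where
  "lipschitz_domain \<Omega> \<longleftrightarrow>
     open \<Omega> \<and> connected \<Omega> \<and> bounded \<Omega> \<and> \<Omega> \<noteq> {} \<and>
     (\<forall>z\<in>frontier \<Omega>. \<exists>U e g L. open U \<and> z \<in> U \<and> norm e = 1 \<and>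
        L-lipschitz_on {y. e \<bullet> y = 0} (g :: real^'d \<Rightarrow> real) \<and>
        \<Omega> \<inter> U = {y \<in> U. e \<bullet> y > g (y - (e \<bullet> y) *\<^sub>R e)})"

definition polyhedral_lipschitz_domain :: "(real^'d) set \<Rightarrow> bool" where
  "polyhedral_lipschitz_domain \<Omega> \<longleftrightarrow>
     lipschitz_domain \<Omega> \<and> (\<exists>\<P>. finite \<P> \<and> (\<forall>P\<in>\<P>. polytope P) \<and> closure \<Omega> = \<Union>\<P>)"

section \<open>Lebesgue and Sobolev spaces\<close>

text \<open>Elements of function spaces on \<open>\<Omega>\<close> are represented by functions on the whole space
  whose values outside \<open>\<Omega>\<close> are irrelevant.\<close>

definition L2 :: "(real^'d) set \<Rightarrow> (real^'d \<Rightarrow> 'b::euclidean_space) \<Rightarrow> bool" where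
  "L2 \<Omega> v \<longleftrightarrow> v \<in> borel_measurable (lebesgue_on \<Omega>) \<and>
     integrable (lebesgue_on \<Omega>) (\<lambda>x. (norm (v x))\<^sup>2)"

definition Linf :: "(real^'d) set \<Rightarrow> (real^'d \<Rightarrow> 'b::euclidean_space) \<Rightarrow> bool" where
  "Linf \<Omega> v \<longleftrightarrow> v \<in> borel_measurable (lebesgue_on \<Omega>) \<and>
     (\<exists>C. AE x in lebesgue_on \<Omega>. norm (v x) \<le> C)"

definition loc_integrable :: "(real^'d) set \<Rightarrow> (real^'d \<Rightarrow> 'b::euclidean_space) \<Rightarrow> bool" where
  "loc_integrable \<Omega> v \<longleftrightarrow> (\<forall>C. compact C \<and> C \<subseteq> \<Omega> \<longrightarrow> integrable (lebesgue_on C) v)"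

definition partial_d :: "'d \<Rightarrow> (real^'d \<Rightarrow> real) \<Rightarrow> real^'d \<Rightarrow> real" where
  "partial_d i f x = frechet_derivative f (at x) (axis i 1)"

definition grad :: "(real^'d \<Rightarrow> real) \<Rightarrow> real^'d \<Rightarrow> real^'d" where
  "grad f x = (\<chi> i. partial_d i f x)"

primrec Ck :: "nat \<Rightarrow> (real^'d \<Rightarrow> real) \<Rightarrow> bool" where
  "Ck 0 f \<longleftrightarrow> continuous_on UNIV f"
| "Ck (Suc n) f \<longleftrightarrow> (\<forall>x. f differentiable (at x)) \<and> (\<forall>i. Ck n (partial_d i f))"

definition smooth :: "(real^'d \<Rightarrow> real) \<Rightarrow> bool" where
  "smooth f \<longleftrightarrow> (\<forall>n. Ck n f)"

definition test_fun :: "(real^'d) set \<Rightarrow> (real^'d \<Rightarrow> real) \<Rightarrow> bool" where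
  "test_fun \<Omega> \<phi> \<longleftrightarrow>
     smooth \<phi> \<and> compact (closure {x. \<phi> x \<noteq> 0}) \<and> closure {x. \<phi> x \<noteq> 0} \<subseteq> \<Omega>"

definition has_weak_grad :: "(real^'d) set \<Rightarrow> (real^'d \<Rightarrow> real) \<Rightarrow> (real^'d \<Rightarrow> real^'d) \<Rightarrow> bool" where
  "has_weak_grad \<Omega> v g \<longleftrightarrow> loc_integrable \<Omega> v \<and> loc_integrable \<Omega> g \<and>
     (\<forall>\<phi>. test_fun \<Omega> \<phi> \<longrightarrow> (\<forall>i.
        (LINT x|lebesgue_on \<Omega>. v x * partial_d i \<phi> x) = - (LINT x|lebesgue_on \<Omega>. g x $ i * \<phi> x)))"

definition has_weak_div :: "(real^'d) set \<Rightarrow> (real^'d \<Rightarrow> real^'d) \<Rightarrow> (real^'d \<Rightarrow> real) \<Rightarrow> bool" where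
  "has_weak_div \<Omega> q h \<longleftrightarrow> loc_integrable \<Omega> q \<and> loc_integrable \<Omega> h \<and>
     (\<forall>\<phi>. test_fun \<Omega> \<phi> \<longrightarrow>
        (LINT x|lebesgue_on \<Omega>. q x \<bullet> grad \<phi> x) = - (LINT x|lebesgue_on \<Omega>. h x * \<phi> x))"

text \<open>Weak gradients and divergences are unique almost everywhere; the choice of a
  representative never matters, since it only occurs below integrals or AE quantifiers.\<close>

definition wgrad :: "(real^'d) set \<Rightarrow> (real^'d \<Rightarrow> real) \<Rightarrow> real^'d \<Rightarrow> real^'d" where
  "wgrad \<Omega> v = (SOME g. has_weak_grad \<Omega> v g)"

definition wdiv :: "(real^'d) set \<Rightarrow> (real^'d \<Rightarrow> real^'d) \<Rightarrow> real^'d \<Rightarrow> real" where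
  "wdiv \<Omega> q = (SOME h. has_weak_div \<Omega> q h)"

definition H1 :: "(real^'d) set \<Rightarrow> (real^'d \<Rightarrow> real) set" where
  "H1 \<Omega> = {v. L2 \<Omega> v \<and> (\<exists>g. has_weak_grad \<Omega> v g \<and> L2 \<Omega> g)}"

definition W1inf :: "(real^'d) set \<Rightarrow> (real^'d \<Rightarrow> real) set" where
  "W1inf \<Omega> = {v. Linf \<Omega> v \<and> (\<exists>g. has_weak_grad \<Omega> v g \<and> Linf \<Omega> g)}"

(* closure of the test functions in H^1 *)
definition H10 :: "(real^'d) set \<Rightarrow> (real^'d \<Rightarrow> real) set" where
  "H10 \<Omega> = {v \<in> H1 \<Omega>. \<exists>\<phi>. (\<forall>n. test_fun \<Omega> (\<phi> n)) \<and>
     (\<lambda>n. LINT x|lebesgue_on \<Omega>. (\<phi> n x - v x)\<^sup>2) \<longlonglongrightarrow> 0 \<and>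
     (\<lambda>n. LINT x|lebesgue_on \<Omega>. (norm (grad (\<phi> n) x - wgrad \<Omega> v x))\<^sup>2) \<longlonglongrightarrow> 0}"

section \<open>Model problem\<close>

record ('d::finite) pde_data =
  Omega :: "(real^'d) set"
  Kmat :: "real^'d \<Rightarrow> real^'d^'d"
  bvec :: "real^'d \<Rightarrow> real^'d"
  creac :: "real^'d \<Rightarrow> real"
  fsrc :: "real^'d \<Rightarrow> real"
  fvec :: "real^'d \<Rightarrow> real^'d"

definition model_problem :: "('d::finite) pde_data \<Rightarrow> bool" where
  "model_problem D \<longleftrightarrow>
     polyhedral_lipschitz_domain (Omega D) \<and>
     L2 (Omega D) (fsrc D) \<and> L2 (Omega D) (fvec D) \<and>
     Linf (Omega D) (bvec D) \<and> (\<exists>h. has_weak_div (Omega D) (bvec D) h \<and> Linf (Omega D) h) \<and>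
     Linf (Omega D) (creac D) \<and>
     (AE x in lebesgue_on (Omega D). - wdiv (Omega D) (bvec D) x + 2 * creac D x \<ge> 0) \<and>
     Linf (Omega D) (Kmat D) \<and>
     (AE x in lebesgue_on (Omega D). transpose (Kmat D x) = Kmat D x) \<and>
     (\<exists>\<kappa>>0. AE x in lebesgue_on (Omega D).
        \<forall>\<mu> w. w \<noteq> 0 \<and> Kmat D x *v w = \<mu> *\<^sub>R w \<longrightarrow> \<kappa> \<le> \<mu>)"

definition form_a :: "('d::finite) pde_data \<Rightarrow> (real^'d \<Rightarrow> real) \<Rightarrow> (real^'d \<Rightarrow> real) \<Rightarrow> real" where
  "form_a D v w =
     (LINT x|lebesgue_on (Omega D). (Kmat D x *v wgrad (Omega D) v x) \<bullet> wgrad (Omega D) w x)"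

definition form_b :: "('d::finite) pde_data \<Rightarrow> (real^'d \<Rightarrow> real) \<Rightarrow> (real^'d \<Rightarrow> real) \<Rightarrow> real" where
  "form_b D v w = form_a D v w
     + (LINT x|lebesgue_on (Omega D). (bvec D x \<bullet> wgrad (Omega D) v x) * w x)
     + (LINT x|lebesgue_on (Omega D). creac D x * v x * w x)"

definition rhs_F :: "('d::finite) pde_data \<Rightarrow> (real^'d \<Rightarrow> real) \<Rightarrow> real" where
  "rhs_F D v = (LINT x|lebesgue_on (Omega D). fsrc D x * v x)
     + (LINT x|lebesgue_on (Omega D). fvec D x \<bullet> wgrad (Omega D) v x)"

definition enorm :: "('d::finite) pde_data \<Rightarrow> (real^'d \<Rightarrow> real) \<Rightarrow> real" where
  "enorm D v = sqrt (form_a D v v)"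

definition exact_solution :: "('d::finite) pde_data \<Rightarrow> (real^'d \<Rightarrow> real) \<Rightarrow> bool" where
  "exact_solution D u \<longleftrightarrow> u \<in> H10 (Omega D) \<and> (\<forall>v\<in>H10 (Omega D). form_b D u v = rhs_F D v)"

section \<open>Triangulations and newest vertex bisection\<close>

text \<open>NVB in arbitrary dimension \<open>d\<close> in the formulation of Maubach, Traxler and Stevenson:
  an element is a tagged simplex \<open>(z\<^sub>0, \<dots>, z\<^sub>d)\<^sub>\<gamma>\<close> with an ordering of its vertices and a type
  \<open>\<gamma> \<in> {0, \<dots>, d-1}\<close>. Its refinement edge is \<open>z\<^sub>0 z\<^sub>d\<close>, and with the midpoint \<open>z'\<close> of this edge
  its children are
  \<open>(z\<^sub>0, z', z\<^sub>1, \<dots>, z\<^sub>\<gamma>, z\<^sub>\<gamma>\<^sub>+\<^sub>1, \<dots>, z\<^sub>d\<^sub>-\<^sub>1)\<close> and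
  \<open>(z\<^sub>d, z', z\<^sub>1, \<dots>, z\<^sub>\<gamma>, z\<^sub>d\<^sub>-\<^sub>1, \<dots>, z\<^sub>\<gamma>\<^sub>+\<^sub>1)\<close>, both of type \<open>\<gamma> + 1\<close> modulo \<open>d\<close>.\<close>

type_synonym 'd tsimplex = "(real^'d) list \<times> nat"
type_synonym 'd mesh = "((real^'d) list \<times> nat) set"

definition verts :: "('d::finite) tsimplex \<Rightarrow> (real^'d) set" where
  "verts T = set (fst T)"

definition elem :: "('d::finite) tsimplex \<Rightarrow> (real^'d) set" where
  "elem T = convex hull (verts T)"

definition refinement_edge :: "('d::finite) tsimplex \<Rightarrow> (real^'d) set" where
  "refinement_edge T = {hd (fst T), last (fst T)}"

definition inner_verts :: "('d::finite) tsimplex \<Rightarrow> (real^'d) list" where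
  "inner_verts T = butlast (tl (fst T))"

definition rev_tail :: "nat \<Rightarrow> 'b list \<Rightarrow> 'b list" where
  "rev_tail \<gamma> zs = take \<gamma> zs @ rev (drop \<gamma> zs)"

definition child1 :: "('d::finite) tsimplex \<Rightarrow> 'd tsimplex" where
  "child1 T = (hd (fst T) # midpoint (hd (fst T)) (last (fst T)) # inner_verts T,
     Suc (snd T) mod CARD('d))"

definition child2 :: "('d::finite) tsimplex \<Rightarrow> 'd tsimplex" where
  "child2 T = (last (fst T) # midpoint (hd (fst T)) (last (fst T)) # rev_tail (snd T) (inner_verts T),
     Suc (snd T) mod CARD('d))"

(* the second tagging of the same simplex that yields the same two children *)
definition reflect :: "('d::finite) tsimplex \<Rightarrow> 'd tsimplex" where
  "reflect T = (last (fst T) # rev_tail (snd T) (inner_verts T) @ [hd (fst T)], snd T)"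

definition conforming :: "(real^'d) set \<Rightarrow> ('d::finite) mesh \<Rightarrow> bool" where
  "conforming \<Omega> \<T> \<longleftrightarrow>
     (\<forall>T\<in>\<T>. length (fst T) = CARD('d) + 1 \<and> snd T < CARD('d) \<and> int CARD('d) simplex elem T) \<and>
     inj_on elem \<T> \<and> triangulation (elem ` \<T>) \<and> \<Union>(elem ` \<T>) = closure \<Omega>"

definition neighbours :: "('d::finite) tsimplex \<Rightarrow> 'd tsimplex \<Rightarrow> bool" where
  "neighbours T T' \<longleftrightarrow> (elem T \<inter> elem T') facet_of elem T \<and> (elem T \<inter> elem T') facet_of elem T'"

definition reflected_neighbours :: "('d::finite) tsimplex \<Rightarrow> 'd tsimplex \<Rightarrow> bool" where
  "reflected_neighbours T T' \<longleftrightarrow> neighbours T T' \<and> snd T = snd T' \<and>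
     (\<exists>S\<in>{T, reflect T}. card {i. i < CARD('d) + 1 \<and> fst S ! i \<noteq> fst T' ! i} = 1)"

text \<open>Stevenson's matching condition on the initial mesh.\<close>

definition matching :: "('d::finite) mesh \<Rightarrow> bool" where
  "matching \<T> \<longleftrightarrow>
     (\<forall>T\<in>\<T>. \<forall>T'\<in>\<T>. snd T = snd T') \<and>
     (\<forall>T\<in>\<T>. \<forall>T'\<in>\<T>. neighbours T T' \<longrightarrow>
        (if refinement_edge T \<subseteq> elem T \<inter> elem T' \<or> refinement_edge T' \<subseteq> elem T \<inter> elem T'
         then reflected_neighbours T T'
         else \<forall>C\<in>{child1 T, child2 T}. \<forall>C'\<in>{child1 T', child2 T'}.
                neighbours C C' \<longrightarrow> reflected_neighbours C C'))"

text \<open>For \<open>d \<le> 2\<close>, NVB is well-defined for every choice of the initial refinement edges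
  (Karkulik, Pavlicek, Praetorius); only for \<open>d \<ge> 3\<close> a compatibility condition is needed.\<close>

definition nvb_admissible :: "('d::finite) mesh \<Rightarrow> bool" where
  "nvb_admissible \<T> \<longleftrightarrow> CARD('d) \<le> 2 \<or> matching \<T>"

definition bisect :: "('d::finite) mesh \<Rightarrow> 'd mesh \<Rightarrow> bool" where
  "bisect \<T> \<T>' \<longleftrightarrow> (\<exists>T\<in>\<T>. \<T>' = (\<T> - {T}) \<union> {child1 T, child2 T})"

text \<open>Single bisections may create hanging nodes; only conforming meshes are kept.\<close>

definition refinements :: "('d::finite) pde_data \<Rightarrow> 'd mesh \<Rightarrow> 'd mesh set" where
  "refinements D \<T> = {\<T>'. bisect\<^sup>*\<^sup>* \<T> \<T>' \<and> conforming (Omega D) \<T>'}"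

definition is_refine :: "('d::finite) pde_data \<Rightarrow> 'd mesh \<Rightarrow> 'd mesh \<Rightarrow> 'd mesh \<Rightarrow> bool" where
  "is_refine D \<T> \<M> \<T>' \<longleftrightarrow> \<T>' \<in> refinements D \<T> \<and> \<M> \<inter> \<T>' = {} \<and>
     (\<forall>\<T>''\<in>refinements D \<T>. \<M> \<inter> \<T>'' = {} \<longrightarrow> \<T>'' \<in> refinements D \<T>')"

definition initial_mesh :: "('d::finite) pde_data \<Rightarrow> 'd mesh \<Rightarrow> bool" where
  "initial_mesh D \<T>0 \<longleftrightarrow> conforming (Omega D) \<T>0 \<and> nvb_admissible \<T>0 \<and>
     (\<forall>T\<in>\<T>0. (\<forall>i. (\<lambda>x. fvec D x $ i) \<in> H1 (interior (elem T))) \<and>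
        (\<forall>i j. (\<lambda>x. Kmat D x $ i $ j) \<in> W1inf (interior (elem T))))"

section \<open>Finite element spaces\<close>

definition poly_fun :: "nat \<Rightarrow> (real^'d \<Rightarrow> real) \<Rightarrow> bool" where
  "poly_fun p q \<longleftrightarrow> (\<exists>c :: ('d::finite \<Rightarrow> nat) \<Rightarrow> real.
     q = (\<lambda>x. \<Sum>\<alpha> | sum \<alpha> UNIV \<le> p. c \<alpha> * (\<Prod>i\<in>UNIV. x $ i ^ \<alpha> i)))"

text \<open>Discrete functions are extended by zero outside \<open>\<Omega>\<close>, which includes the homogeneous
  boundary condition and makes them determined pointwise.\<close>

definition fe_space :: "('d::finite) pde_data \<Rightarrow> nat \<Rightarrow> 'd mesh \<Rightarrow> (real^'d \<Rightarrow> real) set" where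
  "fe_space D p \<T> = {v \<in> H10 (Omega D). continuous_on (closure (Omega D)) v \<and> (\<forall>x. x \<notin> Omega D \<longrightarrow> v x = 0) \<and>
     (\<forall>T\<in>\<T>. \<exists>q. poly_fun p q \<and> (\<forall>x\<in>elem T. v x = q x))}"

definition galerkin_solution :: "('d::finite) pde_data \<Rightarrow> nat \<Rightarrow> 'd mesh \<Rightarrow> (real^'d \<Rightarrow> real) \<Rightarrow> bool" where
  "galerkin_solution D p \<T> u \<longleftrightarrow>
     u \<in> fe_space D p \<T> \<and> (\<forall>v\<in>fe_space D p \<T>. form_b D u v = rhs_F D v)"

section \<open>Error estimator\<close>

definition outer_normal :: "(real^'d) set \<Rightarrow> (real^'d) set \<Rightarrow> real^'d" where
  "outer_normal S E =
     (THE n. norm n = 1 \<and> (\<exists>\<beta>. E \<subseteq> {x. n \<bullet> x = \<beta>} \<and> S \<subseteq> {x. n \<bullet> x \<le> \<beta>}))"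

text \<open>Surface measure on a facet \<open>E\<close> of \<open>S\<close> with unit normal \<open>n\<close>: the \<open>d-1\<close>-dimensional area of
  \<open>A \<subseteq> E\<close> is the \<open>d\<close>-dimensional volume of the right prism \<open>{y + t n. y \<in> A, 0 \<le> t \<le> 1}\<close> of
  height one. Hence the measure is the image of the volume on the prism over \<open>E\<close> under the
  orthogonal projection onto the hyperplane of \<open>E\<close>. For \<open>d = 1\<close> it is the counting measure.\<close>

definition facet_measure :: "(real^'d) set \<Rightarrow> (real^'d) set \<Rightarrow> (real^'d) measure" where
  "facet_measure S E = (let n = outer_normal S E; z = (SOME z. z \<in> E) in
     distr (restrict_space lborel {y + t *\<^sub>R n | y t. y \<in> E \<and> t \<in> {0..1}}) borel
       (\<lambda>x. x - (n \<bullet> (x - z)) *\<^sub>R n))"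

text \<open>Trace on the facet \<open>E\<close> of a function in \<open>H\<^sup>1\<close> of the simplex \<open>S\<close>: the \<open>L\<^sup>2(E)\<close>-limit of the
  restrictions of smooth functions converging in \<open>H\<^sup>1\<close>.\<close>

definition has_trace ::
  "(real^'d) set \<Rightarrow> (real^'d) set \<Rightarrow> (real^'d \<Rightarrow> real) \<Rightarrow> (real^'d \<Rightarrow> real) \<Rightarrow> bool" where
  "has_trace S E g \<gamma> \<longleftrightarrow>
     \<gamma> \<in> borel_measurable borel \<and> integrable (facet_measure S E) (\<lambda>x. (\<gamma> x)\<^sup>2) \<and>
     (\<exists>gs. (\<forall>n. smooth (gs n)) \<and>
        (\<lambda>n. LINT x|lebesgue_on (interior S). (gs n x - g x)\<^sup>2) \<longlonglongrightarrow> 0 \<and>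
        (\<lambda>n. LINT x|lebesgue_on (interior S).
           (norm (grad (gs n) x - wgrad (interior S) g x))\<^sup>2) \<longlonglongrightarrow> 0 \<and>
        (\<lambda>n. LINT x|facet_measure S E. (gs n x - \<gamma> x)\<^sup>2) \<longlonglongrightarrow> 0)"

definition trace_on :: "(real^'d) set \<Rightarrow> (real^'d) set \<Rightarrow> (real^'d \<Rightarrow> real) \<Rightarrow> real^'d \<Rightarrow> real" where
  "trace_on S E g = (SOME \<gamma>. has_trace S E g \<gamma>)"

definition normal_trace :: "(real^'d) set \<Rightarrow> (real^'d) set \<Rightarrow> (real^'d \<Rightarrow> real^'d) \<Rightarrow> real^'d \<Rightarrow> real" where
  "normal_trace S E q x = (\<chi> i. trace_on S E (\<lambda>y. q y $ i) x) \<bullet> outer_normal S E"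

definition flux :: "('d::finite) pde_data \<Rightarrow> (real^'d \<Rightarrow> real) \<Rightarrow> real^'d \<Rightarrow> real^'d" where
  "flux D v x = Kmat D x *v wgrad (Omega D) v x - fvec D x"

definition elem_residual ::
  "('d::finite) pde_data \<Rightarrow> 'd tsimplex \<Rightarrow> (real^'d \<Rightarrow> real) \<Rightarrow> real^'d \<Rightarrow> real" where
  "elem_residual D T v x = wdiv (interior (elem T)) (flux D v) x
     - bvec D x \<bullet> wgrad (Omega D) v x - creac D x * v x + fsrc D x"

definition jump ::
  "('d::finite) pde_data \<Rightarrow> 'd tsimplex \<Rightarrow> 'd tsimplex \<Rightarrow> (real^'d \<Rightarrow> real) \<Rightarrow> real^'d \<Rightarrow> real" where
  "jump D T T' v x = normal_trace (elem T) (elem T \<inter> elem T') (flux D v) x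
     + normal_trace (elem T') (elem T \<inter> elem T') (flux D v) x"

definition vol :: "('d::finite) tsimplex \<Rightarrow> real" where
  "vol T = measure lebesgue (elem T)"

text \<open>Squared indicator \<open>\<eta>(T, v)\<^sup>2\<close>. In a conforming mesh, the facets of \<open>T\<close> inside \<open>\<Omega>\<close> are
  exactly the intersections with its neighbours.\<close>

definition eta_sq :: "('d::finite) pde_data \<Rightarrow> 'd mesh \<Rightarrow> 'd tsimplex \<Rightarrow> (real^'d \<Rightarrow> real) \<Rightarrow> real" where
  "eta_sq D \<T> T v =
     vol T powr (2 / real CARD('d)) *
       (LINT x|lebesgue_on (interior (elem T)). (elem_residual D T v x)\<^sup>2) +
     vol T powr (1 / real CARD('d)) *
       (\<Sum>T' | T' \<in> \<T> \<and> neighbours T T'.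
          LINT x|facet_measure (elem T) (elem T \<inter> elem T'). (jump D T T' v x)\<^sup>2)"

definition eta :: "('d::finite) pde_data \<Rightarrow> 'd mesh \<Rightarrow> 'd mesh \<Rightarrow> (real^'d \<Rightarrow> real) \<Rightarrow> real" where
  "eta D \<T> \<U> v = sqrt (\<Sum>T\<in>\<U>. eta_sq D \<T> T v)"

definition stability :: "('d::finite) pde_data \<Rightarrow> 'd mesh \<Rightarrow> nat \<Rightarrow> real \<Rightarrow> bool" where
  "stability D \<T>0 p Cstab \<longleftrightarrow>
     (\<forall>\<T>H\<in>refinements D \<T>0. \<forall>\<T>h\<in>refinements D \<T>H.
        \<forall>vH\<in>fe_space D p \<T>H. \<forall>vh\<in>fe_space D p \<T>h.
          \<bar>eta D \<T>h (\<T>h \<inter> \<T>H) vh - eta D \<T>H (\<T>h \<inter> \<T>H) vH\<bar> \<le> Cstab * enorm D (\<lambda>x. vh x - vH x))"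

definition reduction :: "('d::finite) pde_data \<Rightarrow> 'd mesh \<Rightarrow> nat \<Rightarrow> real \<Rightarrow> bool" where
  "reduction D \<T>0 p qred \<longleftrightarrow>
     (\<forall>\<T>H\<in>refinements D \<T>0. \<forall>\<T>h\<in>refinements D \<T>H. \<forall>vH\<in>fe_space D p \<T>H.
        eta D \<T>h (\<T>h - \<T>H) vH \<le> qred * eta D \<T>H (\<T>H - \<T>h) vH)"

definition reliability ::
  "('d::finite) pde_data \<Rightarrow> 'd mesh \<Rightarrow> nat \<Rightarrow> (real^'d \<Rightarrow> real) \<Rightarrow> real \<Rightarrow> bool" where
  "reliability D \<T>0 p ustar Crel \<longleftrightarrow>
     (\<forall>\<T>H\<in>refinements D \<T>0. \<forall>uH. galerkin_solution D p \<T>H uH \<longrightarrow>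
        enorm D (\<lambda>x. ustar x - uH x) \<le> Crel * eta D \<T>H \<T>H uH)"

section \<open>Preconditioned GMRES\<close>

definition fe_fun :: "(nat \<Rightarrow> real^'d \<Rightarrow> real) \<Rightarrow> real vec \<Rightarrow> real^'d \<Rightarrow> real" where
  "fe_fun \<phi> x y = (\<Sum>j<dim_vec x. vec_index x j * \<phi> j y)"

definition is_basis :: "nat \<Rightarrow> (nat \<Rightarrow> real^'d \<Rightarrow> real) \<Rightarrow> (real^'d \<Rightarrow> real) set \<Rightarrow> bool" where
  "is_basis N \<phi> V \<longleftrightarrow> inj_on (fe_fun \<phi>) (carrier_vec N) \<and> fe_fun \<phi> ` carrier_vec N = V"

definition system_mat :: "('d::finite) pde_data \<Rightarrow> nat \<Rightarrow> (nat \<Rightarrow> real^'d \<Rightarrow> real) \<Rightarrow> real mat" where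
  "system_mat D N \<phi> = Matrix.mat N N (\<lambda>(j, k). form_b D (\<phi> k) (\<phi> j))"

definition load_vec :: "('d::finite) pde_data \<Rightarrow> nat \<Rightarrow> (nat \<Rightarrow> real^'d \<Rightarrow> real) \<Rightarrow> real vec" where
  "load_vec D N \<phi> = Matrix.vec N (\<lambda>j. rhs_F D (\<phi> j))"

definition spd_mat :: "nat \<Rightarrow> real mat \<Rightarrow> bool" where
  "spd_mat N P \<longleftrightarrow> P \<in> carrier_mat N N \<and> transpose_mat P = P \<and>
     (\<forall>x\<in>carrier_vec N. x \<noteq> 0\<^sub>v N \<longrightarrow> scalar_prod (P *\<^sub>v x) x > 0)"

definition pinv_norm :: "real mat \<Rightarrow> real vec \<Rightarrow> real" where
  "pinv_norm P x = sqrt (scalar_prod (the (mat_inverse P) *\<^sub>v x) x)"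

definition presid :: "real mat \<Rightarrow> real mat \<Rightarrow> real vec \<Rightarrow> real vec \<Rightarrow> real vec" where
  "presid P B d x = P *\<^sub>v (d - B *\<^sub>v x)"

definition krylov :: "real mat \<Rightarrow> real mat \<Rightarrow> real vec \<Rightarrow> nat \<Rightarrow> real vec set" where
  "krylov P B s K = LinearCombinations.module.span class_ring (module_vec TYPE(real) (dim_vec s))
     ((\<lambda>i. ((P * B) ^\<^sub>m i) *\<^sub>v s) ` {..<K})"

definition pgmres :: "nat \<Rightarrow> real mat \<Rightarrow> real mat \<Rightarrow> real vec \<Rightarrow> (nat \<Rightarrow> real vec) \<Rightarrow> bool" where
  "pgmres kmax P B d x \<longleftrightarrow> x 0 \<in> carrier_vec (dim_vec d) \<and>
     (\<forall>k\<ge>1. let K = (k - 1) mod kmax + 1; m = k - K in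
        is_arg_min (\<lambda>y. pinv_norm P (presid P B d y))
          (\<lambda>y. \<exists>z\<in>krylov P B (presid P B d (x m)) K. y = x m + z) (x k))"

section \<open>The adaptive algorithm\<close>

text \<open>A record of all quantities of a run, indexed by the level \<open>\<ell>\<close> (and the solver step \<open>k\<close>).
  The values on levels that are never reached are irrelevant. \<open>Calg \<ell>\<close>, \<open>lam \<ell>\<close>, \<open>Ssum \<ell>\<close> are the
  values of the parameters and of the sum \<open>S\<close> at the beginning of level \<open>\<ell>\<close>.\<close>

record ('d::finite) afem_run =
  mesh_at :: "nat \<Rightarrow> 'd mesh"
  ndof :: "nat \<Rightarrow> nat"
  basis_at :: "nat \<Rightarrow> nat \<Rightarrow> real^'d \<Rightarrow> real"
  precond :: "nat \<Rightarrow> real mat"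
  coeffs :: "nat \<Rightarrow> nat \<Rightarrow> real vec"
  marked :: "nat \<Rightarrow> 'd mesh"
  Calg :: "nat \<Rightarrow> real"
  lam :: "nat \<Rightarrow> real"
  Ssum :: "nat \<Rightarrow> ennreal"

definition iterate :: "('d::finite) afem_run \<Rightarrow> nat \<Rightarrow> nat \<Rightarrow> real^'d \<Rightarrow> real" where
  "iterate R l k = fe_fun (basis_at R l) (coeffs R l k)"

definition Bmat :: "('d::finite) pde_data \<Rightarrow> 'd afem_run \<Rightarrow> nat \<Rightarrow> real mat" where
  "Bmat D R l = system_mat D (ndof R l) (basis_at R l)"

definition dvec :: "('d::finite) pde_data \<Rightarrow> 'd afem_run \<Rightarrow> nat \<Rightarrow> real vec" where
  "dvec D R l = load_vec D (ndof R l) (basis_at R l)"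

definition residual_norm :: "('d::finite) pde_data \<Rightarrow> 'd afem_run \<Rightarrow> nat \<Rightarrow> nat \<Rightarrow> real" where
  "residual_norm D R l k =
     pinv_norm (precond R l) (presid (precond R l) (Bmat D R l) (dvec D R l) (coeffs R l k))"

definition eta_at :: "('d::finite) pde_data \<Rightarrow> 'd afem_run \<Rightarrow> nat \<Rightarrow> 'd mesh \<Rightarrow> nat \<Rightarrow> real" where
  "eta_at D R l \<U> k = eta D (mesh_at R l) \<U> (iterate R l k)"

definition quasi_error :: "('d::finite) pde_data \<Rightarrow> 'd afem_run \<Rightarrow> nat \<Rightarrow> nat \<Rightarrow> real" where
  "quasi_error D R l k = eta_at D R l (mesh_at R l) k + residual_norm D R l k"

definition stop_crit :: "('d::finite) pde_data \<Rightarrow> 'd afem_run \<Rightarrow> nat \<Rightarrow> nat \<Rightarrow> bool" where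
  "stop_crit D R l k \<longleftrightarrow> 1 \<le> k \<and> residual_norm D R l k \<le> lam R l * eta_at D R l (mesh_at R l) k"

definition solver_stops :: "('d::finite) pde_data \<Rightarrow> 'd afem_run \<Rightarrow> nat \<Rightarrow> bool" where
  "solver_stops D R l \<longleftrightarrow> (\<exists>k. stop_crit D R l k)"

(* only meaningful if solver_stops holds; otherwise the final index is infinite *)
definition kfin :: "('d::finite) pde_data \<Rightarrow> 'd afem_run \<Rightarrow> nat \<Rightarrow> nat" where
  "kfin D R l = (LEAST k. stop_crit D R l k)"

definition final_error :: "('d::finite) pde_data \<Rightarrow> 'd afem_run \<Rightarrow> nat \<Rightarrow> real" where
  "final_error D R l = quasi_error D R l (kfin D R l)"

(* the solver stops on level l and the tolerance test does not end the run there (nor on any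
   earlier level), so that the parameter test, marking, and refinement are executed *)
definition completes :: "('d::finite) pde_data \<Rightarrow> real \<Rightarrow> 'd afem_run \<Rightarrow> nat \<Rightarrow> bool" where
  "completes D \<tau> R l \<longleftrightarrow> (\<forall>j\<le>l. solver_stops D R j \<and> \<not> final_error D R j \<le> \<tau>)"

definition reached :: "('d::finite) pde_data \<Rightarrow> real \<Rightarrow> 'd afem_run \<Rightarrow> nat \<Rightarrow> bool" where
  "reached D \<tau> R l \<longleftrightarrow> (\<forall>j<l. completes D \<tau> R j)"

(* inverse on ennreal satisfies inverse 0 = top *)
definition update_at :: "('d::finite) pde_data \<Rightarrow> 'd afem_run \<Rightarrow> nat \<Rightarrow> bool" where
  "update_at D R l \<longleftrightarrow>
     1 \<le> l \<and> Ssum R l > ennreal (Calg R l) * inverse (ennreal (final_error D R l))"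

definition doerfler :: "('d::finite) pde_data \<Rightarrow> real \<Rightarrow> 'd afem_run \<Rightarrow> nat \<Rightarrow> 'd mesh \<Rightarrow> bool" where
  "doerfler D \<theta> R l \<U> \<longleftrightarrow> \<U> \<subseteq> mesh_at R l \<and>
     \<theta> * (eta_at D R l (mesh_at R l) (kfin D R l))\<^sup>2 \<le> (eta_at D R l \<U> (kfin D R l))\<^sup>2"

definition afem_pgmres ::
  "('d::finite) pde_data \<Rightarrow> nat \<Rightarrow> 'd mesh \<Rightarrow> real \<Rightarrow> real \<Rightarrow> (real^'d \<Rightarrow> real) \<Rightarrow> real \<Rightarrow> real \<Rightarrow> nat
     \<Rightarrow> real \<Rightarrow> 'd afem_run \<Rightarrow> bool" where
  "afem_pgmres D p \<T>0 \<theta> Cmark u00 Calg0 lam0 kmax \<tau> R \<longleftrightarrow>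
     mesh_at R 0 = \<T>0 \<and> iterate R 0 0 = u00 \<and>
     Calg R 0 = Calg0 \<and> lam R 0 = lam0 \<and> Ssum R 0 = 0 \<and>
     (\<forall>l. reached D \<tau> R l \<longrightarrow>
        is_basis (ndof R l) (basis_at R l) (fe_space D p (mesh_at R l)) \<and>
        spd_mat (ndof R l) (precond R l) \<and>
        pgmres kmax (precond R l) (Bmat D R l) (dvec D R l) (coeffs R l)) \<and>
     (\<forall>l. completes D \<tau> R l \<longrightarrow>
        Calg R (Suc l) = (if update_at D R l then 2 * Calg R l else Calg R l) \<and>
        lam R (Suc l) = (if update_at D R l then lam R l / 2 else lam R l) \<and>
        Ssum R (Suc l) = Ssum R l + inverse (ennreal (final_error D R l)) \<and>
        doerfler D \<theta> R l (marked R l) \<and>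
        real (card (marked R l)) \<le> Cmark * real (Min {card \<U> | \<U>. doerfler D \<theta> R l \<U>}) \<and>
        is_refine D (mesh_at R l) (marked R l) (mesh_at R (Suc l)) \<and>
        iterate R (Suc l) 0 = iterate R l (kfin D R l))"

definition norm_equivalence :: "('d::finite) pde_data \<Rightarrow> real \<Rightarrow> 'd afem_run \<Rightarrow> real \<Rightarrow> bool" where
  "norm_equivalence D \<tau> R Cpre \<longleftrightarrow>
     (\<forall>l. reached D \<tau> R l \<longrightarrow> (\<forall>x\<in>carrier_vec (ndof R l).
        inverse Cpre * enorm D (fe_fun (basis_at R l) x) \<le> pinv_norm (precond R l) x \<and>
        pinv_norm (precond R l) x \<le> Cpre * enorm D (fe_fun (basis_at R l) x)))"

definition parameter_updates :: "('d::finite) pde_data \<Rightarrow> real \<Rightarrow> 'd afem_run \<Rightarrow> nat set" where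
  "parameter_updates D \<tau> R = {l. completes D \<tau> R l \<and> update_at D R l}"

end

theory Submission
  imports Defs
begin

text \<open>Suppose that there are infinitely many updates. Then \<open>\<lambda>\<^sub>a\<^sub>l\<^sub>g \<rightarrow> 0\<close> and \<open>C\<^sub>a\<^sub>l\<^sub>g \<rightarrow> \<infinity>\<close>, so it suffices to
  bound \<open>S\<close> on level \<open>\<ell>\<close> by \<open>C / H\<^sub>\<ell>\<close> once \<open>\<lambda>\<^sub>a\<^sub>l\<^sub>g\<close> is small, where \<open>H\<^sub>\<ell>\<close> is the final
  quasi-error. This follows from quasi-monotonicity of \<open>H\<close> together with \<open>H\<^sub>\<ell>\<^sub>+\<^sub>N \<le> H\<^sub>\<ell> / 2\<close> for some
  fixed \<open>N\<close>. By the perturbed estimator reduction, the latter only requires a window of \<open>r\<close> consecutive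
  levels among \<open>\<ell>, \<dots>, \<ell> + N\<close> on which the Galerkin solutions \<open>g\<^sub>k\<close> vary by at most \<open>\<delta> H\<^sub>\<ell>\<close>.

  Such a window exists without any quasi-orthogonality: the \<open>g\<^sub>k - g\<^sub>\<ell>\<close> are bounded by a multiple of
  \<open>H\<^sub>\<ell>\<close>, so by the parallelogram law there are two close convex combinations \<open>z\<close> of Galerkin solutions
  before the window and \<open>z'\<close> of Galerkin solutions after it. Each \<open>g\<^sub>k\<close> inside the window is the Galerkin
  projection of \<open>z'\<close> onto a space containing \<open>z\<close>, so \<open>g\<^sub>k\<close> is close to \<open>z'\<close> by Cea's lemma.\<close>

section \<open>Bounded elliptic forms and nested Galerkin approximations\<close>

text \<open>The assumption of infinitely many updates does double duty: updates occur only on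
  completed levels, so the solver never iterates forever and there is a final iterate on every
  level.

  Distances are measured in \<open>nrm v = sqrt (b v v)\<close>, not in \<open>enorm\<close>. It
  sees only the symmetric part of the nonsymmetric \<open>b\<close>, so the parallelogram law is
  exact, while Cea's lemma for the full \<open>b\<close> holds in the same norm.
  \<open>enorm\<close> is tied to \<open>nrm\<close> by \<open>Cell\<close> and \<open>Cbnd\<close>.

  Two facts usually taken for granted are proved here. \<open>wgrad\<close> is an arbitrary
  representative, so linearity of \<open>H10\<close> and bilinearity of \<open>form_b\<close> rest
  on uniqueness of weak gradients, that is, on the fundamental lemma with explicit bump functions.
  Existence of the Galerkin solutions follows from ellipticity and the norm equivalence of the
  preconditioner, which make the system matrix injective.

  The threshold for \<open>lam\<close> depends only on the constants of form, estimator and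
  preconditioner. The bound on \<open>S\<close> also depends on the level from which the threshold
  holds; this is harmless, because it stays fixed while \<open>Calg\<close> keeps doubling.\<close>

definition lc :: "real \<Rightarrow> ('a \<Rightarrow> real) \<Rightarrow> real \<Rightarrow> ('a \<Rightarrow> real) \<Rightarrow> 'a \<Rightarrow> real" where
  "lc s u t v = (\<lambda>x. s * u x + t * v x)"

text \<open>The mean of \<open>w k, ..., w (k + 2^s - 1)\<close>. The recursion presents it as the
  midpoint of two means of half the length, which is the shape to which the parallelogram law
  applies.\<close>

primrec dyadic_avg :: "(nat \<Rightarrow> 'a \<Rightarrow> real) \<Rightarrow> nat \<Rightarrow> nat \<Rightarrow> 'a \<Rightarrow> real" where
  "dyadic_avg w 0 k = w k"
| "dyadic_avg w (Suc s) k = lc (1/2) (dyadic_avg w s k) (1/2) (dyadic_avg w s (k + 2 ^ s))"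

text \<open>Models \<open>form_b\<close> on \<open>H10\<close>. Members of \<open>H\<close> are
  functions rather than classes modulo null sets, so \<open>b v v = 0\<close> must not force
  \<open>v = 0\<close>, and \<open>nrm\<close> is only a seminorm. Boundedness is relative to the
  quadratic form of \<open>b\<close> itself, so that no second norm is needed. The combination
  \<open>lc\<close> covers sums, differences and midpoints alike.\<close>

locale bounded_form =
  fixes H :: "('a \<Rightarrow> real) set" and b :: "('a \<Rightarrow> real) \<Rightarrow> ('a \<Rightarrow> real) \<Rightarrow> real" and C :: real
  assumes lc_closed: "u \<in> H \<Longrightarrow> v \<in> H \<Longrightarrow> lc s u t v \<in> H"
    and b_left: "u \<in> H \<Longrightarrow> v \<in> H \<Longrightarrow> w \<in> H \<Longrightarrow> b (lc s u t v) w = s * b u w + t * b v w"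
    and b_right: "u \<in> H \<Longrightarrow> v \<in> H \<Longrightarrow> w \<in> H \<Longrightarrow> b w (lc s u t v) = s * b w u + t * b w v"
    and b_nonneg: "v \<in> H \<Longrightarrow> 0 \<le> b v v"
    and b_bounded: "v \<in> H \<Longrightarrow> w \<in> H \<Longrightarrow> \<bar>b v w\<bar> \<le> C * sqrt (b v v) * sqrt (b w w)"
    and C_nonneg: "0 \<le> C"
begin

definition nrm :: "('a \<Rightarrow> real) \<Rightarrow> real" where
  "nrm v = sqrt (b v v)"

definition dst :: "('a \<Rightarrow> real) \<Rightarrow> ('a \<Rightarrow> real) \<Rightarrow> real" where
  "dst u v = nrm (lc 1 u (-1) v)"

lemma nrm_nonneg: "v \<in> H \<Longrightarrow> 0 \<le> nrm v"
  by (simp add: nrm_def b_nonneg)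

lemma nrm_sq: "v \<in> H \<Longrightarrow> (nrm v)\<^sup>2 = b v v"
  by (simp add: nrm_def b_nonneg)

lemma nrm_sq_lc:
  assumes "u \<in> H" "v \<in> H"
  shows "(nrm (lc s u t v))\<^sup>2 = s\<^sup>2 * (nrm u)\<^sup>2 + s * t * (b u v + b v u) + t\<^sup>2 * (nrm v)\<^sup>2"
  unfolding nrm_sq[OF lc_closed[OF assms]] nrm_sq[OF assms(1)] nrm_sq[OF assms(2)]
  by (simp add: lc_closed assms b_left b_right algebra_simps power2_eq_square)

text \<open>Discriminant argument: the nonnegative quadratic form
  \<open>(nrm (lc s u t v))\<^sup>2\<close> is evaluated at \<open>(Y, -X)\<close> and
  \<open>(Y, X)\<close>. The sharp factor 2 yields a triangle inequality with constant one, which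
  \<open>b_bounded\<close> with its constant \<open>C\<close> would not; the latter only settles the
  degenerate case \<open>X * Y = 0\<close>, where one cannot divide.\<close>

lemma sym_part_cauchy_schwarz:
  assumes "u \<in> H" "v \<in> H"
  shows "\<bar>b u v + b v u\<bar> \<le> 2 * (nrm u * nrm v)"
proof -
  define X Y r where "X = nrm u" and "Y = nrm v" and "r = b u v + b v u"
  have nn: "0 \<le> X" "0 \<le> Y" using assms by (auto simp: X_def Y_def nrm_nonneg)
  have q: "0 \<le> s\<^sup>2 * X\<^sup>2 + s * t * r + t\<^sup>2 * Y\<^sup>2" for s t
    using nrm_sq_lc[OF assms, of s t] zero_le_power2[of "nrm (lc s u t v)"]
    unfolding X_def Y_def r_def by linarith
  show ?thesis
  proof (cases "X * Y = 0")
    case True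
    then have "\<bar>b u v\<bar> \<le> 0" "\<bar>b v u\<bar> \<le> 0"
      using b_bounded[OF assms] b_bounded[OF assms(2,1)]
      by (auto simp: X_def Y_def nrm_def)
    then show ?thesis using nn by (simp add: X_def Y_def)
  next
    case False
    then have p: "0 < X * Y" using nn by (simp add: less_le)
    have "(X * Y) * r \<le> (X * Y) * (2 * (X * Y))" "(X * Y) * (- r) \<le> (X * Y) * (2 * (X * Y))"
      using q[of Y "- X"] q[of Y X] by (auto simp: algebra_simps power2_eq_square)
    then have "r \<le> 2 * (X * Y)" "- r \<le> 2 * (X * Y)"
      using p mult_le_cancel_left_pos by blast+
    then show ?thesis unfolding X_def Y_def r_def by linarith
  qed
qed

lemma nrm_lc:
  assumes "u \<in> H" "v \<in> H"
  shows "nrm (lc s u t v) \<le> \<bar>s\<bar> * nrm u + \<bar>t\<bar> * nrm v"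
proof -
  have "s * t * (b u v + b v u) \<le> \<bar>s * t\<bar> * \<bar>b u v + b v u\<bar>"
    by (metis abs_ge_self abs_mult)
  also have "\<dots> \<le> \<bar>s * t\<bar> * (2 * (nrm u * nrm v))"
    by (intro mult_left_mono sym_part_cauchy_schwarz assms) auto
  finally have "(nrm (lc s u t v))\<^sup>2 \<le> (\<bar>s\<bar> * nrm u + \<bar>t\<bar> * nrm v)\<^sup>2"
    unfolding nrm_sq_lc[OF assms] power2_sum power_mult_distrib
    by (simp add: algebra_simps abs_mult)
  then show ?thesis
    by (rule power2_le_imp_le) (simp add: nrm_nonneg assms)
qed

lemma parallelogram:
  assumes "u \<in> H" "v \<in> H"
  shows "(nrm (lc (1/2) u (1/2) v))\<^sup>2 = ((nrm u)\<^sup>2 + (nrm v)\<^sup>2) / 2 - (dst u v)\<^sup>2 / 4"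
  unfolding dst_def nrm_sq_lc[OF assms] by (simp add: field_simps power2_eq_square)

lemma dst_nonneg: "u \<in> H \<Longrightarrow> v \<in> H \<Longrightarrow> 0 \<le> dst u v"
  by (simp add: dst_def nrm_nonneg lc_closed)

lemma dst_sym: "u \<in> H \<Longrightarrow> v \<in> H \<Longrightarrow> dst u v = dst v u"
  unfolding dst_def nrm_def
  by (simp add: b_left b_right lc_closed algebra_simps)

lemma dst_triangle:
  assumes "u \<in> H" "v \<in> H" "w \<in> H"
  shows "dst u w \<le> dst u v + dst v w"
proof -
  have "lc 1 u (-1) w = lc 1 (lc 1 u (-1) v) 1 (lc 1 v (-1) w)"
    by (simp add: lc_def)
  then show ?thesis
    using nrm_lc[of "lc 1 u (-1) v" "lc 1 v (-1) w" 1 1] assms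
    by (simp add: dst_def lc_closed)
qed

lemma dyadic_avg_closed:
  assumes "\<And>u v s t. u \<in> V \<Longrightarrow> v \<in> V \<Longrightarrow> lc s u t v \<in> V"
    and "\<And>j. k \<le> j \<Longrightarrow> j < k + 2 ^ s \<Longrightarrow> w j \<in> V"
  shows "dyadic_avg w s k \<in> V"
  using assms(2)
proof (induction s arbitrary: k)
  case (Suc s)
  then show ?case by (auto intro!: assms(1) Suc.IH)
qed simp

text \<open>If all pairs of neighbouring dyadic averages were at distance at least \<open>\<delta>\<close>, the
  parallelogram law would lower the squared norm of the averages by \<open>\<delta>\<^sup>2 / 4\<close> on each scale.\<close>

lemma close_dyadic_averages:
  assumes w: "\<And>k. w k \<in> H" "\<And>k. (nrm (w k))\<^sup>2 \<le> R"
    and large: "R < real t * \<delta>\<^sup>2 / 4" and "0 < \<delta>"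
  shows "\<exists>s k. k + 2 ^ Suc s \<le> 2 ^ t \<and> dst (dyadic_avg w s k) (dyadic_avg w s (k + 2 ^ s)) < \<delta>"
proof (rule ccontr)
  assume "\<not> ?thesis"
  then have far: "\<delta> \<le> dst (dyadic_avg w s k) (dyadic_avg w s (k + 2 ^ s))"
    if "k + 2 ^ Suc s \<le> 2 ^ t" for s k using that by (meson not_le)
  have mem: "dyadic_avg w s k \<in> H" for s k
    by (rule dyadic_avg_closed) (auto simp: lc_closed w)
  have "(nrm (dyadic_avg w s k))\<^sup>2 \<le> R - real s * \<delta>\<^sup>2 / 4" if "k + 2 ^ s \<le> 2 ^ t" for s k
    using that
  proof (induction s arbitrary: k)
    case (Suc s)
    have "\<delta>\<^sup>2 \<le> (dst (dyadic_avg w s k) (dyadic_avg w s (k + 2 ^ s)))\<^sup>2"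
      using far[OF Suc.prems] \<open>0 < \<delta>\<close> by (intro power_mono) auto
    moreover have "(nrm (dyadic_avg w s k))\<^sup>2 \<le> R - real s * \<delta>\<^sup>2 / 4"
      using Suc.prems by (intro Suc.IH) simp
    moreover have "(nrm (dyadic_avg w s (k + 2 ^ s)))\<^sup>2 \<le> R - real s * \<delta>\<^sup>2 / 4"
      using Suc.prems by (intro Suc.IH) simp
    ultimately show ?case
      by (simp add: parallelogram mem field_simps)
  qed (simp add: w)
  \<comment> \<open>At scale \<open>t\<close> only the block starting at 0 fits, and
    \<open>large\<close> makes its upper bound negative.\<close>
  from this[of 0 t] show False
    using large zero_le_power2[of "nrm (dyadic_avg w t 0)"] by simp
qed

end

text \<open>The exact solution does not appear: \<open>galerkin\<close> compares levels only with
  each other. Thus a later member, or an average of later members, can stand in for the exact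
  solution on all earlier levels.\<close>

locale galerkin_sequence = bounded_form +
  fixes V :: "nat \<Rightarrow> ('a \<Rightarrow> real) set" and g :: "nat \<Rightarrow> 'a \<Rightarrow> real"
  assumes V_H: "V k \<subseteq> H"
    and V_mono: "j \<le> k \<Longrightarrow> V j \<subseteq> V k"
    and V_lc: "u \<in> V k \<Longrightarrow> v \<in> V k \<Longrightarrow> lc s u t v \<in> V k"
    and g_V: "g k \<in> V k"
    and galerkin: "j \<le> k \<Longrightarrow> v \<in> V j \<Longrightarrow> b (g k) v = b (g j) v"
begin

lemma g_H: "g k \<in> H"
  using g_V V_H by blast

text \<open>Here \<open>w\<close> is anything whose Galerkin projection onto \<open>V k\<close> is
  \<open>g k\<close>. Orthogonality of \<open>w - g k\<close> to \<open>z - g k\<close> leaves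
  \<open>b e e = b e (w - z)\<close>, and one factor \<open>nrm e\<close> is cancelled.\<close>

lemma cea:
  assumes w: "w \<in> H" and z: "z \<in> V k" and eq: "\<And>v. v \<in> V k \<Longrightarrow> b w v = b (g k) v"
  shows "dst w (g k) \<le> C * dst w z"
proof -
  define e where "e = lc 1 w (-1) (g k)"
  have zH: "z \<in> H" using z V_H by blast
  have e: "e \<in> H" unfolding e_def by (intro lc_closed w g_H)
  have wz: "lc 1 w (-1) z \<in> H" by (intro lc_closed w zH)
  have zg: "lc 1 z (-1) (g k) \<in> V k" by (intro V_lc z g_V)
  then have zgH: "lc 1 z (-1) (g k) \<in> H" using V_H by blast
  have "e = lc 1 (lc 1 w (-1) z) 1 (lc 1 z (-1) (g k))"
    by (simp add: lc_def e_def)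
  then have "b e e = b e (lc 1 w (-1) z) + b e (lc 1 z (-1) (g k))"
    using b_right[OF wz zgH e, of 1 1] by simp
  moreover have "b e (lc 1 z (-1) (g k)) = 0"
    unfolding e_def using b_left[OF w g_H zgH] eq[OF zg] by simp
  ultimately have "(nrm e)\<^sup>2 \<le> C * nrm e * dst w z"
    using b_bounded[OF e wz] by (simp add: nrm_sq[OF e] dst_def) (simp add: nrm_def)
  then have *: "nrm e * nrm e \<le> nrm e * (C * dst w z)" by (simp add: power2_eq_square mult_ac)
  show ?thesis
  proof (cases "nrm e = 0")
    case True
    then show ?thesis using dst_nonneg[OF w zH] C_nonneg by (simp add: dst_def e_def)
  next
    case False
    then have "0 < nrm e" using nrm_nonneg[OF e] by simp
    then show ?thesis using * mult_le_cancel_left_pos by (simp add: dst_def e_def)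
  qed
qed

lemma small_window:
  assumes R: "\<And>k. l \<le> k \<Longrightarrow> dst (g k) (g l) \<le> R"
    and large: "R\<^sup>2 < real t * \<delta>\<^sup>2 / 4" and "0 < \<delta>"
  shows "\<exists>m\<ge>l. m + r \<le> l + r * 2 ^ t \<and>
           (\<forall>k. m \<le> k \<and> k \<le> m + r \<longrightarrow> dst (g k) (g m) \<le> 2 * C * \<delta>)"
proof -
  \<comment> \<open>Sampling with stride \<open>r\<close> leaves exactly \<open>r\<close> levels
    between the last sample averaged in \<open>z\<close> and the first one averaged in
    \<open>z'\<close>; these levels form the window.\<close>
  define G where "G k = g (l + r * k)" for k
  \<comment> \<open>The shift by \<open>g l\<close> makes all norms at most \<open>R\<close>. It
    disappears again from differences of averages, because the weights sum to one.\<close>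
  define w where "w k = lc 1 (G k) (-1) (g l)" for k
  have GH: "G k \<in> H" for k by (simp add: G_def g_H)
  have avg_H: "dyadic_avg G s k \<in> H" for s k
    by (rule dyadic_avg_closed) (auto simp: lc_closed GH)
  have avg_w: "dyadic_avg w s k = lc 1 (dyadic_avg G s k) (-1) (g l)" for s k
  proof (induction s arbitrary: k)
    case (Suc s)
    show ?case by (simp only: dyadic_avg.simps Suc.IH) (auto simp: lc_def field_simps intro!: ext)
  qed (simp add: w_def)
  have "w k \<in> H" for k unfolding w_def by (intro lc_closed GH g_H)
  moreover have "(nrm (w k))\<^sup>2 \<le> R\<^sup>2" for k
    using R[of "l + r * k"] dst_nonneg[OF GH g_H, of k l]
    by (intro power_mono) (auto simp: w_def G_def dst_def)
  ultimately obtain s k where sk: "k + 2 ^ Suc s \<le> 2 ^ t"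
      "dst (dyadic_avg w s k) (dyadic_avg w s (k + 2 ^ s)) < \<delta>"
    using close_dyadic_averages[of w "R\<^sup>2" t \<delta>] large \<open>0 < \<delta>\<close> by blast
  define z where "z = dyadic_avg G s k"
  define z' where "z' = dyadic_avg G s (k + 2 ^ s)"
  have zH: "z \<in> H" "z' \<in> H" by (auto simp: z_def z'_def avg_H)
  have "lc 1 (dyadic_avg w s k) (-1) (dyadic_avg w s (k + 2 ^ s)) = lc 1 z (-1) z'"
    by (simp add: avg_w lc_def z_def z'_def)
  then have zz': "dst z z' < \<delta>" using sk(2) by (simp add: dst_def)
  \<comment> \<open>\<open>m\<close> is the last level sampled in \<open>z\<close>; by
    \<open>mr\<close>, \<open>m + r\<close> is the first level sampled in \<open>z'\<close>.\<close>
  define m where "m = l + r * (k + 2 ^ s - 1)"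
  have pos: "0 < (2::nat) ^ s" by simp
  then have mr: "m + r = l + r * (k + 2 ^ s)"
    unfolding m_def by (cases "2 ^ s :: nat") (auto simp: algebra_simps)
  have zV: "z \<in> V m" unfolding z_def
  proof (rule dyadic_avg_closed)
    show "G j \<in> V m" if "j < k + 2 ^ s" for j
    proof -
      have "l + r * j \<le> m" using that unfolding m_def by (intro add_left_mono mult_le_mono) auto
      then show ?thesis unfolding G_def using g_V V_mono by blast
    qed
  qed (rule V_lc)
  \<comment> \<open>The Galerkin equation on level \<open>j\<close> is inherited by averages over
    levels at or above \<open>j\<close>: \<open>b\<close> is linear in its left argument and the
    weights sum to one.\<close>
  have orth: "b (dyadic_avg G s' k') v = b (g j) v"
    if "v \<in> V j" "j \<le> l + r * k'" for s' k' j v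
    using that(2)
  proof (induction s' arbitrary: k')
    case 0
    then show ?case using galerkin that(1) by (simp add: G_def)
  next
    case (Suc s')
    have "v \<in> H" using that(1) V_H by blast
    moreover have "j \<le> l + r * (k' + 2 ^ s')" using Suc.prems by (simp add: algebra_simps)
    ultimately show ?case using Suc by (simp add: b_left avg_H)
  qed
  have near: "dst (g j) z' \<le> C * \<delta>" if "m \<le> j" "j \<le> m + r" for j
  proof -
    have "dst z' (g j) \<le> C * dst z' z"
    proof (rule cea)
      show "z \<in> V j" using zV V_mono that by blast
      show "b z' v = b (g j) v" if "v \<in> V j" for v
        unfolding z'_def using that \<open>j \<le> m + r\<close> mr by (intro orth) auto
    qed (rule zH)
    also have "\<dots> \<le> C * \<delta>"
      using zz' C_nonneg zH by (intro mult_left_mono) (auto simp: dst_sym)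
    finally show ?thesis using zH g_H by (simp add: dst_sym)
  qed
  have "dst (g j) (g m) \<le> 2 * C * \<delta>" if "m \<le> j" "j \<le> m + r" for j
    using dst_triangle[OF g_H zH(2) g_H, of j m] near[OF that] near[of m]
      dst_sym[OF g_H zH(2), of m] by simp
  moreover have "m + r \<le> l + r * 2 ^ t"
    unfolding mr using sk(1) by (intro add_left_mono mult_le_mono) auto
  moreover have "l \<le> m" by (simp add: m_def)
  ultimately show ?thesis by blast
qed

text \<open>In the application \<open>\<eta>\<close> is the quasi-error and \<open>\<alpha>\<close>
  its estimator part. Inside a window the perturbed reduction is iterated \<open>r\<close> times and
  the perturbations add up to at most a geometric series; quasi-monotonicity bridges the way from
  \<open>l\<close> to the window and from there to \<open>l + N\<close>. Since the radius
  \<open>Cd * \<eta> l\<close> and the tolerance \<open>\<epsilon> * \<eta> l\<close> scale alike,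
  \<open>t\<close> and hence \<open>N\<close> do not depend on \<open>l\<close>.\<close>

lemma halving:
  fixes \<alpha> \<eta> :: "nat \<Rightarrow> real"
  assumes le: "\<And>k. 0 \<le> \<eta> k" "\<And>k. \<alpha> k \<le> \<eta> k" "\<And>k. l0 \<le> k \<Longrightarrow> \<eta> k \<le> 2 * \<alpha> k"
    and mono: "\<And>j k. j \<le> k \<Longrightarrow> l0 \<le> k \<Longrightarrow> \<eta> k \<le> Cm * \<eta> j"
    and red: "\<And>k. l0 \<le> k \<Longrightarrow> \<alpha> (Suc k) \<le> q * \<alpha> k + Ci * dst (g (Suc k)) (g k)"
    and dist: "\<And>j k. j \<le> k \<Longrightarrow> dst (g k) (g j) \<le> Cd * \<eta> j"
    and par: "0 \<le> q" "q < 1" "1 \<le> Cm" "0 \<le> Ci" "0 \<le> Cd"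
  shows "\<exists>N>0. \<forall>l\<ge>l0. \<eta> (l + N) \<le> \<eta> l / 2"
proof -
  \<comment> \<open>The contracted term is multiplied by \<open>Cm\<close> before the window and by
    \<open>2 * Cm\<close> after it; this choice of \<open>r\<close> reduces it to a quarter of
    \<open>\<eta> l\<close>.\<close>
  obtain r where r: "q ^ r < 1 / (8 * Cm\<^sup>2)"
    using real_arch_pow_inv[of "1 / (8 * Cm\<^sup>2)" q] par by auto
  \<comment> \<open>Chosen so that the accumulated perturbation
    \<open>2 * Cm * (E / (1 - q))\<close> is the other quarter of \<open>\<eta> l\<close>; the
    summand 1 keeps the denominator positive if \<open>Ci * C = 0\<close>.\<close>
  define \<epsilon> where "\<epsilon> = (1 - q) / (32 * Cm * (Ci * C + 1))"
  have CiC: "0 \<le> Ci * C" using par C_nonneg by simp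
  then have "0 < \<epsilon>" using par by (simp add: \<epsilon>_def)
  obtain t where t: "4 * Cd\<^sup>2 / \<epsilon>\<^sup>2 < real t" using reals_Archimedean2 by blast
  have t': "4 * Cd\<^sup>2 < real t * \<epsilon>\<^sup>2"
    using t \<open>0 < \<epsilon>\<close> by (simp add: pos_divide_less_eq)
  define N where "N = r * 2 ^ t"
  have half: "\<eta> (l + N) \<le> \<eta> l / 2" if l: "l0 \<le> l" for l
  proof (cases "\<eta> l = 0")
    case True
    then show ?thesis using mono[of l "l + N"] l le(1)[of l] by simp
  next
    case False
    then have pos: "0 < \<eta> l" using le(1)[of l] by simp
    have "(Cd * \<eta> l)\<^sup>2 < real t * (\<epsilon> * \<eta> l)\<^sup>2 / 4"
      using mult_strict_right_mono[OF t', of "(\<eta> l)\<^sup>2"] pos by (simp add: power_mult_distrib field_simps)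
    then obtain m where m: "l \<le> m" "m + r \<le> l + N"
        and win: "\<And>k. m \<le> k \<Longrightarrow> k \<le> m + r \<Longrightarrow> dst (g k) (g m) \<le> 2 * C * (\<epsilon> * \<eta> l)"
      using small_window[of l "Cd * \<eta> l" t "\<epsilon> * \<eta> l" r] dist pos \<open>0 < \<epsilon>\<close> unfolding N_def by auto
    \<comment> \<open>Consecutive Galerkin functions in the window are both compared with
      \<open>g m\<close>, which doubles the bound
      \<open>2 * C * (\<epsilon> * \<eta> l)\<close>.\<close>
    define E where "E = Ci * (4 * C * (\<epsilon> * \<eta> l))"
    have step: "\<alpha> (m + i) \<le> q ^ i * \<alpha> m + E / (1 - q)" if "i \<le> r" for i
      using that
    proof (induction i)
      case 0
      then show ?case
        using par C_nonneg \<open>0 < \<epsilon>\<close> pos by (simp add: E_def)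
    next
      case (Suc i)
      have "dst (g (Suc (m + i))) (g (m + i)) \<le> dst (g (Suc (m + i))) (g m) + dst (g (m + i)) (g m)"
        using dst_triangle[of "g (Suc (m + i))" "g m" "g (m + i)"] g_H by (simp add: dst_sym)
      also have "\<dots> \<le> 4 * C * (\<epsilon> * \<eta> l)"
        using win[of "Suc (m + i)"] win[of "m + i"] Suc.prems by simp
      finally have "Ci * dst (g (Suc (m + i))) (g (m + i)) \<le> E"
        unfolding E_def using par by (intro mult_left_mono) auto
      moreover have "q * \<alpha> (m + i) \<le> q * (q ^ i * \<alpha> m + E / (1 - q))"
        using Suc par by (intro mult_left_mono) auto
      ultimately have "\<alpha> (Suc (m + i)) \<le> q * (q ^ i * \<alpha> m + E / (1 - q)) + E"
        using red[of "m + i"] l m by simp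
      also have "\<dots> = q ^ Suc i * \<alpha> m + E / (1 - q)"
        using par by (simp add: field_simps)
      finally show ?case by simp
    qed
    have E: "2 * Cm * (E / (1 - q)) \<le> \<eta> l / 4"
    proof -
      have "2 * Cm * (E / (1 - q)) = (Ci * C) / (Ci * C + 1) * \<eta> l / 4"
        using par CiC unfolding E_def \<epsilon>_def by (simp add: divide_simps)
      also have "\<dots> \<le> 1 * \<eta> l / 4"
        using CiC pos by (intro divide_right_mono mult_right_mono) auto
      finally show ?thesis by simp
    qed
    have "q ^ r * \<alpha> m \<le> q ^ r * (Cm * \<eta> l)"
      using le(2)[of m] mono[of l m] l m par by (intro mult_left_mono) auto
    also have "\<dots> \<le> 1 / (8 * Cm\<^sup>2) * (Cm * \<eta> l)"
      using r par pos by (intro mult_right_mono) auto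
    finally have A: "2 * Cm * (q ^ r * \<alpha> m) \<le> \<eta> l / 4"
      using par by (simp add: field_simps power2_eq_square)
    have "\<eta> (l + N) \<le> Cm * \<eta> (m + r)" using mono[of "m + r" "l + N"] m l by simp
    also have "\<dots> \<le> Cm * (2 * \<alpha> (m + r))"
      using le(3)[of "m + r"] l m par by (intro mult_left_mono) auto
    also have "\<dots> \<le> Cm * (2 * (q ^ r * \<alpha> m + E / (1 - q)))"
      using step[of r] par by (intro mult_left_mono) auto
    also have "\<dots> = 2 * Cm * (q ^ r * \<alpha> m) + 2 * Cm * (E / (1 - q))"
      by (simp add: algebra_simps)
    also have "\<dots> \<le> \<eta> l / 2" using A E by simp
    finally show ?thesis .
  qed
  \<comment> \<open>For \<open>N = 0\<close> the estimate \<open>half\<close> would force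
    \<open>\<eta>\<close> to vanish from \<open>l0\<close> on, and then any positive step works.
    This avoids a separate proof that \<open>r\<close> is positive.\<close>
  have "0 < N \<or> (\<forall>l\<ge>l0. \<eta> l = 0)"
  proof (cases "N = 0")
    case True
    then show ?thesis using half le(1) by (fastforce intro!: antisym)
  qed simp
  then show ?thesis
  proof
    assume "\<forall>l\<ge>l0. \<eta> l = 0"
    then show ?thesis by (intro exI[of _ 1]) auto
  qed (use half in blast)
qed

end

text \<open>Induction in steps of \<open>N\<close>. Each of the last \<open>N\<close> summands is at
  most \<open>Cm / \<eta> l\<close>; the rest is bounded by the claim at \<open>l - N\<close>, where
  halving turns the constant \<open>A\<close> into \<open>A / 2\<close>. So \<open>A\<close> must
  satisfy \<open>A / 2 + N * Cm \<le> A\<close>, and it must cover the fewer than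
  \<open>l0 + N\<close> summands of the base case; \<open>2 * (l0 + N) * Cm\<close> does both.
  Levels below \<open>l0\<close> are harmless, since \<open>mono\<close> restricts only the later
  index.\<close>

lemma reciprocal_sum_le:
  fixes \<eta> :: "nat \<Rightarrow> real"
  assumes nonneg: "\<And>k. 0 \<le> \<eta> k"
    and mono: "\<And>j k. j \<le> k \<Longrightarrow> l0 \<le> k \<Longrightarrow> \<eta> k \<le> Cm * \<eta> j" and "1 \<le> Cm"
    and "0 < N" and half: "\<And>l. l0 \<le> l \<Longrightarrow> \<eta> (l + N) \<le> \<eta> l / 2"
    and "l0 \<le> l" "0 < \<eta> l"
  shows "(\<Sum>j<l. 1 / \<eta> j) \<le> 2 * (real l0 + real N) * Cm / \<eta> l"
  using \<open>l0 \<le> l\<close> \<open>0 < \<eta> l\<close>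
proof (induction l rule: less_induct)
  case (less l)
  have pos: "0 < \<eta> j" if "j \<le> l" for j
    using mono[OF that less.prems(1)] less.prems(2) nonneg[of j] \<open>1 \<le> Cm\<close>
    by (cases "\<eta> j = 0") auto
  have bd: "(\<Sum>j\<in>J. 1 / \<eta> j) \<le> real n * (Cm / \<eta> l)" if "J \<subseteq> {..<l}" "card J \<le> n" for J n
  proof -
    have "(\<Sum>j\<in>J. 1 / \<eta> j) \<le> real (card J) * (Cm / \<eta> l)"
    proof (rule sum_bounded_above)
      fix j assume "j \<in> J"
      then have "j < l" using that by auto
      then show "1 / \<eta> j \<le> Cm / \<eta> l"
        using mono[of j l] less.prems pos[of j] by (simp add: field_simps)
    qed
    also have "\<dots> \<le> real n * (Cm / \<eta> l)"
      using that less.prems \<open>1 \<le> Cm\<close> by (intro mult_right_mono) auto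
    finally show ?thesis .
  qed
  show ?case
  proof (cases "l < l0 + N")
    case True
    then have "(\<Sum>j<l. 1 / \<eta> j) \<le> real (l0 + N) * (Cm / \<eta> l)" by (intro bd) auto
    also have "\<dots> \<le> 2 * (real l0 + real N) * Cm / \<eta> l"
      using less.prems \<open>1 \<le> Cm\<close> by (simp add: field_simps)
    finally show ?thesis .
  next
    case False
    define k where "k = l - N"
    have k: "k < l" "l0 \<le> k" "k + N = l" using False \<open>0 < N\<close> by (auto simp: k_def)
    have "(\<Sum>j<l. 1 / \<eta> j) = (\<Sum>j<k. 1 / \<eta> j) + (\<Sum>j=k..<l. 1 / \<eta> j)"
      using k by (subst sum.atLeastLessThan_concat[of 0 k l, symmetric, simplified atLeast0LessThan])
        (auto simp: atLeast0LessThan)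
    also have "(\<Sum>j=k..<l. 1 / \<eta> j) \<le> real N * (Cm / \<eta> l)"
      using k by (intro bd) auto
    also have "(\<Sum>j<k. 1 / \<eta> j) \<le> 2 * (real l0 + real N) * Cm / \<eta> k"
      using k pos[of k] by (intro less.IH) auto
    also have "\<dots> \<le> 2 * (real l0 + real N) * Cm / (2 * \<eta> l)"
      using half[of k] k pos[of k] less.prems \<open>1 \<le> Cm\<close> by (intro divide_left_mono) auto
    finally have "(\<Sum>j<l. 1 / \<eta> j) \<le> (real l0 + 2 * real N) * Cm / \<eta> l"
      using less.prems by (simp add: field_simps)
    also have "\<dots> \<le> 2 * (real l0 + real N) * Cm / \<eta> l"
      using less.prems \<open>1 \<le> Cm\<close> by (intro divide_right_mono mult_right_mono) auto
    finally show ?thesis .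
  qed
qed

section \<open>Smooth bump functions\<close>

text \<open>\<open>smooth\<close> is defined by recursion on the order of differentiability. A set
  of differentiable functions that is closed under partial derivatives serves as an invariant for
  all orders simultaneously.\<close>

lemma smooth_coinduct:
  assumes step: "\<And>f. f \<in> S \<Longrightarrow> (\<forall>x. f differentiable (at x)) \<and> (\<forall>i. partial_d i f \<in> S)"
    and "f \<in> S"
  shows "smooth f"
proof -
  have "Ck n f" if "f \<in> S" for n f
    using that
  proof (induction n arbitrary: f)
    case 0
    then have "f differentiable (at x)" for x using step by blast
    then have "isCont f x" for x by (rule differentiable_imp_continuous_within)
    then show ?case by (simp add: continuous_at_imp_continuous_on)
  next
    case (Suc n)
    then show ?case using step by simp
  qed
  then show ?thesis using assms(2) by (simp add: smooth_def)
qed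

lemma smooth_step:
  assumes "smooth f"
  shows "f differentiable (at x)" "smooth (partial_d i f)" "continuous_on UNIV f"
proof -
  have "Ck (Suc n) f" for n using assms by (auto simp: smooth_def simp del: Ck.simps)
  then show "f differentiable (at x)" "smooth (partial_d i f)" by (auto simp: smooth_def)
  show "continuous_on UNIV f" using assms by (auto simp: smooth_def dest: spec[of _ 0])
qed

lemma partial_d_eqI:
  "(f has_derivative f') (at x) \<Longrightarrow> partial_d i f x = f' (axis i 1)"
  by (simp add: partial_d_def frechet_derivative_at[symmetric])

lemma has_derivative_frechet:
  "f differentiable (at x) \<Longrightarrow> (f has_derivative frechet_derivative f (at x)) (at x)"
  by (simp add: frechet_derivative_works)

lemma partial_d_lin:
  assumes "f differentiable (at x)" "g differentiable (at x)"
  shows "partial_d i (\<lambda>x. s * f x + t * g x) x = s * partial_d i f x + t * partial_d i g x"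
  unfolding partial_d_def[of _ f] partial_d_def[of _ g]
  by (rule partial_d_eqI) (intro derivative_intros has_derivative_frechet assms)

lemma smooth_lin:
  assumes "smooth f" "smooth g"
  shows "smooth (\<lambda>x. s * f x + t * g x)"
proof (rule smooth_coinduct)
  let ?S = "{\<lambda>x. s * f x + t * g x | f g. smooth f \<and> smooth g}"
  show "(\<lambda>x. s * f x + t * g x) \<in> ?S" using assms by blast
  fix h assume "h \<in> ?S"
  then obtain f g where h: "h = (\<lambda>x. s * f x + t * g x)" "smooth f" "smooth g" by blast
  then have "\<forall>x. h differentiable (at x)"
    using smooth_step(1) by (auto intro!: derivative_intros)
  moreover have "partial_d i h = (\<lambda>x. s * partial_d i f x + t * partial_d i g x)" for i
    unfolding h(1) using h by (intro ext partial_d_lin smooth_step)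
  ultimately show "(\<forall>x. h differentiable (at x)) \<and> (\<forall>i. partial_d i h \<in> ?S)"
    using h smooth_step(2) by blast
qed

text \<open>The classical flat function is \<open>flat_exp 1\<close>. The polynomial in
  \<open>1 / x\<close> is carried along because every derivative has this form again.\<close>

definition flat_exp :: "real poly \<Rightarrow> real \<Rightarrow> real" where
  "flat_exp p x = (if 0 < x then poly p (1 / x) * exp (- (1 / x)) else 0)"

lemma poly_times_exp_minus_tendsto_0: "((\<lambda>y. poly p y * exp (- y)) \<longlongrightarrow> (0::real)) at_top"
proof -
  have "((\<lambda>y. \<Sum>i\<le>degree p. coeff p i * (y ^ i / exp y)) \<longlongrightarrow> (\<Sum>i\<le>degree p. coeff p i * 0)) at_top"
    by (intro tendsto_intros tendsto_power_div_exp_0)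
  then show ?thesis
    by (simp add: poly_altdef sum_distrib_left sum_distrib_right exp_minus divide_inverse mult_ac)
qed

text \<open>For \<open>x > 0\<close>, differentiating \<open>p(1/x) exp(-1/x)\<close> gives
  \<open>(p - p')(1/x) exp(-1/x) / x^2\<close>, and \<open>1 / x^2\<close> is the polynomial
  \<open>[:0, 0, 1:]\<close> at \<open>1 / x\<close>. At 0 the right difference quotient is the same
  kind of expression for \<open>[:0, 1:] * p\<close>, so exponential decay beats it.\<close>

lemma flat_exp_deriv:
  "(flat_exp p has_real_derivative flat_exp ([:0, 0, 1:] * (p - pderiv p)) x) (at x)"
proof -
  consider "x < 0" | "x = 0" | "0 < x" by linarith
  then show ?thesis
  proof cases
    case 1
    have "((\<lambda>_. 0) has_real_derivative flat_exp ([:0, 0, 1:] * (p - pderiv p)) x) (at x)"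
      using 1 by (simp add: flat_exp_def)
    then show ?thesis
      by (rule has_field_derivative_transform_within_open[where S = "{..<0}"])
        (use 1 in \<open>auto simp: flat_exp_def\<close>)
  next
    case 3
    have "((\<lambda>x. poly p (1 / x) * exp (- (1 / x))) has_real_derivative
            flat_exp ([:0, 0, 1:] * (p - pderiv p)) x) (at x)"
      using 3 by (auto intro!: derivative_eq_intros simp: flat_exp_def field_simps power2_eq_square)
    then show ?thesis
      by (rule has_field_derivative_transform_within_open[where S = "{0<..}"])
        (use 3 in \<open>auto simp: flat_exp_def\<close>)
  next
    case 2
    have "((\<lambda>h. poly ([:0, 1:] * p) (inverse h) * exp (- inverse h)) \<longlongrightarrow> 0) (at_right 0)"
      by (rule filterlim_compose[OF poly_times_exp_minus_tendsto_0 filterlim_inverse_at_top_right])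
    then have "((\<lambda>h. flat_exp p h / h) \<longlongrightarrow> 0) (at_right 0)"
      by (rule Lim_transform_eventually)
        (auto simp: eventually_at_right_field flat_exp_def field_simps intro!: exI[of _ 1])
    moreover have "((\<lambda>h. flat_exp p h / h) \<longlongrightarrow> 0) (at_left 0)"
      by (rule Lim_transform_eventually[OF tendsto_const])
        (auto simp: eventually_at_left_field flat_exp_def intro!: exI[of _ "-1"])
    ultimately show ?thesis
      using 2 by (simp add: DERIV_def flat_exp_def filterlim_at_split)
  qed
qed

text \<open>The smallest family containing the needed bumps on which the invariant of
  \<open>smooth_coinduct\<close> can be checked: \<open>base\<close> admits all polynomials because
  differentiation changes \<open>p\<close>, and sums are present because of the product
  rule.\<close>

inductive_set bump_algebra :: "(real^'d \<Rightarrow> real) set" where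
  const: "(\<lambda>x. c) \<in> bump_algebra"
| base: "(\<lambda>x. flat_exp p (s * x $ i + c)) \<in> bump_algebra"
| add: "f \<in> bump_algebra \<Longrightarrow> g \<in> bump_algebra \<Longrightarrow> (\<lambda>x. f x + g x) \<in> bump_algebra"
| mult: "f \<in> bump_algebra \<Longrightarrow> g \<in> bump_algebra \<Longrightarrow> (\<lambda>x. f x * g x) \<in> bump_algebra"

lemma bump_algebra_smooth:
  assumes "f \<in> bump_algebra"
  shows "smooth f"
proof (rule smooth_coinduct[OF _ assms])
  fix f :: "real^'d \<Rightarrow> real" assume "f \<in> bump_algebra"
  then show "(\<forall>x. f differentiable (at x)) \<and> (\<forall>i. partial_d i f \<in> bump_algebra)"
  proof induction
    case (const c)
    have "((\<lambda>x. c) has_derivative (\<lambda>h. 0)) (at x)" for x :: "real^'d" by simp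
    then have "partial_d i (\<lambda>x. c) = (\<lambda>x::real^'d. 0)" for i
      using partial_d_eqI by blast
    then show ?case by (auto intro: bump_algebra.const)
  next
    case (base p s j c)
    let ?q = "[:0, 0, 1:] * (p - pderiv p)"
    have d: "((\<lambda>x. flat_exp p (s * x $ j + c)) has_derivative
        (\<lambda>h. flat_exp ?q (s * x $ j + c) * (s * h $ j))) (at x)" for x :: "real^'d"
    proof -
      have "((\<lambda>x. s * x $ j + c) has_derivative (\<lambda>h. s * h $ j)) (at x)"
        by (auto intro!: derivative_eq_intros bounded_linear.has_derivative[OF bounded_linear_vec_nth])
      moreover have "(flat_exp p has_derivative (*) (flat_exp ?q (s * x $ j + c))) (at (s * x $ j + c))"
        using flat_exp_deriv by (simp add: has_field_derivative_def del: mult_pCons_left)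
      ultimately show ?thesis
        using has_derivative_compose[of "\<lambda>x. s * x $ j + c" _ x UNIV "flat_exp p"] by blast
    qed
    then have "partial_d i (\<lambda>x. flat_exp p (s * x $ j + c)) =
        (\<lambda>x. (s * axis i 1 $ j) * flat_exp ?q (s * x $ j + c))" for i
      by (intro ext) (simp only: partial_d_eqI[OF d] mult.commute)
    then show ?case
      using d by (auto simp: differentiable_def intro!: bump_algebra.intros simp del: mult_pCons_left)
  next
    case (add f g)
    then have "partial_d i (\<lambda>x. f x + g x) = (\<lambda>x. partial_d i f x + partial_d i g x)" for i
      using partial_d_lin[of f _ g i 1 1] by auto
    then show ?case using add by (auto intro!: bump_algebra.intros derivative_intros)
  next
    case (mult f g)
    then have "partial_d i (\<lambda>x. f x * g x) = (\<lambda>x. f x * partial_d i g x + partial_d i f x * g x)" for i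
      unfolding partial_d_def[of _ f] partial_d_def[of _ g]
      by (intro ext partial_d_eqI has_derivative_mult has_derivative_frechet) auto
    then show ?case using mult by (auto intro!: bump_algebra.intros derivative_intros)
  qed
qed

lemma prod_bump_algebra:
  "finite I \<Longrightarrow> (\<And>i. i \<in> I \<Longrightarrow> f i \<in> bump_algebra) \<Longrightarrow> (\<lambda>x. \<Prod>i\<in>I. f i x) \<in> bump_algebra"
  by (induction I rule: finite_induct) (auto intro: bump_algebra.intros)

text \<open>Scaling by \<open>n\<close> sharpens the transition at the faces: inside the box each
  factor \<open>exp (-1 / (n * y))\<close> tends to 1, so the bumps converge pointwise to the
  indicator of the open box. The arguments are written as \<open>s * x $ i + c\<close> to fit
  \<open>base\<close>.\<close>

definition box_bump :: "real^'d \<Rightarrow> real^'d \<Rightarrow> nat \<Rightarrow> real^'d \<Rightarrow> real" where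
  "box_bump a b n x = (\<Prod>i\<in>UNIV. flat_exp 1 (real n * x $ i + - (real n * a $ i)) *
      flat_exp 1 (- real n * x $ i + real n * b $ i))"

lemma smooth_box_bump: "smooth (box_bump a b n)"
  unfolding box_bump_def[abs_def]
  by (intro bump_algebra_smooth prod_bump_algebra bump_algebra.intros finite)

lemma flat_exp_1_bounds: "0 \<le> flat_exp 1 x" "flat_exp 1 x \<le> 1"
  by (auto simp: flat_exp_def)

lemma box_bump_bounds: "0 \<le> box_bump a b n x" "box_bump a b n x \<le> 1"
  unfolding box_bump_def
  by (auto intro!: prod_nonneg prod_le_1 mult_nonneg_nonneg mult_le_one flat_exp_1_bounds)

lemma box_bump_outside:
  assumes "x \<notin> box a b"
  shows "box_bump a b n x = 0"
proof -
  obtain i where "x $ i \<le> a $ i \<or> b $ i \<le> x $ i" using assms by (auto simp: mem_box_cart not_less)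
  then have "real n * x $ i + - (real n * a $ i) \<le> 0 \<or> - real n * x $ i + real n * b $ i \<le> 0"
    by (auto intro: mult_left_mono)
  then have "flat_exp 1 (real n * x $ i + - (real n * a $ i)) *
      flat_exp 1 (- real n * x $ i + real n * b $ i) = 0"
    by (auto simp: flat_exp_def)
  then show ?thesis unfolding box_bump_def by (intro prod_zero[OF finite] bexI[of _ i]) simp_all
qed

lemma flat_exp_1_limit:
  assumes "0 < y"
  shows "(\<lambda>n. flat_exp 1 (real n * y)) \<longlonglongrightarrow> 1"
proof -
  have "(\<lambda>n. exp (- (1 / y * inverse (real n)))) \<longlonglongrightarrow> exp (- (1 / y * 0))"
    by (intro tendsto_intros tendsto_inverse_0_at_top filterlim_real_sequentially)
  then have "(\<lambda>n. exp (- (1 / y * inverse (real n)))) \<longlonglongrightarrow> 1" by simp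
  then show ?thesis
    by (rule Lim_transform_eventually)
      (use assms in \<open>auto simp: flat_exp_def field_simps intro!: eventually_mono[OF eventually_gt_at_top[of 0]]\<close>)
qed

lemma box_bump_limit: "(\<lambda>n. box_bump a b n x) \<longlonglongrightarrow> indicator (box a b) x"
proof (cases "x \<in> box a b")
  case True
  then have pos: "0 < x $ i - a $ i" "0 < b $ i - x $ i" for i by (auto simp: mem_box_cart)
  have "(\<lambda>n. box_bump a b n x) = (\<lambda>n. \<Prod>i\<in>UNIV. flat_exp 1 (real n * (x $ i - a $ i)) *
      flat_exp 1 (real n * (b $ i - x $ i)))"
    by (simp add: box_bump_def algebra_simps)
  moreover have "\<dots> \<longlonglongrightarrow> (\<Prod>i\<in>(UNIV :: 'a set). 1 * 1)"
    by (intro tendsto_prod tendsto_mult flat_exp_1_limit pos)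
  ultimately show ?thesis using True by simp
next
  case False
  then show ?thesis by (simp add: box_bump_outside)
qed

lemma test_fun_box_bump:
  assumes "cbox a b \<subseteq> \<Omega>"
  shows "test_fun \<Omega> (box_bump a b n)"
proof -
  have "{x. box_bump a b n x \<noteq> 0} \<subseteq> cbox a b"
    using box_bump_outside box_subset_cbox by blast
  then have "closure {x. box_bump a b n x \<noteq> 0} \<subseteq> cbox a b"
    by (simp add: closure_minimal closed_cbox)
  moreover from this have "bounded (closure {x. box_bump a b n x \<noteq> 0})"
    by (rule bounded_subset[OF bounded_cbox])
  ultimately show ?thesis
    using assms smooth_box_bump[of a b n] unfolding test_fun_def compact_eq_bounded_closed
    by (intro conjI) auto
qed

section \<open>Uniqueness of weak gradients\<close>

lemma borel_measurable_indicator_box: "indicat_real (box a b) \<in> borel_measurable lebesgue"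
  for a b :: "'a::euclidean_space"
  by (intro borel_measurable_indicator fmeasurableD lmeasurable_box)

text \<open>Dynkin argument: boxes are stable under intersection and generate the Borel sets, and
  the sets over which the integral vanishes form a Dynkin system. An integrable function with
  vanishing integral over every Borel set is zero almost everywhere.\<close>

lemma AE_zero_of_box_integrals:
  fixes F :: "'a::euclidean_space \<Rightarrow> real"
  assumes int: "integrable lebesgue F"
    and box: "\<And>a b. (LINT x|lebesgue. indicator (box a b) x * F x) = 0"
  shows "AE x in lebesgue. F x = 0"
proof -
  have "F \<in> borel_measurable lebesgue" using int by simp
  \<comment> \<open>\<open>F\<close> is only Lebesgue measurable, while the Dynkin argument runs
    over Borel sets; a Borel representative bridges the two measures.\<close>
  from completion_ex_borel_measurable_real[OF this] obtain F' where
    F'[measurable]: "F' \<in> borel_measurable lborel" and eq: "AE x in lborel. F x = F' x"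
    by blast
  have F'_leb: "F' \<in> borel_measurable lebesgue" using F' measurable_completion by blast
  have eq': "AE x in lebesgue. F x = F' x" using eq by (rule AE_completion)
  have "integrable lebesgue F'"
    using int integrable_cong_AE[OF _ F'_leb eq'] by simp
  then have int': "integrable lborel F'" by (simp add: integrable_completion)
  have basic: "set_lebesgue_integral lborel (box a b) F' = 0" for a b
  proof -
    have m: "(\<lambda>x. indicator (box a b) x * F' x) \<in> borel_measurable lborel" by measurable
    have "0 = (LINT x|lebesgue. indicator (box a b) x * F' x)"
      unfolding box[of a b, symmetric]
    proof (rule integral_cong_AE)
      show "(\<lambda>x. indicator (box a b) x * F x) \<in> borel_measurable lebesgue"
        using int by (intro borel_measurable_times borel_measurable_indicator_box) auto
      show "(\<lambda>x. indicator (box a b) x * F' x) \<in> borel_measurable lebesgue"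
        using m measurable_completion by blast
      show "AE x in lebesgue. indicator (box a b) x * F x = indicator (box a b) x * F' x"
        using eq' by eventually_elim simp
    qed
    then show ?thesis using integral_completion[OF m] by (simp add: set_lebesgue_integral_def)
  qed
  have set_int: "set_integrable lborel A F'" if "A \<in> sets borel" for A
    unfolding set_integrable_def using that by (intro integrable_mult_indicator int') simp
  \<comment> \<open>Complements in the Dynkin system need the integral over the whole space,
    obtained by exhausting it with boxes.\<close>
  have "incseq (\<lambda>i::nat. box (- (real i *\<^sub>R One)) (real i *\<^sub>R One) :: 'a set)"
    by (intro monoI) (auto simp: subset_box)
  then have "(\<lambda>i. set_lebesgue_integral lborel (box (- (real i *\<^sub>R One)) (real i *\<^sub>R One)) F')
      \<longlonglongrightarrow> set_lebesgue_integral lborel (\<Union>i. box (- (real i *\<^sub>R One)) (real i *\<^sub>R One)) F'"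
    by (intro set_integral_cont_up set_int) auto
  then have total: "set_lebesgue_integral lborel UNIV F' = 0"
    by (simp add: basic UN_box_eq_UNIV LIMSEQ_const_iff)
  have zero: "set_lebesgue_integral lborel A F' = 0" if "A \<in> sets borel" for A
  proof -
    have "Int_stable (range (\<lambda>(a, b). box a b :: 'a set))"
      unfolding Int_stable_def by (auto simp: box_Int_box)
    moreover have "range (\<lambda>(a, b). box a b :: 'a set) \<subseteq> Pow UNIV" by simp
    moreover have "A \<in> sigma_sets UNIV (range (\<lambda>(a, b). box a b))"
      using that by (simp add: borel_eq_box)
    ultimately show ?thesis
    proof (induction A rule: sigma_sets_induct_disjoint)
      case (compl A)
      then have A: "A \<in> sets borel" by (simp add: borel_eq_box)
      have "set_lebesgue_integral lborel (A \<union> (UNIV - A)) F' =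
          set_lebesgue_integral lborel A F' + set_lebesgue_integral lborel (UNIV - A) F'"
        using A by (intro set_integral_Un set_int) auto
      then show ?case using compl total by simp
    next
      case (union A)
      then have A: "range A \<subseteq> sets borel" by (simp add: borel_eq_box)
      then have U: "(\<Union>i. A i) \<in> sets borel" by blast
      have "set_lebesgue_integral lborel (\<Union>i. A i) F' = (\<Sum>i. set_lebesgue_integral lborel (A i) F')"
        using A union.hyps(1) set_int[OF U]
        by (intro lebesgue_integral_countable_add) (auto simp: disjoint_family_on_def)
      then show ?case using union by simp
    next
      case empty
      then show ?case by (simp add: set_lebesgue_integral_def)
    qed (auto simp: basic)
  qed
  have "AE x in lborel. F' x = 0"
    by (rule sigma_finite_measure.density_zero[OF sigma_finite_lborel int']) (simp add: zero)
  then have "AE x in lebesgue. F' x = 0" by (rule AE_completion)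
  then show ?thesis using eq' by eventually_elim simp
qed

lemma integrable_mult_bounded:
  fixes f \<phi> :: "'a \<Rightarrow> real"
  assumes "integrable M f" "\<phi> \<in> borel_measurable M" "AE x in M. \<bar>\<phi> x\<bar> \<le> B"
  shows "integrable M (\<lambda>x. f x * \<phi> x)"
proof (rule Bochner_Integration.integrable_bound)
  show "integrable M (\<lambda>x. B * f x)" using assms(1) by simp
  show "AE x in M. norm (f x * \<phi> x) \<le> norm (B * f x)"
    using assms(3)
  proof eventually_elim
    case (elim x)
    then have "\<bar>\<phi> x\<bar> * \<bar>f x\<bar> \<le> \<bar>B\<bar> * \<bar>f x\<bar>" by (intro mult_right_mono) auto
    then show ?case by (simp add: abs_mult mult.commute)
  qed
qed (use assms in auto)

lemma borel_measurable_continuous_lebesgue_on: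
  fixes f :: "'a::euclidean_space \<Rightarrow> 'b::euclidean_space"
  assumes "continuous_on UNIV f"
  shows "f \<in> borel_measurable (lebesgue_on S)"
  using assms
  by (intro measurable_restrict_space1 measurable_completion) (simp add: borel_measurable_continuous_onI)

lemma loc_integrable_mult_compact_support:
  fixes g \<phi> :: "real^'d \<Rightarrow> real"
  assumes g: "loc_integrable \<Omega> g" and "\<Omega> \<in> sets lebesgue" and K: "compact K" "K \<subseteq> \<Omega>"
    and cont: "continuous_on UNIV \<phi>" and supp: "\<And>x. x \<notin> K \<Longrightarrow> \<phi> x = 0"
  shows "integrable (lebesgue_on \<Omega>) (\<lambda>x. g x * \<phi> x)"
proof -
  have Kl: "K \<in> sets lebesgue" using K(1) by (simp add: borel_compact)
  have "bounded (\<phi> ` K)"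
    using K(1) cont by (meson compact_continuous_image compact_imp_bounded continuous_on_subset subset_UNIV)
  then obtain B where B: "\<And>x. x \<in> K \<Longrightarrow> \<bar>\<phi> x\<bar> \<le> B" by (auto simp: bounded_iff)
  have "integrable (lebesgue_on K) (\<lambda>x. g x * \<phi> x)"
    using g K B
    by (intro integrable_mult_bounded[of _ _ _ B] borel_measurable_continuous_lebesgue_on cont AE_I2)
      (auto simp: loc_integrable_def)
  then have "integrable lebesgue (\<lambda>x. indicator K x *\<^sub>R (g x * \<phi> x))"
    using Kl by (simp add: integrable_restrict_space)
  also have "(\<lambda>x. indicator K x *\<^sub>R (g x * \<phi> x)) = (\<lambda>x. indicator \<Omega> x *\<^sub>R (g x * \<phi> x))"
    using K supp by (auto simp: indicator_def fun_eq_iff)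
  finally show ?thesis using assms(2) by (simp add: integrable_restrict_space)
qed

lemma test_fun_support:
  assumes "test_fun \<Omega> \<phi>"
  obtains K where "compact K" "K \<subseteq> \<Omega>" "\<And>x. x \<notin> K \<Longrightarrow> \<phi> x = 0" "\<And>x i. x \<notin> K \<Longrightarrow> partial_d i \<phi> x = 0"
proof
  let ?K = "closure {x. \<phi> x \<noteq> 0}"
  show "compact ?K" "?K \<subseteq> \<Omega>" using assms by (auto simp: test_fun_def)
  show "\<phi> x = 0" if "x \<notin> ?K" for x using that closure_subset[of "{x. \<phi> x \<noteq> 0}"] by auto
  show "partial_d i \<phi> x = 0" if "x \<notin> ?K" for x i
  proof -
    have "((\<lambda>_. 0) has_derivative (\<lambda>_. 0)) (at x)" by simp
    then have "(\<phi> has_derivative (\<lambda>_. 0)) (at x)"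
    proof (rule has_derivative_transform_within_open)
      show "open (- ?K)" by (rule open_Compl) simp
      show "0 = \<phi> y" if "y \<in> - ?K" for y using that closure_subset[of "{x. \<phi> x \<noteq> 0}"] by auto
    qed (use that in auto)
    from partial_d_eqI[OF this] show ?thesis by simp
  qed
qed

lemma test_fun_smooth: "test_fun \<Omega> \<phi> \<Longrightarrow> smooth \<phi>"
  by (simp add: test_fun_def)

lemma loc_integrable_mult_test_fun:
  assumes "loc_integrable \<Omega> g" "\<Omega> \<in> sets lebesgue" "test_fun \<Omega> \<phi>"
  shows "integrable (lebesgue_on \<Omega>) (\<lambda>x. g x * \<phi> x)"
    and "integrable (lebesgue_on \<Omega>) (\<lambda>x. g x * partial_d i \<phi> x)"
proof -
  obtain K where K: "compact K" "K \<subseteq> \<Omega>" "\<And>x. x \<notin> K \<Longrightarrow> \<phi> x = 0" "\<And>x i. x \<notin> K \<Longrightarrow> partial_d i \<phi> x = 0"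
    using test_fun_support[OF assms(3)] by blast
  note int = loc_integrable_mult_compact_support[OF assms(1,2) K(1,2)]
  note sm = smooth_step[OF test_fun_smooth[OF assms(3)]]
  show "integrable (lebesgue_on \<Omega>) (\<lambda>x. g x * \<phi> x)"
    by (rule int) (use sm(3) K(3) in auto)
  show "integrable (lebesgue_on \<Omega>) (\<lambda>x. g x * partial_d i \<phi> x)"
    by (rule int) (use smooth_step(3)[OF sm(2)] K(4) in auto)
qed

text \<open>Bump functions converge to indicators of boxes, so \<open>g\<close> has zero integral
  over every box whose closed hull lies in \<open>\<Omega>\<close>. This makes \<open>g\<close>
  vanish almost everywhere on each closed box in \<open>\<Omega>\<close>, and countably many of
  these cover \<open>\<Omega>\<close>.\<close>

lemma fundamental_lemma:
  fixes g :: "real^'d \<Rightarrow> real"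
  assumes "open \<Omega>" and g: "loc_integrable \<Omega> g"
    and zero: "\<And>\<phi>. test_fun \<Omega> \<phi> \<Longrightarrow> (LINT x|lebesgue_on \<Omega>. g x * \<phi> x) = 0"
  shows "AE x in lebesgue_on \<Omega>. g x = 0"
proof -
  have Om: "\<Omega> \<in> sets lebesgue" using \<open>open \<Omega>\<close> by (simp add: borel_open)
  have int_cbox: "integrable lebesgue (\<lambda>x. indicator (cbox a b) x * g x)" if "cbox a b \<subseteq> \<Omega>" for a b
  proof -
    have "integrable (lebesgue_on (cbox a b)) g" using g that by (simp add: loc_integrable_def compact_cbox)
    then show ?thesis by (simp add: integrable_restrict_space)
  qed
  have box0: "(LINT x|lebesgue. indicator (box a b) x * g x) = 0" if sub: "cbox a b \<subseteq> \<Omega>" for a b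
  proof -
    \<comment> \<open>\<open>g\<close> is only locally integrable; its truncation to the closed box
      is an integrable majorant up to sign, and no value of the bumps is lost.\<close>
    define G where "G x = indicator (cbox a b) x * g x" for x
    have G: "integrable lebesgue G" unfolding G_def by (rule int_cbox[OF sub])
    have "(\<lambda>n. LINT x|lebesgue. box_bump a b n x * G x) \<longlonglongrightarrow> (LINT x|lebesgue. indicator (box a b) x * G x)"
    proof (rule integral_dominated_convergence)
      show "(\<lambda>x. indicator (box a b) x * G x) \<in> borel_measurable lebesgue"
        using G by (intro borel_measurable_times borel_measurable_indicator_box) auto
      have "box_bump a b n \<in> borel_measurable lebesgue" for n
        using borel_measurable_continuous_lebesgue_on[OF smooth_step(3)[OF smooth_box_bump], where S = UNIV]
        unfolding lebesgue_on_UNIV_eq .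
      then show "(\<lambda>x. box_bump a b n x * G x) \<in> borel_measurable lebesgue" for n
        by (intro borel_measurable_times borel_measurable_integrable[OF G])
      show "integrable lebesgue (\<lambda>x. \<bar>G x\<bar>)" using G by simp
      show "AE x in lebesgue. (\<lambda>n. box_bump a b n x * G x) \<longlonglongrightarrow> indicator (box a b) x * G x"
        by (intro AE_I2 tendsto_intros box_bump_limit)
      show "AE x in lebesgue. norm (box_bump a b n x * G x) \<le> \<bar>G x\<bar>" for n
        by (intro AE_I2) (simp add: abs_mult mult_left_le_one_le box_bump_bounds)
    qed
    moreover have "(LINT x|lebesgue. box_bump a b n x * G x) = 0" for n
    proof -
      have "box_bump a b n x * G x = indicator \<Omega> x *\<^sub>R (g x * box_bump a b n x)" for x
        using sub box_bump_outside[of x a b n] box_subset_cbox[of a b]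
        by (cases "x \<in> box a b") (auto simp: G_def indicator_def)
      then have "(\<lambda>x. box_bump a b n x * G x) = (\<lambda>x. indicator \<Omega> x *\<^sub>R (g x * box_bump a b n x))"
        by (rule ext)
      then have "(LINT x|lebesgue. box_bump a b n x * G x) = (LINT x|lebesgue_on \<Omega>. g x * box_bump a b n x)"
        using Om integral_restrict_space[of \<Omega> lebesgue "\<lambda>x. g x * box_bump a b n x"] by simp
      then show ?thesis using zero test_fun_box_bump[OF sub] by simp
    qed
    ultimately have "(LINT x|lebesgue. indicator (box a b) x * G x) = 0"
      by (simp add: LIMSEQ_const_iff)
    moreover have "indicator (box a b) x * G x = indicator (box a b) x * g x" for x
      using box_subset_cbox[of a b] by (auto simp: G_def indicator_def)
    ultimately show ?thesis by simp
  qed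
  have AE_cbox: "AE x in lebesgue. x \<in> cbox a b \<longrightarrow> g x = 0" if sub: "cbox a b \<subseteq> \<Omega>" for a b
  proof -
    define F where "F x = indicator (box a b) x * (indicator (cbox a b) x * g x)" for x
    have "integrable lebesgue F"
      unfolding F_def using integrable_mult_indicator[OF _ int_cbox[OF sub], of "box a b"] by simp
    moreover have "(LINT x|lebesgue. indicator (box c d) x * F x) = 0" for c d
    proof -
      \<comment> \<open>The criterion asks for all boxes of the whole space. Intersecting with
        \<open>box a b\<close> gives a box again, and its closure stays in \<open>cbox a b\<close>,
        so that \<open>box0\<close> applies.\<close>
      obtain c' d' where cd: "box c d \<inter> box a b = box c' d'" by (rule that[OF box_Int_box])
      have "indicator (box c d) x * F x = indicator (box c' d') x * g x" for x
        using box_subset_cbox[of a b] unfolding F_def cd[symmetric] by (auto simp: indicator_def)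
      moreover have "(LINT x|lebesgue. indicator (box c' d') x * g x) = 0"
      proof (cases "box c' d' = {}")
        case False
        have "closure (box c' d') \<subseteq> closure (box a b)" using cd by (intro closure_mono) blast
        also have "\<dots> \<subseteq> cbox a b" by (rule closure_minimal[OF box_subset_cbox closed_cbox])
        finally show ?thesis using False sub by (intro box0) (simp add: closure_box)
      qed simp
      ultimately show ?thesis by simp
    qed
    ultimately have "AE x in lebesgue. F x = 0" by (rule AE_zero_of_box_integrals)
    moreover have "AE x in lebesgue. x \<notin> cbox a b - box a b"
      using negligible_frontier_interval[of a b] by (intro AE_not_in) (simp add: negligible_iff_null_sets)
    ultimately show ?thesis
      by eventually_elim (auto simp: F_def)
  qed
  obtain \<D> where D: "countable \<D>" "\<D> \<subseteq> Pow \<Omega>" "\<And>X. X \<in> \<D> \<Longrightarrow> \<exists>a b. X = cbox a b" "\<Union>\<D> = \<Omega>"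
    by (rule open_countable_Union_open_cbox[OF \<open>open \<Omega>\<close>]) (rule that; assumption)
  have "AE x in lebesgue. \<forall>X\<in>\<D>. x \<in> X \<longrightarrow> g x = 0"
    unfolding AE_ball_countable[OF D(1)]
  proof
    fix X assume X: "X \<in> \<D>"
    then obtain a b where "X = cbox a b" using D(3) by metis
    then show "AE x in lebesgue. x \<in> X \<longrightarrow> g x = 0" using AE_cbox[of a b] D(2) X by auto
  qed
  then have "AE x in lebesgue. x \<in> \<Omega> \<longrightarrow> g x = 0"
    by eventually_elim (use D(4) in blast)
  then show ?thesis using Om by (simp add: AE_restrict_space_iff)
qed

text \<open>The bridge from the choice operator in \<open>wgrad\<close> to calculus: every identity
  for weak gradients below is obtained by exhibiting a second weak gradient and comparing.\<close>

lemma weak_grad_unique: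
  assumes "open \<Omega>" and g: "has_weak_grad \<Omega> v g" and h: "has_weak_grad \<Omega> v h"
  shows "AE x in lebesgue_on \<Omega>. g x = h x"
proof -
  have Om: "\<Omega> \<in> sets lebesgue" using \<open>open \<Omega>\<close> by (simp add: borel_open)
  have comp: "loc_integrable \<Omega> (\<lambda>x. f x $ i)" if "loc_integrable \<Omega> f" for f :: "real^'a \<Rightarrow> real^'a" and i
    using that integrable_bounded_linear[OF bounded_linear_vec_nth]
    unfolding loc_integrable_def by blast
  have loc: "loc_integrable \<Omega> (\<lambda>x. g x $ i)" "loc_integrable \<Omega> (\<lambda>x. h x $ i)" for i
    using g h comp by (auto simp: has_weak_grad_def)
  have "AE x in lebesgue_on \<Omega>. g x $ i - h x $ i = 0" for i
  proof (rule fundamental_lemma[OF \<open>open \<Omega>\<close>])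
    show "loc_integrable \<Omega> (\<lambda>x. g x $ i - h x $ i)"
      using loc[of i] by (simp add: loc_integrable_def)
    fix \<phi> assume \<phi>: "test_fun \<Omega> \<phi>"
    have "(LINT x|lebesgue_on \<Omega>. g x $ i * \<phi> x) = (LINT x|lebesgue_on \<Omega>. h x $ i * \<phi> x)"
      using g h \<phi> by (simp add: has_weak_grad_def)
    moreover have "(LINT x|lebesgue_on \<Omega>. (g x $ i - h x $ i) * \<phi> x) =
        (LINT x|lebesgue_on \<Omega>. g x $ i * \<phi> x) - (LINT x|lebesgue_on \<Omega>. h x $ i * \<phi> x)"
      using loc_integrable_mult_test_fun(1)[OF loc(1)[of i] Om \<phi>]
        loc_integrable_mult_test_fun(1)[OF loc(2)[of i] Om \<phi>]
      by (simp add: left_diff_distrib)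
    ultimately show "(LINT x|lebesgue_on \<Omega>. (g x $ i - h x $ i) * \<phi> x) = 0" by simp
  qed
  then have "AE x in lebesgue_on \<Omega>. \<forall>i. g x $ i - h x $ i = 0"
    by (simp add: AE_all_countable)
  then show ?thesis by eventually_elim (simp add: Finite_Cartesian_Product.vec_eq_iff)
qed

section \<open>Linear structure of \<open>H1\<close> and \<open>H10\<close>\<close>

lemma borel_measurable_lebesgue_on_AE:
  fixes f g :: "'a::euclidean_space \<Rightarrow> 'b::euclidean_space"
  assumes "S \<in> sets lebesgue" "f \<in> borel_measurable (lebesgue_on S)"
    and "AE x in lebesgue_on S. f x = g x"
  shows "g \<in> borel_measurable (lebesgue_on S)"
proof -
  have "(\<lambda>x. if x \<in> S then f x else 0) \<in> borel_measurable lebesgue"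
    using assms by (simp add: borel_measurable_if)
  moreover have "AE x in lebesgue. x \<in> S \<longrightarrow> f x = g x"
    using assms by (simp add: AE_restrict_space_iff)
  then have "AE x in lebesgue. (if x \<in> S then f x else 0) = (if x \<in> S then g x else 0)"
    by eventually_elim simp
  ultimately have "(\<lambda>x. if x \<in> S then g x else 0) \<in> borel_measurable lebesgue"
    by (rule borel_measurable_AE)
  then show ?thesis using assms by (simp add: borel_measurable_if)
qed

lemma L2_cong_AE:
  assumes "\<Omega> \<in> sets lebesgue" "L2 \<Omega> f" "AE x in lebesgue_on \<Omega>. f x = g x"
  shows "L2 \<Omega> g"
proof -
  have g: "g \<in> borel_measurable (lebesgue_on \<Omega>)"
    using assms borel_measurable_lebesgue_on_AE by (auto simp: L2_def)
  have "AE x in lebesgue_on \<Omega>. (norm (f x))\<^sup>2 = (norm (g x))\<^sup>2"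
    using assms(3) by eventually_elim simp
  then have "integrable (lebesgue_on \<Omega>) (\<lambda>x. (norm (g x))\<^sup>2)"
    using assms(2) g integrable_cong_AE[of "\<lambda>x. (norm (f x))\<^sup>2" "lebesgue_on \<Omega>" "\<lambda>x. (norm (g x))\<^sup>2"]
    by (auto simp: L2_def)
  then show ?thesis using g by (simp add: L2_def)
qed

lemma norm_lin_square_le: "(norm (s *\<^sub>R a + t *\<^sub>R b))\<^sup>2 \<le> 2 * s\<^sup>2 * (norm a)\<^sup>2 + 2 * t\<^sup>2 * (norm b)\<^sup>2"
  for a b :: "'b::real_normed_vector"
proof -
  have "norm (s *\<^sub>R a + t *\<^sub>R b) \<le> \<bar>s\<bar> * norm a + \<bar>t\<bar> * norm b"
    by (rule order_trans[OF norm_triangle_ineq]) simp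
  then have "(norm (s *\<^sub>R a + t *\<^sub>R b))\<^sup>2 \<le> (\<bar>s\<bar> * norm a + \<bar>t\<bar> * norm b)\<^sup>2"
    by (intro power_mono) auto
  also have "\<dots> \<le> 2 * (\<bar>s\<bar> * norm a)\<^sup>2 + 2 * (\<bar>t\<bar> * norm b)\<^sup>2"
    using sum_squares_bound[of "\<bar>s\<bar> * norm a" "\<bar>t\<bar> * norm b"] by (simp add: power2_sum)
  finally show ?thesis by (simp add: power_mult_distrib mult_ac)
qed

lemma L2_lin:
  assumes f: "L2 \<Omega> f" and g: "L2 \<Omega> g"
  shows "L2 \<Omega> (\<lambda>x. s *\<^sub>R f x + t *\<^sub>R g x)"
    and "(LINT x|lebesgue_on \<Omega>. (norm (s *\<^sub>R f x + t *\<^sub>R g x))\<^sup>2) \<le>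
      2 * s\<^sup>2 * (LINT x|lebesgue_on \<Omega>. (norm (f x))\<^sup>2) + 2 * t\<^sup>2 * (LINT x|lebesgue_on \<Omega>. (norm (g x))\<^sup>2)"
proof -
  have m: "(\<lambda>x. s *\<^sub>R f x + t *\<^sub>R g x) \<in> borel_measurable (lebesgue_on \<Omega>)"
    using f g unfolding L2_def by (intro borel_measurable_add borel_measurable_scaleR) auto
  have i: "integrable (lebesgue_on \<Omega>) (\<lambda>x. 2 * s\<^sup>2 * (norm (f x))\<^sup>2 + 2 * t\<^sup>2 * (norm (g x))\<^sup>2)"
    using f g by (simp add: L2_def)
  have l: "integrable (lebesgue_on \<Omega>) (\<lambda>x. (norm (s *\<^sub>R f x + t *\<^sub>R g x))\<^sup>2)"
    by (rule Bochner_Integration.integrable_bound[OF i])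
      (use m norm_lin_square_le in \<open>auto intro!: AE_I2 order_trans[OF _ abs_ge_self]\<close>)
  show "L2 \<Omega> (\<lambda>x. s *\<^sub>R f x + t *\<^sub>R g x)" using m l by (simp add: L2_def)
  show "(LINT x|lebesgue_on \<Omega>. (norm (s *\<^sub>R f x + t *\<^sub>R g x))\<^sup>2) \<le>
      2 * s\<^sup>2 * (LINT x|lebesgue_on \<Omega>. (norm (f x))\<^sup>2) + 2 * t\<^sup>2 * (LINT x|lebesgue_on \<Omega>. (norm (g x))\<^sup>2)"
    using integral_mono[OF l i norm_lin_square_le] f g by (simp add: L2_def)
qed

lemma L2_lin_tendsto_0:
  assumes "\<And>n. L2 \<Omega> (f n)" "\<And>n. L2 \<Omega> (g n)"
    and "(\<lambda>n. LINT x|lebesgue_on \<Omega>. (norm (f n x))\<^sup>2) \<longlonglongrightarrow> 0"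
    and "(\<lambda>n. LINT x|lebesgue_on \<Omega>. (norm (g n x))\<^sup>2) \<longlonglongrightarrow> 0"
  shows "(\<lambda>n. LINT x|lebesgue_on \<Omega>. (norm (s *\<^sub>R f n x + t *\<^sub>R g n x))\<^sup>2) \<longlonglongrightarrow> 0"
proof (rule tendsto_sandwich[OF _ _ tendsto_const])
  show "\<forall>\<^sub>F n in sequentially. 0 \<le> (LINT x|lebesgue_on \<Omega>. (norm (s *\<^sub>R f n x + t *\<^sub>R g n x))\<^sup>2)"
    by (simp add: integral_nonneg)
  show "\<forall>\<^sub>F n in sequentially. (LINT x|lebesgue_on \<Omega>. (norm (s *\<^sub>R f n x + t *\<^sub>R g n x))\<^sup>2) \<le>
      2 * s\<^sup>2 * (LINT x|lebesgue_on \<Omega>. (norm (f n x))\<^sup>2) + 2 * t\<^sup>2 * (LINT x|lebesgue_on \<Omega>. (norm (g n x))\<^sup>2)"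
    using L2_lin(2)[OF assms(1,2)] by simp
  show "(\<lambda>n. 2 * s\<^sup>2 * (LINT x|lebesgue_on \<Omega>. (norm (f n x))\<^sup>2) + 2 * t\<^sup>2 * (LINT x|lebesgue_on \<Omega>. (norm (g n x))\<^sup>2))
      \<longlonglongrightarrow> 0"
    using tendsto_add[OF tendsto_mult[OF tendsto_const[of "2 * s\<^sup>2"] assms(3)]
        tendsto_mult[OF tendsto_const[of "2 * t\<^sup>2"] assms(4)]] by simp
qed

text \<open>\<open>H1\<close> provides some square integrable weak gradient, but
  \<open>wgrad\<close> may choose another one. Uniqueness and completeness of the Lebesgue measure
  carry square integrability over.\<close>

lemma H1_wgrad:
  assumes "open \<Omega>" "v \<in> H1 \<Omega>"
  shows "has_weak_grad \<Omega> v (wgrad \<Omega> v)" "L2 \<Omega> (wgrad \<Omega> v)"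
proof -
  obtain g where g: "has_weak_grad \<Omega> v g" "L2 \<Omega> g" using assms(2) unfolding H1_def by blast
  show *: "has_weak_grad \<Omega> v (wgrad \<Omega> v)"
    unfolding wgrad_def by (rule someI[of "has_weak_grad \<Omega> v", OF g(1)])
  show "L2 \<Omega> (wgrad \<Omega> v)"
    by (rule L2_cong_AE[OF _ g(2) weak_grad_unique[OF assms(1) g(1) *]])
      (simp add: assms(1) borel_open)
qed

lemma has_weak_grad_lin:
  assumes "open \<Omega>" and g: "has_weak_grad \<Omega> v g" and h: "has_weak_grad \<Omega> w h"
  shows "has_weak_grad \<Omega> (\<lambda>x. s * v x + t * w x) (\<lambda>x. s *\<^sub>R g x + t *\<^sub>R h x)"
proof -
  have Om: "\<Omega> \<in> sets lebesgue" using \<open>open \<Omega>\<close> by (simp add: borel_open)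
  have comp: "loc_integrable \<Omega> (\<lambda>x. f x $ i)" if "loc_integrable \<Omega> f" for f :: "real^'a \<Rightarrow> real^'a" and i
    using that integrable_bounded_linear[OF bounded_linear_vec_nth]
    unfolding loc_integrable_def by blast
  have loc: "loc_integrable \<Omega> v" "loc_integrable \<Omega> w" "loc_integrable \<Omega> g" "loc_integrable \<Omega> h"
    using g h by (auto simp: has_weak_grad_def)
  have "(LINT x|lebesgue_on \<Omega>. (s * v x + t * w x) * partial_d i \<phi> x) =
      - (LINT x|lebesgue_on \<Omega>. (s *\<^sub>R g x + t *\<^sub>R h x) $ i * \<phi> x)" if \<phi>: "test_fun \<Omega> \<phi>" for \<phi> i
  proof -
    note int = loc_integrable_mult_test_fun[OF _ Om \<phi>]
    have "(LINT x|lebesgue_on \<Omega>. (s * v x + t * w x) * partial_d i \<phi> x) =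
        (LINT x|lebesgue_on \<Omega>. s * (v x * partial_d i \<phi> x) + t * (w x * partial_d i \<phi> x))"
      by (simp add: algebra_simps)
    also have "\<dots> = s * (LINT x|lebesgue_on \<Omega>. v x * partial_d i \<phi> x) + t * (LINT x|lebesgue_on \<Omega>. w x * partial_d i \<phi> x)"
      using int(2)[OF loc(1)] int(2)[OF loc(2)] by simp
    also have "\<dots> = - (s * (LINT x|lebesgue_on \<Omega>. g x $ i * \<phi> x) + t * (LINT x|lebesgue_on \<Omega>. h x $ i * \<phi> x))"
      using g h \<phi> by (simp add: has_weak_grad_def)
    also have "\<dots> = - (LINT x|lebesgue_on \<Omega>. s * (g x $ i * \<phi> x) + t * (h x $ i * \<phi> x))"
      using int(1)[OF comp[OF loc(3)]] int(1)[OF comp[OF loc(4)]] by simp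
    also have "(\<lambda>x. s * (g x $ i * \<phi> x) + t * (h x $ i * \<phi> x)) = (\<lambda>x. (s *\<^sub>R g x + t *\<^sub>R h x) $ i * \<phi> x)"
      by (simp add: algebra_simps)
    finally show ?thesis .
  qed
  then show ?thesis using loc by (auto simp: has_weak_grad_def loc_integrable_def)
qed

lemma H1_lin:
  assumes "open \<Omega>" "v \<in> H1 \<Omega>" "w \<in> H1 \<Omega>"
  shows "(\<lambda>x. s * v x + t * w x) \<in> H1 \<Omega>"
proof -
  have "L2 \<Omega> (\<lambda>x. s * v x + t * w x)"
    using L2_lin(1)[of \<Omega> v w s t] assms(2,3) by (simp add: H1_def)
  moreover have "has_weak_grad \<Omega> (\<lambda>x. s * v x + t * w x) (\<lambda>x. s *\<^sub>R wgrad \<Omega> v x + t *\<^sub>R wgrad \<Omega> w x)"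
    by (intro has_weak_grad_lin H1_wgrad assms)
  moreover have "L2 \<Omega> (\<lambda>x. s *\<^sub>R wgrad \<Omega> v x + t *\<^sub>R wgrad \<Omega> w x)"
    by (intro L2_lin H1_wgrad assms)
  ultimately show ?thesis unfolding H1_def by blast
qed

lemma wgrad_lin:
  assumes "open \<Omega>" "v \<in> H1 \<Omega>" "w \<in> H1 \<Omega>"
  shows "AE x in lebesgue_on \<Omega>.
    wgrad \<Omega> (\<lambda>x. s * v x + t * w x) x = s *\<^sub>R wgrad \<Omega> v x + t *\<^sub>R wgrad \<Omega> w x"
  by (rule weak_grad_unique[OF assms(1), of "\<lambda>x. s * v x + t * w x"])
    (intro H1_wgrad H1_lin has_weak_grad_lin assms)+

lemma loc_integrable_const: "loc_integrable \<Omega> (\<lambda>x. c :: real)"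
  unfolding loc_integrable_def
proof (intro allI impI)
  fix K assume "compact K \<and> K \<subseteq> \<Omega>"
  then have "finite_measure (lebesgue_on K)"
    by (intro finite_measure_lebesgue_on lmeasurable_compact) simp
  then show "integrable (lebesgue_on K) (\<lambda>x. c)"
    by (rule finite_measure.integrable_const)
qed

lemma L2_test_fun:
  assumes "open \<Omega>" "test_fun \<Omega> \<phi>"
  shows "L2 \<Omega> \<phi>" "L2 \<Omega> (grad \<phi>)"
proof -
  have Om: "\<Omega> \<in> sets lebesgue" using assms(1) by (simp add: borel_open)
  obtain K where K: "compact K" "K \<subseteq> \<Omega>" "\<And>x. x \<notin> K \<Longrightarrow> \<phi> x = 0" "\<And>x i. x \<notin> K \<Longrightarrow> partial_d i \<phi> x = 0"
    using test_fun_support[OF assms(2)] by blast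
  note sm = smooth_step[OF test_fun_smooth[OF assms(2)]]
  note int = loc_integrable_mult_compact_support[OF loc_integrable_const[of _ 1] Om K(1,2)]
  have "integrable (lebesgue_on \<Omega>) (\<lambda>x. 1 * (\<phi> x)\<^sup>2)"
  proof (rule int)
    show "continuous_on UNIV (\<lambda>x. (\<phi> x)\<^sup>2)" by (intro continuous_intros sm(3))
  qed (simp add: K(3))
  then show "L2 \<Omega> \<phi>"
    using borel_measurable_continuous_lebesgue_on[OF sm(3)] by (simp add: L2_def)
  have cont: "continuous_on UNIV (partial_d i \<phi>)" for i
    by (rule smooth_step(3)[OF sm(2)])
  have "integrable (lebesgue_on \<Omega>) (\<lambda>x. 1 * (\<Sum>i\<in>UNIV. (partial_d i \<phi> x)\<^sup>2))"
  proof (rule int)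
    show "continuous_on UNIV (\<lambda>x. \<Sum>i\<in>UNIV. (partial_d i \<phi> x)\<^sup>2)" by (intro continuous_intros cont)
  qed (simp add: K(4))
  moreover have "(norm (grad \<phi> x))\<^sup>2 = (\<Sum>i\<in>UNIV. (partial_d i \<phi> x)\<^sup>2)" for x
    by (simp add: norm_vec_def L2_set_def grad_def sum_nonneg)
  moreover have "grad \<phi> \<in> borel_measurable (lebesgue_on \<Omega>)"
    using cont unfolding grad_def[abs_def]
    by (intro borel_measurable_continuous_lebesgue_on continuous_on_vec_lambda) auto
  ultimately show "L2 \<Omega> (grad \<phi>)" by (simp add: L2_def)
qed

lemma test_fun_lin:
  assumes "test_fun \<Omega> \<phi>" "test_fun \<Omega> \<psi>"
  shows "test_fun \<Omega> (\<lambda>x. s * \<phi> x + t * \<psi> x)"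
proof -
  let ?K = "closure {x. \<phi> x \<noteq> 0} \<union> closure {x. \<psi> x \<noteq> 0}"
  have K: "compact ?K" "?K \<subseteq> \<Omega>"
    using assms unfolding test_fun_def by (blast intro: compact_Un)+
  have zero: "\<phi> x = 0" "\<psi> x = 0" if "x \<notin> ?K" for x
    using that closure_subset[of "{x. \<phi> x \<noteq> 0}"] closure_subset[of "{x. \<psi> x \<noteq> 0}"] by blast+
  have "s * \<phi> x + t * \<psi> x = 0" if "x \<notin> ?K" for x
    unfolding zero[OF that] by simp
  then have "{x. s * \<phi> x + t * \<psi> x \<noteq> 0} \<subseteq> ?K" by blast
  then have sub: "closure {x. s * \<phi> x + t * \<psi> x \<noteq> 0} \<subseteq> ?K"
    by (rule closure_minimal[OF _ compact_imp_closed[OF K(1)]])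
  then have "bounded (closure {x. s * \<phi> x + t * \<psi> x \<noteq> 0})"
    by (rule bounded_subset[OF compact_imp_bounded[OF K(1)]])
  then have "compact (closure {x. s * \<phi> x + t * \<psi> x \<noteq> 0})"
    by (simp add: compact_eq_bounded_closed)
  moreover have "smooth (\<lambda>x. s * \<phi> x + t * \<psi> x)"
    using assms by (intro smooth_lin test_fun_smooth)
  ultimately show ?thesis
    using order_trans[OF sub K(2)] by (simp add: test_fun_def)
qed

text \<open>The same combination of the approximating test functions approximates the combination.
  Its \<open>wgrad\<close> is chosen independently of those of \<open>v\<close> and
  \<open>w\<close>, so the gradient part holds only under the integral, through
  \<open>wgrad_lin\<close>.\<close>

lemma H10_lin:
  assumes "open \<Omega>" "v \<in> H10 \<Omega>" "w \<in> H10 \<Omega>"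
  shows "(\<lambda>x. s * v x + t * w x) \<in> H10 \<Omega>"
proof -
  have vw: "v \<in> H1 \<Omega>" "w \<in> H1 \<Omega>" using assms by (auto simp: H10_def)
  have L2vw: "L2 \<Omega> v" "L2 \<Omega> w" using vw by (auto simp: H1_def)
  note g = H1_wgrad(2)[OF assms(1) vw(1)] H1_wgrad(2)[OF assms(1) vw(2)]
  obtain \<phi> where \<phi>: "\<And>n. test_fun \<Omega> (\<phi> n)"
      "(\<lambda>n. LINT x|lebesgue_on \<Omega>. (\<phi> n x - v x)\<^sup>2) \<longlonglongrightarrow> 0"
      "(\<lambda>n. LINT x|lebesgue_on \<Omega>. (norm (grad (\<phi> n) x - wgrad \<Omega> v x))\<^sup>2) \<longlonglongrightarrow> 0"
    using assms(2) by (auto simp: H10_def)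
  obtain \<psi> where \<psi>: "\<And>n. test_fun \<Omega> (\<psi> n)"
      "(\<lambda>n. LINT x|lebesgue_on \<Omega>. (\<psi> n x - w x)\<^sup>2) \<longlonglongrightarrow> 0"
      "(\<lambda>n. LINT x|lebesgue_on \<Omega>. (norm (grad (\<psi> n) x - wgrad \<Omega> w x))\<^sup>2) \<longlonglongrightarrow> 0"
    using assms(3) by (auto simp: H10_def)
  define \<theta> where "\<theta> n = (\<lambda>x. s * \<phi> n x + t * \<psi> n x)" for n
  have \<theta>: "test_fun \<Omega> (\<theta> n)" for n unfolding \<theta>_def by (intro test_fun_lin \<phi> \<psi>)
  have diff: "L2 \<Omega> (\<lambda>x. f x - h x)" if "L2 \<Omega> f" "L2 \<Omega> h"
    for f h :: "real^'a \<Rightarrow> 'b::euclidean_space"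
    using L2_lin(1)[OF that, of 1 "-1"] by simp
  have "(\<lambda>n. LINT x|lebesgue_on \<Omega>. (norm (s *\<^sub>R (\<phi> n x - v x) + t *\<^sub>R (\<psi> n x - w x)))\<^sup>2) \<longlonglongrightarrow> 0"
    using \<phi> \<psi> L2vw L2_test_fun(1)[OF assms(1)]
    by (intro L2_lin_tendsto_0 diff) auto
  moreover have "(norm (s *\<^sub>R (\<phi> n x - v x) + t *\<^sub>R (\<psi> n x - w x)))\<^sup>2 = (\<theta> n x - (s * v x + t * w x))\<^sup>2" for n x
    by (simp add: \<theta>_def algebra_simps)
  ultimately have 1: "(\<lambda>n. LINT x|lebesgue_on \<Omega>. (\<theta> n x - (s * v x + t * w x))\<^sup>2) \<longlonglongrightarrow> 0" by simp
  define W where "W = wgrad \<Omega> (\<lambda>x. s * v x + t * w x)"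
  have lim: "(\<lambda>n. LINT x|lebesgue_on \<Omega>. (norm (s *\<^sub>R (grad (\<phi> n) x - wgrad \<Omega> v x) + t *\<^sub>R (grad (\<psi> n) x - wgrad \<Omega> w x)))\<^sup>2) \<longlonglongrightarrow> 0"
    using \<phi> \<psi> g L2_test_fun(2)[OF assms(1)]
    by (intro L2_lin_tendsto_0 diff) auto
  have eq: "(LINT x|lebesgue_on \<Omega>. (norm (s *\<^sub>R (grad (\<phi> n) x - wgrad \<Omega> v x) + t *\<^sub>R (grad (\<psi> n) x - wgrad \<Omega> w x)))\<^sup>2) =
      (LINT x|lebesgue_on \<Omega>. (norm (grad (\<theta> n) x - W x))\<^sup>2)" for n
  proof (rule integral_cong_AE)
    have "L2 \<Omega> (\<lambda>x. s *\<^sub>R (grad (\<phi> n) x - wgrad \<Omega> v x) + t *\<^sub>R (grad (\<psi> n) x - wgrad \<Omega> w x))"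
      by (intro L2_lin diff L2_test_fun(2)[OF assms(1)] \<phi> \<psi> g)
    then show "(\<lambda>x. (norm (s *\<^sub>R (grad (\<phi> n) x - wgrad \<Omega> v x) + t *\<^sub>R (grad (\<psi> n) x - wgrad \<Omega> w x)))\<^sup>2)
        \<in> borel_measurable (lebesgue_on \<Omega>)" by (auto simp: L2_def)
    have "L2 \<Omega> (\<lambda>x. grad (\<theta> n) x - W x)" unfolding W_def
      by (intro diff L2_test_fun(2)[OF assms(1)] \<theta> H1_wgrad H1_lin assms vw)
    then show "(\<lambda>x. (norm (grad (\<theta> n) x - W x))\<^sup>2) \<in> borel_measurable (lebesgue_on \<Omega>)"
      by (auto simp: L2_def)
    have grad: "grad (\<theta> n) x = s *\<^sub>R grad (\<phi> n) x + t *\<^sub>R grad (\<psi> n) x" for x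
      using smooth_step(1)[OF test_fun_smooth[OF \<phi>(1)[of n]]] smooth_step(1)[OF test_fun_smooth[OF \<psi>(1)[of n]]]
      by (simp add: Finite_Cartesian_Product.vec_eq_iff grad_def \<theta>_def partial_d_lin)
    show "AE x in lebesgue_on \<Omega>.
      (norm (s *\<^sub>R (grad (\<phi> n) x - wgrad \<Omega> v x) + t *\<^sub>R (grad (\<psi> n) x - wgrad \<Omega> w x)))\<^sup>2 =
      (norm (grad (\<theta> n) x - W x))\<^sup>2"
      using wgrad_lin[OF assms(1) vw, of s t]
    proof eventually_elim
      case (elim x)
      then show ?case unfolding grad W_def by (simp add: algebra_simps)
    qed
  qed
  have 2: "(\<lambda>n. LINT x|lebesgue_on \<Omega>. (norm (grad (\<theta> n) x - W x))\<^sup>2) \<longlonglongrightarrow> 0"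
    using lim unfolding eq .
  show ?thesis
    unfolding H10_def mem_Collect_eq
  proof (intro conjI exI[of _ \<theta>] allI)
    show "(\<lambda>x. s * v x + t * w x) \<in> H1 \<Omega>" by (rule H1_lin[OF assms(1) vw])
  qed (rule \<theta> 1 2[unfolded W_def])+
qed

section \<open>Bilinearity of the weak form\<close>

lemma L2_mult_integrable:
  fixes f g :: "real^'d \<Rightarrow> real"
  assumes f: "L2 \<Omega> f" and g: "L2 \<Omega> g"
  shows "integrable (lebesgue_on \<Omega>) (\<lambda>x. f x * g x)"
proof (rule Bochner_Integration.integrable_bound)
  show "integrable (lebesgue_on \<Omega>) (\<lambda>x. (norm (f x))\<^sup>2 + (norm (g x))\<^sup>2)"
    using f g by (simp add: L2_def)
  show "(\<lambda>x. f x * g x) \<in> borel_measurable (lebesgue_on \<Omega>)"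
    using f g unfolding L2_def by (intro borel_measurable_times) auto
  have "norm (f x * g x) \<le> norm ((norm (f x))\<^sup>2 + (norm (g x))\<^sup>2)" for x
  proof -
    have "2 * (\<bar>f x\<bar> * \<bar>g x\<bar>) \<le> (f x)\<^sup>2 + (g x)\<^sup>2"
      using sum_squares_bound[of "\<bar>f x\<bar>" "\<bar>g x\<bar>"] by simp
    moreover have "0 \<le> \<bar>f x\<bar> * \<bar>g x\<bar>" by simp
    ultimately have "\<bar>f x\<bar> * \<bar>g x\<bar> \<le> (f x)\<^sup>2 + (g x)\<^sup>2" by linarith
    then show ?thesis by (simp add: abs_mult)
  qed
  then show "AE x in lebesgue_on \<Omega>. norm (f x * g x) \<le> norm ((norm (f x))\<^sup>2 + (norm (g x))\<^sup>2)"
    by (rule AE_I2)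
qed

lemma borel_measurable_vec_nth_comp:
  fixes f :: "'a \<Rightarrow> 'b::euclidean_space ^ 'n"
  assumes "f \<in> borel_measurable M"
  shows "(\<lambda>x. f x $ i) \<in> borel_measurable M"
  by (rule borel_measurable_continuous_on[OF _ assms]) (intro continuous_intros)

lemma L2_nth:
  assumes "L2 \<Omega> (f :: real^'d \<Rightarrow> real^'n)"
  shows "L2 \<Omega> (\<lambda>x. f x $ i)"
proof -
  have m: "(\<lambda>x. f x $ i) \<in> borel_measurable (lebesgue_on \<Omega>)"
    using assms by (intro borel_measurable_vec_nth_comp) (simp add: L2_def)
  have "integrable (lebesgue_on \<Omega>) (\<lambda>x. (norm (f x $ i))\<^sup>2)"
  proof (rule Bochner_Integration.integrable_bound)
    show "integrable (lebesgue_on \<Omega>) (\<lambda>x. (norm (f x))\<^sup>2)" using assms by (simp add: L2_def)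
    show "(\<lambda>x. (norm (f x $ i))\<^sup>2) \<in> borel_measurable (lebesgue_on \<Omega>)"
      using m by simp
    show "AE x in lebesgue_on \<Omega>. norm ((norm (f x $ i))\<^sup>2) \<le> norm ((norm (f x))\<^sup>2)"
      by (intro AE_I2) (simp add: power_mono component_le_norm_cart flip: abs_le_square_iff)
  qed
  then show ?thesis using m by (simp add: L2_def)
qed

lemma Linf_nth:
  fixes f :: "real^'d \<Rightarrow> 'b::euclidean_space ^ 'n"
  assumes "Linf \<Omega> f"
  shows "Linf \<Omega> (\<lambda>x. f x $ i)"
proof -
  obtain C where "AE x in lebesgue_on \<Omega>. norm (f x) \<le> C" using assms by (auto simp: Linf_def)
  then have "AE x in lebesgue_on \<Omega>. norm (f x $ i) \<le> C"
    by eventually_elim (rule order_trans[OF Finite_Cartesian_Product.norm_nth_le])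
  then show ?thesis
    using assms borel_measurable_vec_nth_comp[of f "lebesgue_on \<Omega>" i] unfolding Linf_def by blast
qed

lemma Linf_L2_L2_integrable:
  fixes k f g :: "real^'d \<Rightarrow> real"
  assumes "Linf \<Omega> k" "L2 \<Omega> f" "L2 \<Omega> g"
  shows "integrable (lebesgue_on \<Omega>) (\<lambda>x. k x * f x * g x)"
proof -
  obtain C where "AE x in lebesgue_on \<Omega>. \<bar>k x\<bar> \<le> C" using assms(1) by (auto simp: Linf_def)
  then have "integrable (lebesgue_on \<Omega>) (\<lambda>x. (f x * g x) * k x)"
    using assms by (intro integrable_mult_bounded L2_mult_integrable) (auto simp: Linf_def)
  then show ?thesis by (simp add: mult_ac)
qed

lemma diffusion_integrable:
  fixes K :: "real^'d \<Rightarrow> real^'d^'d"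
  assumes "Linf \<Omega> K" "L2 \<Omega> f" "L2 \<Omega> g"
  shows "integrable (lebesgue_on \<Omega>) (\<lambda>x. (K x *v f x) \<bullet> g x)"
proof -
  have "integrable (lebesgue_on \<Omega>) (\<lambda>x. \<Sum>i\<in>UNIV. \<Sum>j\<in>UNIV. K x $ i $ j * f x $ j * g x $ i)"
    by (intro Bochner_Integration.integrable_sum Linf_L2_L2_integrable Linf_nth L2_nth assms)
  then show ?thesis
    by (simp add: inner_vec_def matrix_vector_mult_def sum_distrib_right)
qed

lemma convection_integrable:
  fixes q :: "real^'d \<Rightarrow> real^'d"
  assumes "Linf \<Omega> q" "L2 \<Omega> f" "L2 \<Omega> g"
  shows "integrable (lebesgue_on \<Omega>) (\<lambda>x. (q x \<bullet> f x) * g x)"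
proof -
  have "integrable (lebesgue_on \<Omega>) (\<lambda>x. \<Sum>i\<in>UNIV. q x $ i * f x $ i * g x)"
    by (intro Bochner_Integration.integrable_sum Linf_L2_L2_integrable Linf_nth L2_nth assms)
  then show ?thesis
    by (simp add: inner_vec_def sum_distrib_right)
qed

lemma integral_lin_AE:
  fixes f g h :: "'a \<Rightarrow> real"
  assumes "integrable M f" "integrable M g" "integrable M h"
    and "AE x in M. h x = s * f x + t * g x"
  shows "integral\<^sup>L M h = s * integral\<^sup>L M f + t * integral\<^sup>L M g"
proof -
  have "integral\<^sup>L M h = (LINT x|M. s * f x + t * g x)"
    using assms by (intro integral_cong_AE) auto
  then show ?thesis using assms by simp
qed

lemma model_problem_facts:
  assumes "model_problem D"
  shows "open (Omega D)" "Linf (Omega D) (Kmat D)" "Linf (Omega D) (bvec D)" "Linf (Omega D) (creac D)"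
  using assms unfolding model_problem_def polyhedral_lipschitz_domain_def lipschitz_domain_def by blast+

lemma form_b_lin:
  assumes "model_problem D" and v: "v \<in> H1 (Omega D)" and w: "w \<in> H1 (Omega D)" and z: "z \<in> H1 (Omega D)"
  shows "form_b D (\<lambda>x. s * v x + t * w x) z = s * form_b D v z + t * form_b D w z"
    and "form_b D z (\<lambda>x. s * v x + t * w x) = s * form_b D z v + t * form_b D z w"
proof -
  note D = model_problem_facts[OF assms(1)]
  define u where "u = (\<lambda>x. s * v x + t * w x)"
  have u: "u \<in> H1 (Omega D)" unfolding u_def by (rule H1_lin[OF D(1) v w])
  note g = H1_wgrad(2)[OF D(1)]
  have L2: "L2 (Omega D) y" if "y \<in> H1 (Omega D)" for y using that by (simp add: H1_def)
  note lin = wgrad_lin[OF D(1) v w, of s t, folded u_def]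
  \<comment> \<open>Additivity needs each integrand to be integrable: the integral of a
    non-integrable function is 0 by convention, and linearity would fail.\<close>
  note int = diffusion_integrable[OF D(2) g g] convection_integrable[OF D(3) g L2]
    Linf_L2_L2_integrable[OF D(4) L2 L2]
  have "form_a D u z = s * form_a D v z + t * form_a D w z"
    unfolding form_a_def
  proof (intro integral_lin_AE int u v w z)
    show "AE x in lebesgue_on (Omega D). (Kmat D x *v wgrad (Omega D) u x) \<bullet> wgrad (Omega D) z x =
        s * ((Kmat D x *v wgrad (Omega D) v x) \<bullet> wgrad (Omega D) z x) +
        t * ((Kmat D x *v wgrad (Omega D) w x) \<bullet> wgrad (Omega D) z x)"
      using lin
      by eventually_elim (simp add: matrix_vector_right_distrib matrix_vector_mult_scaleR inner_add_left)
  qed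
  moreover have "(LINT x|lebesgue_on (Omega D). (bvec D x \<bullet> wgrad (Omega D) u x) * z x) =
      s * (LINT x|lebesgue_on (Omega D). (bvec D x \<bullet> wgrad (Omega D) v x) * z x) +
      t * (LINT x|lebesgue_on (Omega D). (bvec D x \<bullet> wgrad (Omega D) w x) * z x)"
  proof (intro integral_lin_AE int u v w z)
    show "AE x in lebesgue_on (Omega D). (bvec D x \<bullet> wgrad (Omega D) u x) * z x =
        s * ((bvec D x \<bullet> wgrad (Omega D) v x) * z x) + t * ((bvec D x \<bullet> wgrad (Omega D) w x) * z x)"
      using lin by eventually_elim (simp add: inner_add_right algebra_simps)
  qed
  moreover have "(LINT x|lebesgue_on (Omega D). creac D x * u x * z x) =
      s * (LINT x|lebesgue_on (Omega D). creac D x * v x * z x) +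
      t * (LINT x|lebesgue_on (Omega D). creac D x * w x * z x)"
    by (intro integral_lin_AE int u v w z AE_I2) (simp add: u_def algebra_simps)
  ultimately show "form_b D (\<lambda>x. s * v x + t * w x) z = s * form_b D v z + t * form_b D w z"
    unfolding form_b_def u_def[symmetric] by (simp add: algebra_simps)
  have "form_a D z u = s * form_a D z v + t * form_a D z w"
    unfolding form_a_def
  proof (intro integral_lin_AE int u v w z)
    show "AE x in lebesgue_on (Omega D). (Kmat D x *v wgrad (Omega D) z x) \<bullet> wgrad (Omega D) u x =
        s * ((Kmat D x *v wgrad (Omega D) z x) \<bullet> wgrad (Omega D) v x) +
        t * ((Kmat D x *v wgrad (Omega D) z x) \<bullet> wgrad (Omega D) w x)"
      using lin by eventually_elim (simp add: inner_add_right)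
  qed
  moreover have "(LINT x|lebesgue_on (Omega D). (bvec D x \<bullet> wgrad (Omega D) z x) * u x) =
      s * (LINT x|lebesgue_on (Omega D). (bvec D x \<bullet> wgrad (Omega D) z x) * v x) +
      t * (LINT x|lebesgue_on (Omega D). (bvec D x \<bullet> wgrad (Omega D) z x) * w x)"
    by (intro integral_lin_AE int u v w z AE_I2) (simp add: u_def algebra_simps)
  moreover have "(LINT x|lebesgue_on (Omega D). creac D x * z x * u x) =
      s * (LINT x|lebesgue_on (Omega D). creac D x * z x * v x) +
      t * (LINT x|lebesgue_on (Omega D). creac D x * z x * w x)"
    by (intro integral_lin_AE int u v w z AE_I2) (simp add: u_def algebra_simps)
  ultimately show "form_b D z (\<lambda>x. s * v x + t * w x) = s * form_b D z v + t * form_b D z w"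
    unfolding form_b_def u_def[symmetric] by (simp add: algebra_simps)
qed

section \<open>Preconditioned residuals and discrete solvability\<close>

lemma invertible_inverse_mat:
  fixes A :: "'a::field mat"
  assumes A: "A \<in> carrier_mat n n"
    and inj: "\<And>x. x \<in> carrier_vec n \<Longrightarrow> A *\<^sub>v x = 0\<^sub>v n \<Longrightarrow> x = 0\<^sub>v n"
  shows "A * the (mat_inverse A) = 1\<^sub>m n" "the (mat_inverse A) * A = 1\<^sub>m n"
    "the (mat_inverse A) \<in> carrier_mat n n"
proof -
  have "det A \<noteq> 0"
    using det_0_iff_vec_prod_zero_field[OF A] inj by blast
  then have "A \<in> Units (ring_mat TYPE('a) n ())"
    by (rule det_non_zero_imp_unit[OF A])
  then obtain B where "mat_inverse A = Some B"
    using mat_inverse(1)[OF A, of "()"] by (cases "mat_inverse A") auto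
  then show "A * the (mat_inverse A) = 1\<^sub>m n" "the (mat_inverse A) * A = 1\<^sub>m n"
    "the (mat_inverse A) \<in> carrier_mat n n"
    using mat_inverse(2)[OF A] by auto
qed

lemma mat_mult_zero_vec: "A \<in> carrier_mat n m \<Longrightarrow> A *\<^sub>v 0\<^sub>v m = 0\<^sub>v n"
  by (auto intro!: eq_vecI)

context
  fixes N P
  assumes spd: "spd_mat N P"
begin

lemma spd_carrier: "P \<in> carrier_mat N N"
  using spd by (simp add: spd_mat_def)

lemma spd_nonneg: "x \<in> carrier_vec N \<Longrightarrow> 0 \<le> scalar_prod (P *\<^sub>v x) x"
  using spd by (cases "x = 0\<^sub>v N") (auto simp: spd_mat_def less_imp_le)

lemma spd_sym:
  assumes "x \<in> carrier_vec N" "y \<in> carrier_vec N"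
  shows "scalar_prod (P *\<^sub>v x) y = scalar_prod (P *\<^sub>v y) x"
proof -
  have "scalar_prod (P *\<^sub>v x) y = scalar_prod (transpose_mat P *\<^sub>v x) y"
    using spd by (simp add: spd_mat_def)
  also have "\<dots> = scalar_prod x (P *\<^sub>v y)"
    using transpose_vec_mult_scalar[OF spd_carrier assms(2,1)] .
  also have "\<dots> = scalar_prod (P *\<^sub>v y) x"
    using assms spd_carrier by (intro comm_scalar_prod[of _ N]) auto
  finally show ?thesis .
qed

text \<open>The vector \<open>a y - b x\<close> is \<open>a\<close> times the component of
  \<open>y\<close> that is orthogonal to \<open>x\<close> with respect to \<open>P\<close>. Its
  energy is \<open>a * (a * c - b * b)\<close>, and \<open>a > 0\<close>.\<close>

lemma spd_cauchy_schwarz: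
  assumes x: "x \<in> carrier_vec N" and y: "y \<in> carrier_vec N"
  shows "scalar_prod (P *\<^sub>v x) y \<le> sqrt (scalar_prod (P *\<^sub>v x) x) * sqrt (scalar_prod (P *\<^sub>v y) y)"
proof (cases "x = 0\<^sub>v N")
  case True
  then show ?thesis using spd_sym[OF x y] spd_carrier y by simp
next
  case False
  define a b c where "a = scalar_prod (P *\<^sub>v x) x" and "b = scalar_prod (P *\<^sub>v x) y"
    and "c = scalar_prod (P *\<^sub>v y) y"
  have a: "0 < a" using False x spd by (simp add: a_def spd_mat_def)
  have c: "0 \<le> c" unfolding c_def by (rule spd_nonneg[OF y])
  let ?z = "a \<cdot>\<^sub>v y + (- b) \<cdot>\<^sub>v x"
  have z: "?z \<in> carrier_vec N" using x y by simp
  have Px: "P *\<^sub>v x \<in> carrier_vec N" "P *\<^sub>v y \<in> carrier_vec N" using spd_carrier x y by auto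
  have "P *\<^sub>v ?z = a \<cdot>\<^sub>v (P *\<^sub>v y) + (- b) \<cdot>\<^sub>v (P *\<^sub>v x)"
    using x y spd_carrier by (simp add: mult_add_distrib_mat_vec[of _ N N] mult_mat_vec[of _ N N])
  then have "scalar_prod (P *\<^sub>v ?z) ?z = a * (a * c - b * b)"
    using x y Px spd_sym[OF x y]
    by (simp add: add_scalar_prod_distrib[of _ N] scalar_prod_add_distrib[of _ N] a_def b_def c_def algebra_simps)
  then have "0 \<le> a * (a * c - b * b)" using spd_nonneg[OF z] by simp
  then have "b\<^sup>2 \<le> a * c" using a by (simp add: zero_le_mult_iff power2_eq_square)
  then have "b \<le> sqrt (a * c)" by (rule real_le_rsqrt)
  then show ?thesis by (simp add: real_sqrt_mult a_def b_def c_def)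
qed

lemma spd_inverse:
  shows "P * the (mat_inverse P) = 1\<^sub>m N" "the (mat_inverse P) * P = 1\<^sub>m N"
    "the (mat_inverse P) \<in> carrier_mat N N"
proof -
  have "x = 0\<^sub>v N" if "x \<in> carrier_vec N" "P *\<^sub>v x = 0\<^sub>v N" for x
    using that spd unfolding spd_mat_def by force
  from invertible_inverse_mat[OF spd_carrier this]
  show "P * the (mat_inverse P) = 1\<^sub>m N" "the (mat_inverse P) * P = 1\<^sub>m N"
    "the (mat_inverse P) \<in> carrier_mat N N" by blast+
qed

text \<open>The substitution \<open>x = P t\<close> turns the norm induced by the inverse into the
  energy norm of \<open>P\<close>, for which positivity and the Cauchy-Schwarz inequality are
  available.\<close>

lemma pinv_norm_eq:
  assumes "x \<in> carrier_vec N"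
  shows "\<exists>t\<in>carrier_vec N. x = P *\<^sub>v t \<and> pinv_norm P x = sqrt (scalar_prod (P *\<^sub>v t) t)"
proof
  let ?t = "the (mat_inverse P) *\<^sub>v x"
  show t: "?t \<in> carrier_vec N" using assms spd_inverse(3) by simp
  have x: "x = P *\<^sub>v ?t"
    using assms spd_inverse spd_carrier by (simp flip: assoc_mult_mat_vec)
  moreover have "scalar_prod ?t x = scalar_prod x ?t" by (rule comm_scalar_prod[OF t assms])
  ultimately show "x = P *\<^sub>v ?t \<and> pinv_norm P x = sqrt (scalar_prod (P *\<^sub>v ?t) ?t)"
    unfolding pinv_norm_def by simp
qed

lemma pinv_norm_image:
  assumes "r \<in> carrier_vec N"
  shows "pinv_norm P (P *\<^sub>v r) = sqrt (scalar_prod (P *\<^sub>v r) r)"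
proof -
  have "the (mat_inverse P) *\<^sub>v (P *\<^sub>v r) = r"
    using assms spd_inverse spd_carrier by (simp flip: assoc_mult_mat_vec)
  then show ?thesis
    using assms spd_carrier by (simp add: pinv_norm_def comm_scalar_prod[of r N])
qed

lemma pinv_norm_nonneg: "x \<in> carrier_vec N \<Longrightarrow> 0 \<le> pinv_norm P x"
  using pinv_norm_eq spd_nonneg by fastforce

lemma pinv_norm_eq_0:
  assumes "x \<in> carrier_vec N" "pinv_norm P x \<le> 0"
  shows "x = 0\<^sub>v N"
proof -
  obtain t where t: "t \<in> carrier_vec N" "x = P *\<^sub>v t" "pinv_norm P x = sqrt (scalar_prod (P *\<^sub>v t) t)"
    using pinv_norm_eq[OF assms(1)] by blast
  then have "t = 0\<^sub>v N" using assms(2) spd by (force simp: spd_mat_def)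
  then show ?thesis using t(2) mat_mult_zero_vec[OF spd_carrier] by simp
qed

text \<open>Duality: the preconditioned residual \<open>P r\<close>, measured in the norm of the
  inverse, has the dual norm of the residual \<open>r\<close>.\<close>

lemma scalar_prod_le_pinv_norm:
  assumes "y \<in> carrier_vec N" "r \<in> carrier_vec N"
  shows "scalar_prod y r \<le> pinv_norm P y * pinv_norm P (P *\<^sub>v r)"
proof -
  obtain t where t: "t \<in> carrier_vec N" "y = P *\<^sub>v t" "pinv_norm P y = sqrt (scalar_prod (P *\<^sub>v t) t)"
    using pinv_norm_eq[OF assms(1)] by blast
  show ?thesis using spd_cauchy_schwarz[OF t(1) assms(2)] t pinv_norm_image[OF assms(2)] by simp
qed

end

text \<open>\<open>pgmres\<close> prescribes the dimension of the start vector only. It is passed on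
  from the restart index \<open>m < k\<close>, since Krylov spaces stay inside the coefficient
  space.\<close>

lemma pgmres_carrier:
  assumes "pgmres kmax P B d x" "P \<in> carrier_mat N N" "B \<in> carrier_mat N N" "d \<in> carrier_vec N"
  shows "x k \<in> carrier_vec N"
proof (induction k rule: less_induct)
  case (less k)
  show ?case
  proof (cases "k = 0")
    case True
    then show ?thesis using assms by (auto simp: pgmres_def)
  next
    case False
    define K where "K = (k - 1) mod kmax + 1"
    define m where "m = k - K"
    have "m < k" using False by (simp add: m_def K_def)
    then have xm: "x m \<in> carrier_vec N" by (rule less.IH)
    define s where "s = presid P B d (x m)"
    have s: "s \<in> carrier_vec N" using assms xm by (simp add: s_def presid_def)
    have "\<exists>z\<in>krylov P B s K. x k = x m + z"
      using assms(1) False unfolding pgmres_def Let_def is_arg_min_def K_def m_def s_def by simp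
    then obtain z where z: "z \<in> krylov P B s K" "x k = x m + z" by blast
    have "(\<lambda>i. ((P * B) ^\<^sub>m i) *\<^sub>v s) ` {..<K} \<subseteq> carrier (module_vec TYPE(real) N)"
      using s pow_carrier_mat[OF mult_carrier_mat[OF assms(2,3)]]
      by (auto simp: module_vec_simps intro!: mult_mat_vec_carrier[of _ N N])
    then have "krylov P B s K \<subseteq> carrier (module_vec TYPE(real) N)"
      using s LinearCombinations.module.span_is_subset2[OF vec_module[where 'a = real]]
      unfolding krylov_def by auto
    then have "z \<in> carrier_vec N" using z(1) by (auto simp: module_vec_simps)
    then show ?thesis using z(2) xm by simp
  qed
qed

section \<open>Coefficient vectors, finite element functions and the Galerkin system\<close>

lemma fe_fun_carrier: "x \<in> carrier_vec N \<Longrightarrow> fe_fun \<phi> x = (\<lambda>y. \<Sum>j<N. vec_index x j * \<phi> j y)"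
  by (auto simp: fe_fun_def)

lemma fe_fun_lin:
  assumes "x \<in> carrier_vec N" "y \<in> carrier_vec N"
  shows "fe_fun \<phi> (s \<cdot>\<^sub>v x + t \<cdot>\<^sub>v y) = lc s (fe_fun \<phi> x) t (fe_fun \<phi> y)"
  using assms
  by (simp add: fe_fun_carrier[of _ N] lc_def fun_eq_iff sum_distrib_left algebra_simps sum.distrib)

lemma basis_lc:
  assumes "is_basis N \<phi> V" "u \<in> V" "v \<in> V"
  shows "lc s u t v \<in> V"
proof -
  obtain x y where xy: "x \<in> carrier_vec N" "y \<in> carrier_vec N" "u = fe_fun \<phi> x" "v = fe_fun \<phi> y"
    using assms unfolding is_basis_def by blast
  then have "lc s u t v = fe_fun \<phi> (s \<cdot>\<^sub>v x + t \<cdot>\<^sub>v y)" by (simp add: fe_fun_lin)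
  moreover have "s \<cdot>\<^sub>v x + t \<cdot>\<^sub>v y \<in> carrier_vec N" using xy by simp
  ultimately show ?thesis using assms(1) unfolding is_basis_def by blast
qed

lemma basis_mem:
  assumes "is_basis N \<phi> V" "k < N"
  shows "\<phi> k \<in> V"
proof -
  have "\<phi> k = fe_fun \<phi> (unit_vec N k)"
    using assms(2) by (simp add: fe_fun_carrier[of _ N] fun_eq_iff unit_vec_def if_distrib[of "\<lambda>a. a * _"] sum.delta cong: if_cong)
  then show ?thesis using assms(1) unfolding is_basis_def by auto
qed

context bounded_form
begin

lemma zero_closed: "w \<in> H \<Longrightarrow> (\<lambda>_. 0) \<in> H"
  using lc_closed[of w w 0 0] by (simp add: lc_def)

lemma b_sum_left:
  fixes n :: nat
  assumes "w \<in> H" "\<And>j. j < n \<Longrightarrow> f j \<in> H"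
  shows "(\<lambda>y. \<Sum>j<n. c j * f j y) \<in> H" "b (\<lambda>y. \<Sum>j<n. c j * f j y) w = (\<Sum>j<n. c j * b (f j) w)"
proof -
  have "(\<lambda>y. \<Sum>j<n. c j * f j y) \<in> H \<and> b (\<lambda>y. \<Sum>j<n. c j * f j y) w = (\<Sum>j<n. c j * b (f j) w)"
    using assms(2)
  proof (induction n)
    case 0
    then show ?case using zero_closed[OF assms(1)] b_left[of w w w 0 0] assms(1) by (simp add: lc_def)
  next
    case (Suc n)
    have "(\<lambda>y. \<Sum>j<Suc n. c j * f j y) = lc 1 (\<lambda>y. \<Sum>j<n. c j * f j y) (c n) (f n)"
      by (simp add: lc_def)
    then show ?case using Suc assms(1) by (simp add: lc_closed b_left)
  qed
  then show "(\<lambda>y. \<Sum>j<n. c j * f j y) \<in> H" "b (\<lambda>y. \<Sum>j<n. c j * f j y) w = (\<Sum>j<n. c j * b (f j) w)"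
    by auto
qed

lemma b_sum_right:
  fixes n :: nat
  assumes "w \<in> H" "\<And>j. j < n \<Longrightarrow> f j \<in> H"
  shows "b w (\<lambda>y. \<Sum>j<n. c j * f j y) = (\<Sum>j<n. c j * b w (f j))"
  using assms(2)
proof (induction n)
  case 0
  then show ?case using b_right[of w w w 0 0] assms(1) by (simp add: lc_def)
next
  case (Suc n)
  have "(\<lambda>y. \<Sum>j<Suc n. c j * f j y) = lc 1 (\<lambda>y. \<Sum>j<n. c j * f j y) (c n) (f n)"
    by (simp add: lc_def)
  then show ?case using Suc assms(1) b_sum_left(1)[of w n f c] by (simp add: b_right)
qed

end

locale fe_form = bounded_form H b C
  for H :: "(real^'d \<Rightarrow> real) set" and b C
begin

text \<open>\<open>w0\<close> witnesses that \<open>H\<close> is nonempty, so that it contains the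
  zero function also for \<open>N = 0\<close>.\<close>

lemma galerkin_matrix:
  assumes \<phi>: "\<And>j. j < N \<Longrightarrow> \<phi> j \<in> H" and "w0 \<in> H"
    and x: "x \<in> carrier_vec N" and y: "y \<in> carrier_vec N"
  shows "b (fe_fun \<phi> x) (fe_fun \<phi> y) = scalar_prod y (Matrix.mat N N (\<lambda>(j, k). b (\<phi> k) (\<phi> j)) *\<^sub>v x)"
proof -
  have fx: "fe_fun \<phi> x \<in> H"
    unfolding fe_fun_carrier[OF x] by (rule b_sum_left(1)[OF \<open>w0 \<in> H\<close> \<phi>])
  have "b (fe_fun \<phi> x) (fe_fun \<phi> y) = (\<Sum>j<N. vec_index y j * b (fe_fun \<phi> x) (\<phi> j))"
    unfolding fe_fun_carrier[OF y] by (rule b_sum_right[OF fx \<phi>])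
  also have "\<dots> = (\<Sum>j<N. vec_index y j * (\<Sum>k<N. vec_index x k * b (\<phi> k) (\<phi> j)))"
    unfolding fe_fun_carrier[OF x] by (intro sum.cong refl arg_cong2[where f = "(*)"] b_sum_left(2) \<phi>) auto
  also have "\<dots> = scalar_prod y (Matrix.mat N N (\<lambda>(j, k). b (\<phi> k) (\<phi> j)) *\<^sub>v x)"
    using x y by (simp add: scalar_prod_def mult_mat_vec_def atLeast0LessThan mult.commute)
  finally show ?thesis .
qed

text \<open>The core is \<open>err\<close>: the energy of a discrete function is
  \<open>y . B y\<close>, which by duality is at most the preconditioned norm of \<open>y\<close>
  times that of \<open>P B y\<close>; norm equivalence and ellipticity bound the former by
  \<open>Cpre / sqrt Cell\<close> times the energy norm, which cancels. For \<open>B y = 0\<close>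
  this gives injectivity and so solvability; for \<open>y\<close> the difference between the
  Galerkin solution and \<open>x\<close> it bounds the algebraic error by the computable
  residual.\<close>

lemma galerkin_exists_residual_bound:
  fixes en :: "(real^'d \<Rightarrow> real) \<Rightarrow> real"
  assumes basis: "is_basis N \<phi> V" and "V \<subseteq> H" and spd: "spd_mat N P" and u: "u \<in> H"
    and Cpre: "0 < Cpre" "\<And>x. x \<in> carrier_vec N \<Longrightarrow> inverse Cpre * en (fe_fun \<phi> x) \<le> pinv_norm P x"
      "\<And>x. x \<in> carrier_vec N \<Longrightarrow> pinv_norm P x \<le> Cpre * en (fe_fun \<phi> x)"
    and Cell: "0 < Cell" "\<And>v. v \<in> H \<Longrightarrow> Cell * (en v)\<^sup>2 \<le> b v v"
  defines "B \<equiv> Matrix.mat N N (\<lambda>(j, k). b (\<phi> k) (\<phi> j))" and "d \<equiv> Matrix.vec N (\<lambda>j. b u (\<phi> j))"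
  shows "\<exists>g\<in>V. (\<forall>v\<in>V. b g v = b u v) \<and>
    (\<forall>x\<in>carrier_vec N. dst g (fe_fun \<phi> x) \<le> Cpre / sqrt Cell * pinv_norm P (presid P B d x))"
proof -
  have \<phi>: "\<phi> j \<in> H" if "j < N" for j using basis_mem[OF basis that] \<open>V \<subseteq> H\<close> by blast
  have fe_V: "fe_fun \<phi> x \<in> V" if "x \<in> carrier_vec N" for x
    using basis that unfolding is_basis_def by blast
  have fe_H: "fe_fun \<phi> x \<in> H" if "x \<in> carrier_vec N" for x using fe_V[OF that] \<open>V \<subseteq> H\<close> by blast
  have B: "B \<in> carrier_mat N N" and d: "d \<in> carrier_vec N" by (auto simp: B_def d_def)
  have Bmat: "b (fe_fun \<phi> x) (fe_fun \<phi> y) = scalar_prod y (B *\<^sub>v x)"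
    if "x \<in> carrier_vec N" "y \<in> carrier_vec N" for x y
    unfolding B_def by (rule galerkin_matrix[OF _ u that]) (rule \<phi>)
  have en_le: "en v \<le> nrm v / sqrt Cell" if "v \<in> H" for v
  proof -
    have "(sqrt Cell * en v)\<^sup>2 \<le> (nrm v)\<^sup>2"
      using Cell(1) Cell(2)[OF that] nrm_sq[OF that] by (simp add: power_mult_distrib)
    then have "sqrt Cell * en v \<le> nrm v" using nrm_nonneg[OF that] by (rule power2_le_imp_le)
    then show ?thesis using Cell(1) by (simp add: pos_le_divide_eq mult.commute)
  qed
  have pinv_le: "pinv_norm P x \<le> Cpre / sqrt Cell * nrm (fe_fun \<phi> x)" if "x \<in> carrier_vec N" for x
    using Cpre(3)[OF that] mult_left_mono[OF en_le[OF fe_H[OF that]], of Cpre] Cpre(1) by simp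
  have err: "nrm (fe_fun \<phi> y) \<le> Cpre / sqrt Cell * pinv_norm P (P *\<^sub>v (B *\<^sub>v y))"
    if y: "y \<in> carrier_vec N" for y
  proof -
    let ?e = "nrm (fe_fun \<phi> y)" and ?r = "pinv_norm P (P *\<^sub>v (B *\<^sub>v y))"
    have r: "B *\<^sub>v y \<in> carrier_vec N" using B y by simp
    have r0: "0 \<le> ?r" using spd_carrier[OF spd] r by (intro pinv_norm_nonneg[OF spd]) simp
    have "?e * ?e = scalar_prod y (B *\<^sub>v y)"
      using nrm_sq[OF fe_H[OF y]] Bmat[OF y y] by (simp add: power2_eq_square)
    also have "\<dots> \<le> pinv_norm P y * ?r" by (rule scalar_prod_le_pinv_norm[OF spd y r])
    also have "\<dots> \<le> Cpre / sqrt Cell * ?e * ?r"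
      by (intro mult_right_mono pinv_le y r0)
    finally have "?e * ?e \<le> ?e * (Cpre / sqrt Cell * ?r)" by (simp add: mult_ac)
    moreover have "0 \<le> Cpre / sqrt Cell * ?r" using r0 Cpre(1) Cell(1) by simp
    moreover have "0 \<le> ?e" by (rule nrm_nonneg[OF fe_H[OF y]])
    ultimately show ?thesis
      by (metis less_le mult_le_cancel_left_pos)
  qed
  \<comment> \<open>\<open>err\<close> only gives \<open>nrm (fe_fun \<phi> x) = 0\<close> for a
    seminorm; definiteness comes from the preconditioner norm via \<open>pinv_le\<close>.\<close>
  have inj: "x = 0\<^sub>v N" if x: "x \<in> carrier_vec N" and "B *\<^sub>v x = 0\<^sub>v N" for x
  proof (rule pinv_norm_eq_0[OF spd x])
    have "pinv_norm P (0\<^sub>v N) = 0"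
      using spd_inverse(3)[OF spd] by (simp add: pinv_norm_def)
    then have "nrm (fe_fun \<phi> x) \<le> 0"
      using err[OF x] that(2) mat_mult_zero_vec[OF spd_carrier[OF spd]] by simp
    then have "Cpre / sqrt Cell * nrm (fe_fun \<phi> x) \<le> 0"
      using Cpre(1) Cell(1) by (intro mult_nonneg_nonpos) auto
    then show "pinv_norm P x \<le> 0" using pinv_le[OF x] by linarith
  qed
  note inv = invertible_inverse_mat[OF B inj]
  define xg where "xg = the (mat_inverse B) *\<^sub>v d"
  have xg: "xg \<in> carrier_vec N" using inv d by (simp add: xg_def)
  have Bxg: "B *\<^sub>v xg = d"
    unfolding xg_def using inv B d by (simp flip: assoc_mult_mat_vec)
  let ?g = "fe_fun \<phi> xg"
  have "b ?g v = b u v" if v: "v \<in> V" for v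
  proof -
    obtain y where y: "y \<in> carrier_vec N" "v = fe_fun \<phi> y" using v basis unfolding is_basis_def by blast
    have "b ?g v = scalar_prod y d" using Bmat[OF xg y(1)] y(2) Bxg by simp
    also have "\<dots> = (\<Sum>j<N. vec_index y j * b u (\<phi> j))"
      using y(1) by (simp add: scalar_prod_def d_def atLeast0LessThan)
    also have "\<dots> = b u v"
      unfolding y(2) fe_fun_carrier[OF y(1)] by (rule b_sum_right[OF u \<phi>, symmetric])
    finally show ?thesis .
  qed
  moreover have "dst ?g (fe_fun \<phi> x) \<le> Cpre / sqrt Cell * pinv_norm P (presid P B d x)"
    if x: "x \<in> carrier_vec N" for x
  proof -
    have y: "1 \<cdot>\<^sub>v xg + (-1) \<cdot>\<^sub>v x \<in> carrier_vec N" using x xg by simp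
    have "B *\<^sub>v (1 \<cdot>\<^sub>v xg + (-1) \<cdot>\<^sub>v x) = d - B *\<^sub>v x"
      using B x xg Bxg d
      by (simp add: mult_add_distrib_mat_vec[of _ N N] mult_mat_vec[of _ N N])
        (auto intro!: eq_vecI)
    then show ?thesis
      using err[OF y] fe_fun_lin[OF xg x, of \<phi> 1 "-1"] by (simp add: dst_def presid_def)
  qed
  ultimately show ?thesis using fe_V[OF xg] by blast
qed

end

section \<open>Refinement, estimator reduction and summability\<close>

context galerkin_sequence
begin

text \<open>\<open>\<alpha>\<close> is the estimator at the final iterate \<open>u\<close>,
  \<open>\<rho>\<close> the algebraic residual norm. The estimates \<open>stab\<close> and
  \<open>red\<close> involve differences of iterates, whereas \<open>halving\<close> needs
  differences of Galerkin functions. The switch costs multiples of \<open>\<rho>\<close>, which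
  \<open>small\<close> turns into multiples of \<open>\<alpha>\<close> that can be absorbed.\<close>

lemma reciprocal_sums_bounded:
  fixes u :: "nat \<Rightarrow> 'a \<Rightarrow> real" and \<alpha> \<rho> :: "nat \<Rightarrow> real"
  assumes u: "\<And>k. u k \<in> H" and \<alpha>: "\<And>k. 0 \<le> \<alpha> k" and \<rho>: "\<And>k. 0 \<le> \<rho> k"
    and near: "\<And>k. dst (g k) (u k) \<le> Ca * \<rho> k"
    and gal: "\<And>j k. j \<le> k \<Longrightarrow> dst (g k) (g j) \<le> Cd * (\<alpha> j + \<rho> j)"
    and stab: "\<And>j k. j \<le> k \<Longrightarrow> \<alpha> k \<le> \<alpha> j + Cs * dst (u k) (u j)"
    and red: "\<And>k. \<alpha> (Suc k) \<le> q * \<alpha> k + Cs * dst (u (Suc k)) (u k)"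
    and small: "\<And>k. l0 \<le> k \<Longrightarrow> \<rho> k \<le> \<mu> * \<alpha> k" "\<mu> \<le> 1" "Cs * Ca * \<mu> \<le> (1 - q) / 4"
    and par: "0 \<le> q" "q < 1" "0 \<le> Ca" "0 \<le> Cd" "0 \<le> Cs"
  shows "\<exists>A. \<forall>l\<ge>l0. 0 < \<alpha> l + \<rho> l \<longrightarrow>
    (\<forall>j\<le>l. 0 < \<alpha> j + \<rho> j) \<and> (\<Sum>j<l. 1 / (\<alpha> j + \<rho> j)) \<le> A / (\<alpha> l + \<rho> l)"
proof -
  define \<eta> where "\<eta> k = \<alpha> k + \<rho> k" for k
  have \<eta>: "0 \<le> \<eta> k" "\<alpha> k \<le> \<eta> k" "\<rho> k \<le> \<eta> k" for k
    using \<alpha>[of k] \<rho>[of k] by (auto simp: \<eta>_def)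
  have near': "dst (u k) (g k) \<le> Ca * \<rho> k" for k
    using near[of k] u g_H by (simp add: dst_sym)
  have absorb: "Cs * (Ca * \<rho> k) \<le> (1 - q) / 4 * \<alpha> k" if "l0 \<le> k" for k
  proof -
    have "Cs * (Ca * \<rho> k) \<le> Cs * (Ca * (\<mu> * \<alpha> k))"
      using small(1)[OF that] par by (intro mult_left_mono) auto
    also have "\<dots> = (Cs * Ca * \<mu>) * \<alpha> k" by simp
    also have "\<dots> \<le> (1 - q) / 4 * \<alpha> k" using small(3) \<alpha> by (intro mult_right_mono) auto
    finally show ?thesis .
  qed
  have \<eta>_le: "\<eta> k \<le> 2 * \<alpha> k" if "l0 \<le> k" for k
    using small(1)[OF that] mult_right_mono[OF small(2) \<alpha>[of k]] by (simp add: \<eta>_def)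
  have u_dist: "Cs * dst (u k) (u j) \<le> Cs * (Ca * \<rho> k) + Cs * dst (g k) (g j) + Cs * (Ca * \<rho> j)" for j k
  proof -
    have "dst (u k) (u j) \<le> dst (u k) (g k) + (dst (g k) (g j) + dst (g j) (u j))"
      using dst_triangle[of "u k" "g k" "u j"] dst_triangle[of "g k" "g j" "u j"] u g_H by simp
    also have "\<dots> \<le> Ca * \<rho> k + dst (g k) (g j) + Ca * \<rho> j"
      using near'[of k] near[of j] by simp
    finally have "Cs * dst (u k) (u j) \<le> Cs * (Ca * \<rho> k + dst (g k) (g j) + Ca * \<rho> j)"
      using par by (intro mult_left_mono)
    then show ?thesis by (simp add: algebra_simps)
  qed
  \<comment> \<open>After absorption half of \<open>\<alpha> k\<close> remains on the left, and
    \<open>\<eta> k \<le> 2 * \<alpha> k\<close>; together this is the factor 4.\<close>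
  define Cm where "Cm = 4 * (1 + Cs * Cd + Cs * Ca)"
  have "0 \<le> Cs * Cd" "0 \<le> Cs * Ca" using par by auto
  then have Cm: "1 \<le> Cm" by (simp add: Cm_def)
  have mono: "\<eta> k \<le> Cm * \<eta> j" if "j \<le> k" "l0 \<le> k" for j k
  proof -
    have "Cs * dst (g k) (g j) \<le> Cs * (Cd * \<eta> j)" "Cs * (Ca * \<rho> j) \<le> Cs * (Ca * \<eta> j)"
      using gal[OF that(1)] par \<eta>(3) by (auto simp: \<eta>_def intro!: mult_left_mono)
    then have "\<alpha> k \<le> \<eta> j + ((1 - q) / 4 * \<alpha> k + Cs * (Cd * \<eta> j) + Cs * (Ca * \<eta> j))"
      using stab[OF that(1)] u_dist[of k j] absorb[OF that(2)] \<eta>(2)[of j] by linarith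
    moreover have "(1 - q) / 4 * \<alpha> k \<le> 1 / 2 * \<alpha> k" using par \<alpha> by (intro mult_right_mono) auto
    ultimately have "\<alpha> k \<le> \<eta> j + (1 / 2 * \<alpha> k + Cs * (Cd * \<eta> j) + Cs * (Ca * \<eta> j))"
      by linarith
    then have "2 * \<alpha> k \<le> Cm * \<eta> j" by (simp add: Cm_def algebra_simps)
    then show ?thesis using \<eta>_le[OF that(2)] by linarith
  qed
  \<comment> \<open>Moving \<open>(1 - q) / 4 * \<alpha> (Suc k)\<close> to the left leaves
    \<open>(3 + q) / 4\<close> there and \<open>(1 + 3 * q) / 4\<close> before
    \<open>\<alpha> k\<close>; the quotient is below one because \<open>q < 1\<close>.\<close>
  define q' where "q' = (1 + 3 * q) / (3 + q)"
  define Ci where "Ci = 4 * Cs / (3 + q)"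
  have "\<alpha> (Suc k) \<le> q' * \<alpha> k + Ci * dst (g (Suc k)) (g k)" if "l0 \<le> k" for k
  proof -
    have "\<alpha> (Suc k) \<le> q * \<alpha> k + ((1 - q) / 4 * \<alpha> (Suc k) + Cs * dst (g (Suc k)) (g k) + (1 - q) / 4 * \<alpha> k)"
      using red[of k] u_dist[of "Suc k" k] absorb[of k] absorb[of "Suc k"] that by linarith
    then have "(3 + q) * \<alpha> (Suc k) \<le> (1 + 3 * q) * \<alpha> k + 4 * Cs * dst (g (Suc k)) (g k)"
      by (simp add: field_simps)
    then have "\<alpha> (Suc k) \<le> ((1 + 3 * q) * \<alpha> k + 4 * Cs * dst (g (Suc k)) (g k)) / (3 + q)"
      using par by (simp add: pos_le_divide_eq mult.commute)
    also have "\<dots> = (1 + 3 * q) / (3 + q) * \<alpha> k + 4 * Cs / (3 + q) * dst (g (Suc k)) (g k)"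
      by (subst add_divide_distrib) simp
    finally show ?thesis unfolding q'_def Ci_def .
  qed
  moreover have "0 \<le> q'" "q' < 1" "0 \<le> Ci" using par by (auto simp: q'_def Ci_def)
  ultimately have "\<exists>N>0. \<forall>l\<ge>l0. \<eta> (l + N) \<le> \<eta> l / 2"
    using \<eta>(1,2) \<eta>_le mono gal[folded \<eta>_def] Cm par(4) by (intro halving)
  then obtain N where N: "0 < N" "\<And>l. l0 \<le> l \<Longrightarrow> \<eta> (l + N) \<le> \<eta> l / 2" by blast
  have "(\<forall>j\<le>l. 0 < \<eta> j) \<and> (\<Sum>j<l. 1 / \<eta> j) \<le> 2 * (real l0 + real N) * Cm / \<eta> l"
    if "l0 \<le> l" "0 < \<eta> l" for l
  proof
    show "\<forall>j\<le>l. 0 < \<eta> j"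
    proof (intro allI impI)
      fix j assume "j \<le> l"
      then have "0 < Cm * \<eta> j" using mono[of j l] that by simp
      then show "0 < \<eta> j" using Cm by (simp add: zero_less_mult_iff)
    qed
    show "(\<Sum>j<l. 1 / \<eta> j) \<le> 2 * (real l0 + real N) * Cm / \<eta> l"
      by (rule reciprocal_sum_le[OF \<eta>(1) mono Cm N that])
  qed
  then show ?thesis
    unfolding \<eta>_def[symmetric] by (intro exI[of _ "2 * (real l0 + real N) * Cm"]) simp
qed

end

section \<open>Nested meshes, nested spaces and estimator reduction\<close>

lemma refinements_trans:
  "\<T>' \<in> refinements D \<T> \<Longrightarrow> \<T>'' \<in> refinements D \<T>' \<Longrightarrow> \<T>'' \<in> refinements D \<T>"
  by (auto simp: refinements_def)

lemma refinements_refl: "conforming (Omega D) \<T> \<Longrightarrow> \<T> \<in> refinements D \<T>"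
  by (simp add: refinements_def)

lemma conforming_finite: "conforming \<Omega> \<T> \<Longrightarrow> finite \<T>"
  unfolding conforming_def triangulation_def by (elim conjE) (rule finite_imageD)

lemma child_elem:
  assumes "fst T \<noteq> []" "C \<in> {child1 T, child2 T}"
  shows "fst C \<noteq> [] \<and> elem C \<subseteq> elem T"
proof -
  have inner: "set (inner_verts T) \<subseteq> verts T"
    unfolding inner_verts_def verts_def by (cases "fst T") (auto dest: in_set_butlastD)
  have "set (rev_tail k zs) = set zs" for k and zs :: "(real^'a) list"
    by (metis append_take_drop_id rev_tail_def set_append set_rev)
  moreover have hl: "hd (fst T) \<in> verts T" "last (fst T) \<in> verts T"
    using assms(1) by (auto simp: verts_def)
  moreover have "midpoint (hd (fst T)) (last (fst T)) \<in> elem T"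
    unfolding elem_def using hl by (meson hull_inc midpoint_in_closed_segment convex_contains_segment convex_convex_hull subsetD)
  moreover have vT: "verts T \<subseteq> elem T" unfolding elem_def by (rule hull_subset)
  moreover have "set (inner_verts T) \<subseteq> elem T" using inner vT by (rule order_trans)
  moreover have "hd (fst T) \<in> elem T" "last (fst T) \<in> elem T" using hl vT by blast+
  ultimately have "verts C \<subseteq> elem T"
    using assms(2) by (auto simp: verts_def[of C] child1_def child2_def)
  then have "elem C \<subseteq> elem T" unfolding elem_def by (simp add: hull_minimal)
  then show ?thesis using assms(2) by (auto simp: child1_def child2_def)
qed

text \<open>Intermediate meshes of a bisection sequence need not be conforming, so the nonemptiness
  of vertex lists, on which \<open>hd\<close> and \<open>last\<close> depend, is part of the
  invariant.\<close>

lemma refinement_elem: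
  assumes "bisect\<^sup>*\<^sup>* \<T> \<T>'" "\<And>T. T \<in> \<T> \<Longrightarrow> fst T \<noteq> []"
  shows "\<forall>T'\<in>\<T>'. fst T' \<noteq> [] \<and> (\<exists>T\<in>\<T>. elem T' \<subseteq> elem T)"
  using assms(1)
proof (induction rule: rtranclp_induct)
  case (step \<S> \<S>')
  then obtain S where S: "S \<in> \<S>" "\<S>' = (\<S> - {S}) \<union> {child1 S, child2 S}" by (auto simp: bisect_def)
  show ?case
  proof
    fix T' assume "T' \<in> \<S>'"
    then consider "T' \<in> \<S>" | "T' \<in> {child1 S, child2 S}" using S(2) by blast
    then show "fst T' \<noteq> [] \<and> (\<exists>T\<in>\<T>. elem T' \<subseteq> elem T)"
    proof cases
      case 2
      then have "fst T' \<noteq> []" "elem T' \<subseteq> elem S" using child_elem[of S T'] step.IH S(1) by auto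
      then show ?thesis using step.IH S(1) by blast
    qed (use step.IH in blast)
  qed
qed (use assms(2) in blast)

lemma fe_space_mono:
  assumes "conforming (Omega D) \<T>" "\<T>' \<in> refinements D \<T>"
  shows "fe_space D p \<T> \<subseteq> fe_space D p \<T>'"
proof
  fix v assume v: "v \<in> fe_space D p \<T>"
  have "fst T \<noteq> []" if "T \<in> \<T>" for T
    using assms(1) that by (auto simp: conforming_def)
  then have *: "\<forall>T'\<in>\<T>'. \<exists>T\<in>\<T>. elem T' \<subseteq> elem T"
    using refinement_elem[of \<T> \<T>'] assms(2) by (auto simp: refinements_def)
  have "\<exists>q. poly_fun p q \<and> (\<forall>x\<in>elem T'. v x = q x)" if "T' \<in> \<T>'" for T'
    using * that v unfolding fe_space_def by blast
  then show "v \<in> fe_space D p \<T>'" using v by (simp add: fe_space_def)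
qed

lemma eta_sq_nonneg: "0 \<le> eta_sq D \<T> T v"
  unfolding eta_sq_def
  by (intro add_nonneg_nonneg mult_nonneg_nonneg sum_nonneg integral_nonneg_AE AE_I2) auto

lemma eta_nonneg: "0 \<le> eta D \<T> \<U> v"
  by (simp add: eta_def sum_nonneg eta_sq_nonneg)

lemma eta_power2: "(eta D \<T> \<U> v)\<^sup>2 = (\<Sum>T\<in>\<U>. eta_sq D \<T> T v)"
  by (simp add: eta_def sum_nonneg eta_sq_nonneg)

lemma eta_mono: "finite \<U>' \<Longrightarrow> \<U> \<subseteq> \<U>' \<Longrightarrow> (eta D \<T> \<U> v)\<^sup>2 \<le> (eta D \<T> \<U>' v)\<^sup>2"
  unfolding eta_power2 by (rule sum_mono2) (auto simp: eta_sq_nonneg)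

lemma eta_split:
  assumes "finite \<U>"
  shows "(eta D \<T> \<U> v)\<^sup>2 = (eta D \<T> (\<U> \<inter> \<V>) v)\<^sup>2 + (eta D \<T> (\<U> - \<V>) v)\<^sup>2"
  unfolding eta_power2 by (rule sum.Int_Diff[OF assms])

text \<open>Stability with the same function on both meshes shows that the contribution of unrefined
  elements is unchanged; refined ones shrink by \<open>qred\<close> and contain the marked ones.
  With \<open>\<theta> = 0\<close> and no marked element the same statement gives monotonicity under
  refinement. The hypothesis \<open>zero\<close> is kept separate because it depends on the
  linearity of \<open>form_b\<close>.\<close>

lemma estimator_reduction:
  assumes stab: "stability D \<T>0 p Cstab" and red: "reduction D \<T>0 p qred" and q: "0 < qred" "qred < 1"
    and T: "\<T> \<in> refinements D \<T>0" and T': "\<T>' \<in> refinements D \<T>"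
    and v: "v \<in> fe_space D p \<T>" and zero: "enorm D (\<lambda>x. v x - v x) = 0"
    and M: "\<M> \<subseteq> \<T>" "\<M> \<inter> \<T>' = {}" "\<theta> * (eta D \<T> \<T> v)\<^sup>2 \<le> (eta D \<T> \<M> v)\<^sup>2"
  shows "(eta D \<T>' \<T>' v)\<^sup>2 \<le> (1 - (1 - qred\<^sup>2) * \<theta>) * (eta D \<T> \<T> v)\<^sup>2"
proof -
  have conf: "conforming (Omega D) \<T>" "conforming (Omega D) \<T>'" using T T' by (auto simp: refinements_def)
  have v': "v \<in> fe_space D p \<T>'" using fe_space_mono[OF conf(1) T'] v by blast
  have "\<bar>eta D \<T>' (\<T>' \<inter> \<T>) v - eta D \<T> (\<T>' \<inter> \<T>) v\<bar> \<le> Cstab * enorm D (\<lambda>x. v x - v x)"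
    using stab T T' v v' unfolding stability_def by blast
  then have s: "eta D \<T>' (\<T>' \<inter> \<T>) v = eta D \<T> (\<T>' \<inter> \<T>) v" using zero by simp
  have "eta D \<T>' (\<T>' - \<T>) v \<le> qred * eta D \<T> (\<T> - \<T>') v"
    using red T T' v unfolding reduction_def by blast
  then have r: "(eta D \<T>' (\<T>' - \<T>) v)\<^sup>2 \<le> qred\<^sup>2 * (eta D \<T> (\<T> - \<T>') v)\<^sup>2"
    using power_mono[OF _ eta_nonneg, of D \<T>' "\<T>' - \<T>" v "qred * eta D \<T> (\<T> - \<T>') v" 2]
    by (simp add: power_mult_distrib)
  have "(eta D \<T> \<M> v)\<^sup>2 \<le> (eta D \<T> (\<T> - \<T>') v)\<^sup>2"
    using M conforming_finite[OF conf(1)] by (intro eta_mono) auto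
  then have m: "\<theta> * (eta D \<T> \<T> v)\<^sup>2 \<le> (eta D \<T> (\<T> - \<T>') v)\<^sup>2" using M(3) by linarith
  have q2: "0 \<le> 1 - qred\<^sup>2" using q by (simp add: power_le_one)
  have "(eta D \<T>' \<T>' v)\<^sup>2 \<le> (eta D \<T> (\<T> \<inter> \<T>') v)\<^sup>2 + qred\<^sup>2 * (eta D \<T> (\<T> - \<T>') v)\<^sup>2"
    using eta_split[OF conforming_finite[OF conf(2)], of D \<T>' v \<T>] r s by (simp add: Int_commute)
  also have "\<dots> = (eta D \<T> \<T> v)\<^sup>2 - (1 - qred\<^sup>2) * (eta D \<T> (\<T> - \<T>') v)\<^sup>2"
    using eta_split[OF conforming_finite[OF conf(1)], of D \<T> v \<T>'] by (simp add: algebra_simps)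
  also have "\<dots> \<le> (eta D \<T> \<T> v)\<^sup>2 - (1 - qred\<^sup>2) * (\<theta> * (eta D \<T> \<T> v)\<^sup>2)"
    using mult_left_mono[OF m q2] by simp
  finally show ?thesis by (simp only: left_diff_distrib mult.assoc mult_1)
qed

section \<open>Runs of the algorithm\<close>

text \<open>The real \<open>sqrt\<close> is odd, so \<open>enorm\<close> would be negative if
  \<open>form_a\<close> were. The absolute value makes the bound independent of a sign argument for
  \<open>form_a\<close>.\<close>

lemma enorm_le_sqrt_form_b:
  assumes "0 < Cell" "Cell * (enorm D v)\<^sup>2 \<le> form_b D v v"
  shows "\<bar>enorm D v\<bar> \<le> sqrt (form_b D v v) / sqrt Cell"
proof -
  have "(enorm D v)\<^sup>2 \<le> form_b D v v / Cell"
    using assms by (simp add: pos_le_divide_eq mult.commute)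
  then have "sqrt ((enorm D v)\<^sup>2) \<le> sqrt (form_b D v v / Cell)" by (rule real_sqrt_le_mono)
  then show ?thesis by (simp add: real_sqrt_divide)
qed

lemma form_b_bounded_form:
  assumes model: "model_problem D" and const: "0 < Cell" "Cell \<le> Cbnd"
    and bounded: "\<And>v w. v \<in> H10 (Omega D) \<Longrightarrow> w \<in> H10 (Omega D) \<Longrightarrow>
          \<bar>form_b D v w\<bar> \<le> Cbnd * enorm D v * enorm D w"
    and elliptic: "\<And>v. v \<in> H10 (Omega D) \<Longrightarrow> Cell * (enorm D v)\<^sup>2 \<le> form_b D v v"
  shows "bounded_form (H10 (Omega D)) (form_b D) (Cbnd / Cell)"
proof
  have H1: "v \<in> H1 (Omega D)" if "v \<in> H10 (Omega D)" for v using that by (simp add: H10_def)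
  fix u v w s t
  assume u: "u \<in> H10 (Omega D)" and v: "v \<in> H10 (Omega D)"
  show "lc s u t v \<in> H10 (Omega D)"
    unfolding lc_def by (rule H10_lin[OF model_problem_facts(1)[OF model] u v])
  assume w: "w \<in> H10 (Omega D)"
  show "form_b D (lc s u t v) w = s * form_b D u w + t * form_b D v w"
    unfolding lc_def by (rule form_b_lin(1)[OF model H1[OF u] H1[OF v] H1[OF w]])
  show "form_b D w (lc s u t v) = s * form_b D w u + t * form_b D w v"
    unfolding lc_def by (rule form_b_lin(2)[OF model H1[OF u] H1[OF v] H1[OF w]])
next
  fix v assume v: "v \<in> H10 (Omega D)"
  have "0 \<le> Cell * (enorm D v)\<^sup>2" using const by simp
  then show "0 \<le> form_b D v v" using elliptic[OF v] by linarith
next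
  fix v w assume v: "v \<in> H10 (Omega D)" and w: "w \<in> H10 (Omega D)"
  have "Cbnd * enorm D v * enorm D w \<le> Cbnd * (\<bar>enorm D v\<bar> * \<bar>enorm D w\<bar>)"
    using const by (simp add: mult.assoc flip: abs_mult)
  also have "\<dots> \<le> Cbnd * ((sqrt (form_b D v v) / sqrt Cell) * (sqrt (form_b D w w) / sqrt Cell))"
    using const enorm_le_sqrt_form_b[OF const(1) elliptic[OF v]] enorm_le_sqrt_form_b[OF const(1) elliptic[OF w]]
    by (intro mult_left_mono mult_mono) auto
  also have "\<dots> = Cbnd / Cell * sqrt (form_b D v v) * sqrt (form_b D w w)"
    using const by simp
  finally show "\<bar>form_b D v w\<bar> \<le> Cbnd / Cell * sqrt (form_b D v v) * sqrt (form_b D w w)"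
    using bounded[OF v w] by linarith
next
  show "0 \<le> Cbnd / Cell" using const by simp
qed

lemma run_parameters:
  assumes run: "afem_pgmres D p \<T>0 \<theta> Cmark u00 Calg0 lam0 kmax \<tau> R"
    and all: "\<And>l. completes D \<tau> R l"
  shows "Calg R l = Calg0 * 2 ^ card {j. j < l \<and> update_at D R j}"
    and "lam R l = lam0 / 2 ^ card {j. j < l \<and> update_at D R j}"
    and "Ssum R l = (\<Sum>j<l. inverse (ennreal (final_error D R j)))"
proof (induction l)
  case (Suc l)
  have "{j. j < Suc l \<and> update_at D R j} =
      (if update_at D R l then insert l {j. j < l \<and> update_at D R j} else {j. j < l \<and> update_at D R j})"
    by (auto simp: less_Suc_eq)
  then have card: "card {j. j < Suc l \<and> update_at D R j} =
      card {j. j < l \<and> update_at D R j} + (if update_at D R l then 1 else 0)"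
    by simp
  have "Calg R (Suc l) = (if update_at D R l then 2 * Calg R l else Calg R l)"
    "lam R (Suc l) = (if update_at D R l then lam R l / 2 else lam R l)"
    "Ssum R (Suc l) = Ssum R l + inverse (ennreal (final_error D R l))"
    using run all[of l] unfolding afem_pgmres_def by blast+
  then show "Calg R (Suc l) = Calg0 * 2 ^ card {j. j < Suc l \<and> update_at D R j}"
    "lam R (Suc l) = lam0 / 2 ^ card {j. j < Suc l \<and> update_at D R j}"
    "Ssum R (Suc l) = (\<Sum>j<Suc l. inverse (ennreal (final_error D R j)))"
    using Suc.IH unfolding card by simp_all
qed (use run in \<open>auto simp: afem_pgmres_def\<close>)

lemma infinite_card_less_unbounded:
  assumes "infinite {j::nat. P j}"
  shows "\<exists>l0. \<forall>l\<ge>l0. n \<le> card {j. j < l \<and> P j}"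
proof -
  obtain F where F: "F \<subseteq> {j. P j}" "finite F" "card F = n"
    using infinite_arbitrarily_large[OF assms] by blast
  have "n \<le> card {j. j < l \<and> P j}" if "Suc (Max (insert 0 F)) \<le> l" for l
  proof -
    have "x < l" if "x \<in> F" for x
      using that F(2) \<open>Suc (Max (insert 0 F)) \<le> l\<close> by (meson Max_ge finite_insert insertI2 le_imp_less_Suc less_le_trans)
    then have "F \<subseteq> {j. j < l \<and> P j}" using F(1) by blast
    then show ?thesis using F(3) card_mono[of "{j. j < l \<and> P j}" F] by simp
  qed
  then show ?thesis by blast
qed

text \<open>For a vanishing quasi-error the right-hand side of the test is infinite, because
  \<open>Calg\<close> is positive, and the test fails by itself. Otherwise all earlier quasi-errors
  are positive and the test is an inequality between reals.\<close>

lemma no_update_of_sum_le: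
  assumes S: "Ssum R l = (\<Sum>j<l. inverse (ennreal (final_error D R j)))" and C: "0 < Calg R l"
    and nonneg: "0 \<le> final_error D R l"
    and A: "0 < final_error D R l \<Longrightarrow> (\<forall>j\<le>l. 0 < final_error D R j) \<and>
      (\<Sum>j<l. 1 / final_error D R j) \<le> A / final_error D R l" and "A \<le> Calg R l"
  shows "\<not> update_at D R l"
proof (cases "final_error D R l = 0")
  case True
  then show ?thesis using C by (simp add: update_at_def ennreal_mult_top)
next
  case False
  then have pos: "0 < final_error D R l" using nonneg by simp
  have "Ssum R l = (\<Sum>j<l. ennreal (1 / final_error D R j))"
    unfolding S using A[OF pos] by (intro sum.cong) (auto simp: inverse_ennreal inverse_eq_divide)
  also have "\<dots> = ennreal (\<Sum>j<l. 1 / final_error D R j)"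
    using A[OF pos] by (intro sum_ennreal) (simp add: less_imp_le)
  also have "\<dots> \<le> ennreal (Calg R l / final_error D R l)"
  proof (rule ennreal_leI)
    have "A / final_error D R l \<le> Calg R l / final_error D R l"
      using \<open>A \<le> Calg R l\<close> pos by (intro divide_right_mono) auto
    then show "(\<Sum>j<l. 1 / final_error D R j) \<le> Calg R l / final_error D R l"
      using A[OF pos] by linarith
  qed
  also have "\<dots> = ennreal (Calg R l) * inverse (ennreal (final_error D R l))"
    using pos C by (simp add: inverse_ennreal ennreal_mult[symmetric] divide_inverse)
  finally show ?thesis by (simp add: update_at_def not_less)
qed

theorem lemma19:
  fixes D :: "('d::finite) pde_data" and \<T>0 :: "'d mesh" and p kmax :: nat
    and ustar u00 :: "real^'d \<Rightarrow> real" and R :: "'d afem_run"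
    and Cell Cbnd Cstab qred Crel Cpre \<theta> Cmark Calg0 lam0 \<tau> :: real
  assumes model: "model_problem D"
    and init: "initial_mesh D \<T>0"
    and constants: "0 < Cell" "Cell \<le> Cbnd"
    and bounded: "\<And>v w. v \<in> H10 (Omega D) \<Longrightarrow> w \<in> H10 (Omega D) \<Longrightarrow>
          \<bar>form_b D v w\<bar> \<le> Cbnd * enorm D v * enorm D w"
    and elliptic: "\<And>v. v \<in> H10 (Omega D) \<Longrightarrow> Cell * (enorm D v)\<^sup>2 \<le> form_b D v v"
    and exact: "exact_solution D ustar"
    and A1: "0 < Cstab" "stability D \<T>0 p Cstab"
    and A2: "0 < qred" "qred < 1" "reduction D \<T>0 p qred"
    and A3: "0 < Crel" "reliability D \<T>0 p ustar Crel"
    and params: "0 < \<theta>" "\<theta> \<le> 1" "1 \<le> Cmark" "0 < lam0" "0 < Calg0" "1 \<le> kmax"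
    and start: "u00 \<in> fe_space D p \<T>0"
    and tol: "\<tau> < 0"
    and run: "afem_pgmres D p \<T>0 \<theta> Cmark u00 Calg0 lam0 kmax \<tau> R"
    and PRE: "1 \<le> Cpre" "norm_equivalence D \<tau> R Cpre"
  shows "finite (parameter_updates D \<tau> R)"
proof (rule ccontr)
  assume "infinite (parameter_updates D \<tau> R)"
  \<comment> \<open>\<open>completes\<close> includes all earlier levels, so arbitrarily late
    updates complete every level.\<close>
  have all: "completes D \<tau> R l" for l
  proof -
    obtain k where "k \<ge> l" "k \<in> parameter_updates D \<tau> R"
      using \<open>infinite _\<close> by (meson finite_nat_set_iff_bounded_le nat_le_linear)
    then show ?thesis by (auto simp: parameter_updates_def completes_def)
  qed
  then have reached: "reached D \<tau> R l" for l by (simp add: reached_def)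
  have "parameter_updates D \<tau> R = {l. update_at D R l}"
    using all by (simp add: parameter_updates_def)
  then have inf: "infinite {l. update_at D R l}" using \<open>infinite _\<close> by simp
  note par = run_parameters[OF run all]

  define \<T> where "\<T> = mesh_at R"
  define V where "V l = fe_space D p (\<T> l)" for l
  define k where "k = kfin D R"
  define u where "u l = iterate R l (k l)" for l
  define \<alpha> where "\<alpha> l = eta D (\<T> l) (\<T> l) (u l)" for l
  define \<rho> where "\<rho> l = residual_norm D R l (k l)" for l
  let ?H = "H10 (Omega D)"

  have basis: "is_basis (ndof R l) (basis_at R l) (V l)"
    and spd: "spd_mat (ndof R l) (precond R l)"
    and gmres: "pgmres kmax (precond R l) (Bmat D R l) (dvec D R l) (coeffs R l)" for l
    using run reached[of l] unfolding afem_pgmres_def V_def \<T>_def by blast+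
  have mark: "doerfler D \<theta> R l (marked R l)"
    and refine: "is_refine D (\<T> l) (marked R l) (\<T> (Suc l))" for l
    using run all[of l] unfolding afem_pgmres_def \<T>_def by blast+
  have T0: "\<T> 0 = \<T>0" using run by (simp add: afem_pgmres_def \<T>_def)
  have stop: "stop_crit D R l (k l)" for l
    using all[of l] LeastI_ex[of "stop_crit D R l"]
    by (auto simp: completes_def solver_stops_def k_def kfin_def)
  have final: "final_error D R l = \<alpha> l + \<rho> l" for l
    by (simp add: final_error_def quasi_error_def eta_at_def \<alpha>_def \<rho>_def u_def k_def \<T>_def)

  have step: "\<T> (Suc l) \<in> refinements D (\<T> l)" for l
    using refine[of l] by (simp add: is_refine_def)
  have conf: "conforming (Omega D) (\<T> l)" for l
    using init step by (cases l) (auto simp: T0 initial_mesh_def refinements_def)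
  have refs: "\<T> m \<in> refinements D (\<T> l)" if "l \<le> m" for l m
    using that
  proof (induction m rule: dec_induct)
    case base
    show ?case by (rule refinements_refl[OF conf])
  next
    case (step m)
    then show ?case using refinements_trans \<open>\<And>l. \<T> (Suc l) \<in> refinements D (\<T> l)\<close> by blast
  qed
  have refs0: "\<T> l \<in> refinements D \<T>0" for l using refs[of 0 l] T0 by simp
  have V_mono: "V l \<subseteq> V m" if "l \<le> m" for l m
    unfolding V_def by (rule fe_space_mono[OF conf refs[OF that]])
  have V_H: "V l \<subseteq> ?H" for l by (auto simp: V_def fe_space_def)

  interpret fe_form "?H" "form_b D" "Cbnd / Cell"
    unfolding fe_form_def by (rule form_b_bounded_form[OF model constants bounded elliptic])
  have ustar: "ustar \<in> ?H" and ustar_eq: "\<And>v. v \<in> ?H \<Longrightarrow> form_b D ustar v = rhs_F D v"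
    using exact by (auto simp: exact_solution_def)

  have Bd: "Bmat D R l \<in> carrier_mat (ndof R l) (ndof R l)" "dvec D R l \<in> carrier_vec (ndof R l)" for l
    by (simp_all add: Bmat_def system_mat_def dvec_def load_vec_def)
  have carr: "coeffs R l i \<in> carrier_vec (ndof R l)" for l i
    by (rule pgmres_carrier[OF gmres spd_carrier[OF spd] Bd])
  have u_V: "u l \<in> V l" for l
    using basis[of l] carr[of l "k l"] unfolding u_def iterate_def is_basis_def by blast
  have u_H: "u l \<in> ?H" for l using u_V V_H by blast
  have pinv_le: "inverse Cpre * enorm D (fe_fun (basis_at R l) x) \<le> pinv_norm (precond R l) x"
    and le_pinv: "pinv_norm (precond R l) x \<le> Cpre * enorm D (fe_fun (basis_at R l) x)"
    if "x \<in> carrier_vec (ndof R l)" for l x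
    using PRE(2) reached that unfolding norm_equivalence_def by blast+
  have Cpre: "0 < Cpre" using PRE(1) by simp
  \<comment> \<open>The sign is read off from the norm equivalence: a nonnegative preconditioner
    norm is at most \<open>Cpre\<close> times \<open>enorm\<close>.\<close>
  have enorm_nonneg: "0 \<le> enorm D v" if v: "v \<in> V l" for v l
  proof -
    obtain x where x: "x \<in> carrier_vec (ndof R l)" "v = fe_fun (basis_at R l) x"
      using v basis[of l] unfolding is_basis_def by blast
    have "0 \<le> Cpre * enorm D v"
      using pinv_norm_nonneg[OF spd x(1)] le_pinv[OF x(1)] x(2) by simp
    then show ?thesis using Cpre by (simp add: zero_le_mult_iff)
  qed
  have enorm_le: "enorm D v \<le> nrm v / sqrt Cell" if "v \<in> ?H" for v
    using enorm_le_sqrt_form_b[OF constants(1) elliptic[OF that]] by (simp add: nrm_def)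
  have V_lc: "lc s v t w \<in> V l" if "v \<in> V l" "w \<in> V l" for v w s t l
    by (rule basis_lc[OF basis that])

  define Ca where "Ca = Cpre / sqrt Cell"
  have "\<forall>l. \<exists>g. g \<in> V l \<and> (\<forall>v\<in>V l. form_b D g v = form_b D ustar v) \<and>
      dst g (u l) \<le> Ca * \<rho> l"
  proof
    fix l
    let ?N = "ndof R l" and ?\<phi> = "basis_at R l"
    \<comment> \<open>The exact solution represents the load functional by the form, as the abstract
      existence lemma requires.\<close>
    have "rhs_F D (?\<phi> j) = form_b D ustar (?\<phi> j)" if "j < ?N" for j
      using ustar_eq basis_mem[OF basis that] V_H by (metis subsetD)
    then have d: "dvec D R l = Matrix.vec ?N (\<lambda>j. form_b D ustar (?\<phi> j))"
      by (auto simp: dvec_def load_vec_def)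
    have B: "Bmat D R l = Matrix.mat ?N ?N (\<lambda>(j, k). form_b D (?\<phi> k) (?\<phi> j))"
      by (simp add: Bmat_def system_mat_def)
    have "\<exists>g\<in>V l. (\<forall>v\<in>V l. form_b D g v = form_b D ustar v) \<and>
      (\<forall>x\<in>carrier_vec ?N. dst g (fe_fun ?\<phi> x) \<le>
        Cpre / sqrt Cell * pinv_norm (precond R l) (presid (precond R l) (Bmat D R l) (dvec D R l) x))"
      unfolding d B
      by (rule galerkin_exists_residual_bound[OF basis V_H spd ustar Cpre _ _ constants(1) elliptic])
        (fact pinv_le le_pinv)+
    then show "\<exists>g. g \<in> V l \<and> (\<forall>v\<in>V l. form_b D g v = form_b D ustar v) \<and> dst g (u l) \<le> Ca * \<rho> l"
      using carr[of l "k l"] unfolding u_def iterate_def \<rho>_def residual_norm_def Ca_def by blast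
  qed
  then obtain g where g: "\<And>l. g l \<in> V l" "\<And>l v. v \<in> V l \<Longrightarrow> form_b D (g l) v = form_b D ustar v"
      "\<And>l. dst (g l) (u l) \<le> Ca * \<rho> l"
    using choice[of "\<lambda>l g. g \<in> V l \<and> (\<forall>v\<in>V l. form_b D g v = form_b D ustar v) \<and> dst g (u l) \<le> Ca * \<rho> l"]
    by blast
  interpret galerkin_sequence "?H" "form_b D" "Cbnd / Cell" V g
  proof
    show "form_b D (g m) v = form_b D (g j) v" if "j \<le> m" "v \<in> V j" for j m v
      using g(2)[of v m] g(2)[of v j] V_mono[OF that(1)] that(2) by auto
  qed (rule V_H V_mono V_lc g(1); assumption)+

  have gal_sol: "galerkin_solution D p (\<T> l) (g l)" for l
    unfolding galerkin_solution_def V_def[symmetric]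
  proof (intro conjI ballI)
    fix v assume v: "v \<in> V l"
    then have "v \<in> ?H" using V_H by blast
    then show "form_b D (g l) v = rhs_F D v" using g(2)[OF v] ustar_eq by simp
  qed (rule g(1))
  define Cs where "Cs = Cstab / sqrt Cell"
  have Cs: "0 \<le> Cs" using A1(1) constants(1) by (simp add: Cs_def)
  have Ca: "0 \<le> Ca" using Cpre constants(1) by (simp add: Ca_def)
  have dist_enorm: "enorm D (\<lambda>x. v x - w x) \<le> dst v w / sqrt Cell" if "v \<in> ?H" "w \<in> ?H" for v w
    using enorm_le[OF lc_closed[OF that, of 1 "-1"]] by (simp add: dst_def lc_def)
  \<comment> \<open>Stability with equal coarse and fine mesh, converted from \<open>enorm\<close>
    to \<open>nrm\<close>.\<close>
  have eta_lip: "eta D (\<T> l) (\<T> l) v \<le> eta D (\<T> l) (\<T> l) w + Cs * dst v w"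
    if "v \<in> V l" "w \<in> V l" for v w l
  proof -
    have "\<bar>eta D (\<T> l) (\<T> l \<inter> \<T> l) v - eta D (\<T> l) (\<T> l \<inter> \<T> l) w\<bar> \<le> Cstab * enorm D (\<lambda>x. v x - w x)"
      using A1(2) refs0[of l] refs[of l l] that unfolding stability_def V_def by blast
    also have "\<dots> \<le> Cstab * (dst v w / sqrt Cell)"
      using A1(1) dist_enorm[of v w] that V_H[of l] by (intro mult_left_mono) auto
    finally show ?thesis by (simp add: Cs_def)
  qed
  have enorm0: "enorm D (\<lambda>x. v x - v x) = 0" if "v \<in> V l" for v l
  proof (rule antisym)
    have "v \<in> ?H" using that V_H by blast
    then show "enorm D (\<lambda>x. v x - v x) \<le> 0"
      using dist_enorm[of v v] nrm_sq_lc[of v v 1 "-1"] constants(1) by (simp add: dst_def nrm_sq)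
    show "0 \<le> enorm D (\<lambda>x. v x - v x)"
      using enorm_nonneg[OF V_lc[OF that that, of 1 "-1"]] by (simp add: lc_def)
  qed
  \<comment> \<open>Reduction holds for squares. \<open>\<theta> \<le> 1\<close> keeps the radicand
    nonnegative and \<open>\<theta> > 0\<close> makes \<open>q < 1\<close>.\<close>
  define q where "q = sqrt (1 - (1 - qred\<^sup>2) * \<theta>)"
  have "qred\<^sup>2 < 1" using A2 by (simp add: power_less_one_iff)
  then have q2: "0 < 1 - qred\<^sup>2" "1 - qred\<^sup>2 \<le> 1" by auto
  have "(1 - qred\<^sup>2) * \<theta> \<le> 1" using q2 params by (intro mult_le_one) auto
  then have q: "0 \<le> q" "q < 1" using q2 params by (auto simp: q_def real_sqrt_lt_1_iff)
  have eta_refine: "eta D (\<T> (Suc l)) (\<T> (Suc l)) (u l) \<le> q * \<alpha> l" for l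
  proof -
    have "(eta D (\<T> (Suc l)) (\<T> (Suc l)) (u l))\<^sup>2 \<le> (1 - (1 - qred\<^sup>2) * \<theta>) * (eta D (\<T> l) (\<T> l) (u l))\<^sup>2"
    proof (rule estimator_reduction[OF A1(2) A2(3,1,2) refs0 step])
      show "u l \<in> fe_space D p (\<T> l)" using u_V by (simp add: V_def)
      show "enorm D (\<lambda>x. u l x - u l x) = 0" by (rule enorm0[OF u_V])
      show "marked R l \<subseteq> \<T> l" "\<theta> * (eta D (\<T> l) (\<T> l) (u l))\<^sup>2 \<le> (eta D (\<T> l) (marked R l) (u l))\<^sup>2"
        using mark[of l] by (auto simp: doerfler_def \<T>_def eta_at_def u_def k_def)
      show "marked R l \<inter> \<T> (Suc l) = {}" using refine[of l] by (simp add: is_refine_def)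
    qed
    then have "(eta D (\<T> (Suc l)) (\<T> (Suc l)) (u l))\<^sup>2 \<le> (q * \<alpha> l)\<^sup>2"
      using \<open>(1 - qred\<^sup>2) * \<theta> \<le> 1\<close> by (simp add: q_def \<alpha>_def power_mult_distrib)
    then show ?thesis
      by (rule power2_le_imp_le) (simp add: q \<alpha>_def eta_nonneg)
  qed
  have eta_coarse: "eta D (\<T> m) (\<T> m) (u l) \<le> \<alpha> l" if "l \<le> m" for l m
  proof -
    have "(eta D (\<T> m) (\<T> m) (u l))\<^sup>2 \<le> (1 - (1 - qred\<^sup>2) * 0) * (eta D (\<T> l) (\<T> l) (u l))\<^sup>2"
      using u_V[of l] enorm0[OF u_V[of l]]
      by (intro estimator_reduction[OF A1(2) A2(3,1,2) refs0 refs[OF that], where \<M> = "{}"]) (auto simp: V_def)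
    then have "(eta D (\<T> m) (\<T> m) (u l))\<^sup>2 \<le> (\<alpha> l)\<^sup>2" by (simp add: \<alpha>_def)
    then show ?thesis by (rule power2_le_imp_le) (simp add: \<alpha>_def eta_nonneg)
  qed
  define C2 where "C2 = Cbnd * Crel / sqrt Cell"
  have C2: "0 \<le> C2" using constants A3(1) by (simp add: C2_def)
  \<comment> \<open>The difference \<open>e\<close> lies in the finer space, where
    \<open>g m\<close> and \<open>ustar\<close> act alike. Hence
    \<open>b e e = b (ustar - g l) e\<close>, and reliability on the coarser mesh controls the first
    argument.\<close>
  have gal_dist: "dst (g m) (g l) \<le> C2 * eta D (\<T> l) (\<T> l) (g l)" if "l \<le> m" for l m
  proof -
    define e where "e = lc 1 (g m) (-1) (g l)"
    let ?\<eta> = "eta D (\<T> l) (\<T> l) (g l)"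
    have e: "e \<in> V m" unfolding e_def using V_lc g(1) V_mono[OF that] by blast
    then have eH: "e \<in> ?H" using V_H by blast
    have d: "lc 1 ustar (-1) (g l) \<in> ?H" by (rule lc_closed[OF ustar g_H])
    have "form_b D e e = form_b D (g m) e - form_b D (g l) e"
      unfolding e_def using b_left[OF g_H g_H eH, of 1 m "-1" l] by (simp add: e_def)
    also have "\<dots> = form_b D (lc 1 ustar (-1) (g l)) e"
      using b_left[OF ustar g_H eH, of 1 "-1" l] g(2)[OF e] by simp
    also have "\<dots> \<le> Cbnd * enorm D (lc 1 ustar (-1) (g l)) * enorm D e"
      using bounded[OF d eH] by simp
    also have "\<dots> \<le> Cbnd * (Crel * ?\<eta>) * enorm D e"
    proof (intro mult_right_mono mult_left_mono)
      show "enorm D (lc 1 ustar (-1) (g l)) \<le> Crel * ?\<eta>"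
        using A3(2) refs0[of l] gal_sol[of l] unfolding reliability_def by (simp add: lc_def)
    qed (use constants enorm_nonneg[OF e] in auto)
    also have "\<dots> \<le> Cbnd * (Crel * ?\<eta>) * (nrm e / sqrt Cell)"
      using constants A3(1) eta_nonneg[of D "\<T> l" "\<T> l" "g l"]
      by (intro mult_left_mono enorm_le[OF eH]) auto
    finally have "nrm e * nrm e \<le> nrm e * (C2 * ?\<eta>)"
      using nrm_sq[OF eH] by (simp add: C2_def power2_eq_square mult_ac)
    moreover have "0 \<le> C2 * ?\<eta>" using C2 eta_nonneg[of D "\<T> l" "\<T> l" "g l"] by simp
    moreover have "0 \<le> nrm e" by (rule nrm_nonneg[OF eH])
    ultimately have "nrm e \<le> C2 * ?\<eta>" by (metis less_le mult_le_cancel_left_pos)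
    then show ?thesis by (simp add: dst_def e_def)
  qed
  have \<alpha>: "0 \<le> \<alpha> l" for l by (simp add: \<alpha>_def eta_nonneg)
  have \<rho>: "0 \<le> \<rho> l" for l
    unfolding \<rho>_def residual_norm_def presid_def
    by (intro pinv_norm_nonneg[OF spd] mult_mat_vec_carrier[OF spd_carrier[OF spd]]
        minus_carrier_vec mult_mat_vec_carrier[OF _ carr] Bd)
  have gal: "dst (g m) (g l) \<le> C2 * (1 + Cs * Ca) * (\<alpha> l + \<rho> l)" if "l \<le> m" for l m
  proof -
    have "eta D (\<T> l) (\<T> l) (g l) \<le> \<alpha> l + Cs * dst (g l) (u l)"
      using eta_lip[OF g(1) u_V] by (simp add: \<alpha>_def)
    also have "\<dots> \<le> \<alpha> l + Cs * (Ca * \<rho> l)"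
      using g(3) Cs by (intro add_left_mono mult_left_mono)
    also have "\<dots> \<le> (1 + Cs * Ca) * (\<alpha> l + \<rho> l)"
      using \<alpha>[of l] \<rho>[of l] mult_nonneg_nonneg[OF mult_nonneg_nonneg[OF Cs Ca] \<alpha>[of l]]
      by (simp add: algebra_simps)
    finally show ?thesis
      using gal_dist[OF that] C2 mult_left_mono[of _ _ C2] by fastforce
  qed
  have stab: "\<alpha> m \<le> \<alpha> l + Cs * dst (u m) (u l)" if "l \<le> m" for l m
    using eta_lip[OF u_V, of "u l" m] u_V[of l] V_mono[OF that] eta_coarse[OF that]
    by (fastforce simp: \<alpha>_def)
  have red: "\<alpha> (Suc l) \<le> q * \<alpha> l + Cs * dst (u (Suc l)) (u l)" for l
    using eta_lip[OF u_V, of "u l" "Suc l"] u_V[of l] V_mono[of l "Suc l"] eta_refine[of l]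
    by (fastforce simp: \<alpha>_def)

  have CsCa: "0 \<le> Cs * Ca" using Cs Ca by simp
  then have Cd: "0 \<le> C2 * (1 + Cs * Ca)" using C2 by simp
  \<comment> \<open>The two arguments of \<open>min\<close> are the two smallness conditions of
    \<open>reciprocal_sums_bounded\<close>; the second allows both residual terms in the reduction
    to be absorbed.\<close>
  define \<mu> where "\<mu> = min 1 ((1 - q) / (4 * (Cs * Ca + 1)))"
  have \<mu>: "0 < \<mu>" "\<mu> \<le> 1" using q CsCa by (auto simp: \<mu>_def)
  have "Cs * Ca * \<mu> \<le> (Cs * Ca + 1) * ((1 - q) / (4 * (Cs * Ca + 1)))"
    using CsCa q by (intro mult_mono) (auto simp: \<mu>_def)
  also have "\<dots> = (1 - q) / 4" using CsCa by (simp add: field_simps)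
  finally have \<mu>': "Cs * Ca * \<mu> \<le> (1 - q) / 4" .
  \<comment> \<open>After \<open>n0\<close> updates \<open>lam\<close> has been halved often enough,
    by \<open>n < 2 ^ n\<close>.\<close>
  obtain n0 :: nat where n0: "lam0 / \<mu> < real n0" using reals_Archimedean2 by blast
  obtain l0 where l0: "\<And>l. l0 \<le> l \<Longrightarrow> n0 \<le> card {j. j < l \<and> update_at D R j}"
    using infinite_card_less_unbounded[OF inf] by blast
  have lam: "lam R l \<le> \<mu>" if "l0 \<le> l" for l
  proof -
    have "lam0 / \<mu> \<le> 2 ^ card {j. j < l \<and> update_at D R j}"
      using n0 l0[OF that] of_nat_less_two_power[of "card {j. j < l \<and> update_at D R j}", where 'a = real]
      by linarith
    then show ?thesis unfolding par(2) using \<mu>(1) by (simp add: field_simps)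
  qed
  have small: "\<rho> l \<le> \<mu> * \<alpha> l" if "l0 \<le> l" for l
  proof -
    have "\<rho> l \<le> lam R l * \<alpha> l"
      using stop[of l] by (simp add: stop_crit_def \<rho>_def \<alpha>_def eta_at_def u_def \<T>_def)
    also have "\<dots> \<le> \<mu> * \<alpha> l" by (intro mult_right_mono lam that \<alpha>)
    finally show ?thesis .
  qed
  \<comment> \<open>\<open>A\<close> is independent of \<open>l\<close>, so the doubled
    \<open>Calg\<close> eventually exceeds it; an update level beyond both \<open>l0\<close> and
    \<open>l1\<close> is then contradictory.\<close>
  obtain A where A: "\<And>l. l0 \<le> l \<Longrightarrow> 0 < \<alpha> l + \<rho> l \<Longrightarrow>
    (\<forall>j\<le>l. 0 < \<alpha> j + \<rho> j) \<and> (\<Sum>j<l. 1 / (\<alpha> j + \<rho> j)) \<le> A / (\<alpha> l + \<rho> l)"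
    using reciprocal_sums_bounded[OF u_H \<alpha> \<rho> g(3) gal stab red small \<mu>(2) \<mu>' q Ca Cd Cs] by blast
  obtain n1 :: nat where n1: "A / Calg0 < real n1" using reals_Archimedean2 by blast
  obtain l1 where l1: "\<And>l. l1 \<le> l \<Longrightarrow> n1 \<le> card {j. j < l \<and> update_at D R j}"
    using infinite_card_less_unbounded[OF inf] by blast
  have "\<exists>l\<ge>max l0 l1. l \<in> {l. update_at D R l}"
    using inf unfolding infinite_nat_iff_unbounded_le by (rule spec)
  then obtain l where l: "max l0 l1 \<le> l" "update_at D R l" unfolding mem_Collect_eq by (elim exE conjE)
  have "A / Calg0 \<le> 2 ^ card {j. j < l \<and> update_at D R j}"
    using n1 l1[of l] l(1) of_nat_less_two_power[of "card {j. j < l \<and> update_at D R j}", where 'a = real]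
    by linarith
  then have "A \<le> Calg R l" unfolding par(1) using params by (simp add: field_simps)
  moreover have "0 < Calg R l" unfolding par(1) using params by simp
  ultimately have "\<not> update_at D R l"
    using no_update_of_sum_le[OF par(3), of l A] A[of l] l(1) \<alpha>[of l] \<rho>[of l] by (simp add: final)
  then show False using l(2) by blast
qed

end
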